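(* Let $1\le g\le r$ and let $\Gamma=(\gamma_1,\dots,\gamma_r)$ be a tuple of symmetric noncommutative polynomials in $x_1,\dots,x_g$ with $\gamma_j=x_j$ for $1\le j\le g$. (a) Let $A=(A_1,\dots,A_g)$ be a semi-finite tuple of bounded self-adjoint operators on a Hilbert space $\mathcal H$ and let $\mathcal R=\mathcal R^\Gamma_A=\operatorname{span}\{I_{\mathcal H},\gamma_1(A),\dots,\gamma_r(A)\}$. If $I_{\mathcal H},\gamma_1(A),\dots,\gamma_r(A)$ are linearly independent, then $\mathcal R$ and $\widehat{W^\Gamma(A)}$ are isomorphic $\Gamma$-operator systems. (b) Suppose $\Gamma(0)=0$ and let $\boldsymbol K\subseteq\mathbb S^g$ be a closed and bounded $\Gamma$-convex set with $0\in K_1$. If $\boldsymbol K=\Gamma^{-1}\big(\overline{\operatorname{matco}}(\Gamma(\boldsymbol K))\big)$, then $\boldsymbol K=W^\Gamma(\widehat Y)$, where $\widehat Y=\bigoplus_{Y\in\boldsymbol K}Y$.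
   Context: Polynomials. $\mathbb C\langle x\rangle$ is the free algebra in noncommuting variables $x_1,\dots,x_g$ with the conjugate-linear involution satisfying $x_j^*=x_j$ and $(uw)^*=w^*u^*$; $q$ is symmetric if $q^*=q$. Polynomials are evaluated at tuples $X$ of self-adjoint operators, and $\Gamma(X)=(\gamma_1(X),\dots,\gamma_r(X))$. Graded sets. $\mathbb S_n$ is the set of self-adjoint $n\times n$ complex matrices and $\mathbb S^g=(\mathbb S_n^g)_{n\in\mathbb N}$. A graded set $\boldsymbol K=(K_n)_n$, $K_n\subseteq\mathbb S^g_n$, is closed if each $K_n$ is closed, and bounded if there is $R\ge0$ with $\sum_j X_j^2\preceq R^2$ for all $X\in\boldsymbol K$. It is free if closed under (finite) direct sums and simultaneous unitary conjugation. A pair $(X,V)$, with $X\in\mathbb S^g_n$ and $V:\mathbb C^m\to\mathbb C^n$ an isometry, is a $\Gamma$-pair if $V^*\Gamma(X)V=\Gamma(V^*XV)$ (entrywise). $\boldsymbol K$ is $\Gamma$-convex if it is free and $V^*XV\in\boldsymbol K$ whenever $X\in\boldsymbol K$ and $(X,V)$ is a $\Gamma$-pair. A matrix convex set is a free set closed under $X\mapsto V^*XV$ for all isometries $V$; $\operatorname{matco}$ is the matrix convex hull (smallest matrix convex set containing a given set) and $\overline{\operatorname{matco}}$ its level-wise closure. $\Gamma^{-1}(\boldsymbol J)=\{X\in\mathbb S^g:\Gamma(X)\in\boldsymbol J\}$. $\Gamma$-operator systems. For a tuple $A$ of $g$ self-adjoint operators on $\mathcal H$, $\mathcal R_A^\Gamma=\operatorname{span}\{I_{\mathcal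 H},\gamma_1(A),\dots,\gamma_r(A)\}\subseteq\mathcal B(\mathcal H)$ (complex span) is called a $\Gamma$-operator system. A linear map $\varphi:\mathcal R^\Gamma_A\to\mathcal B(\mathcal K)$ is $\Gamma$-ucp if it is unital, completely positive, and $\varphi(\gamma_i(A))=\gamma_i(\varphi(A_1),\dots,\varphi(A_g))$ for $1\le i\le r$. An isomorphism of $\Gamma$-operator systems is a bijective $\Gamma$-ucp map whose inverse is also $\Gamma$-ucp. The tuple $A$ is semi-finite if it is an at most countable direct sum of tuples of self-adjoint matrices (of finite sizes). The $\Gamma$-matrix range is $W^\Gamma(A)=(W^\Gamma_n(A))_n$ with $W_n^\Gamma(A)=\{(\varphi(A_1),\dots,\varphi(A_g)):\varphi:\mathcal R^\Gamma_A\to M_n(\mathbb C)\ \Gamma\text{-ucp}\}\subseteq\mathbb S_n^g$; it is a closed and bounded $\Gamma$-convex set. For a closed and bounded $\Gamma$-convex set $\boldsymbol K$, put $\widehat Y=\bigoplus_{Y\in\boldsymbol K}Y$ (a tuple of bounded self-adjoint operators) and $\widehat{\boldsymbol K}=\mathcal R^\Gamma_{\widehat Y}=\operatorname{span}\{I,\gamma_1(\widehat Y),\dots,\gamma_r(\widehat Y)\}$. *)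

theory Defs
  imports
    "HOL-Analysis.Infinite_Sum"
    "HOL-Analysis.Inner_Product"
    "HOL-Library.Poly_Mapping"
    "Jordan_Normal_Form.Schur_Decomposition"
begin

section \<open>Complex inner product spaces and \<open>\<ell>\<^sup>2\<close>\<close>

text \<open>The inner product is antilinear in its first argument; norm and topology are those of the
  underlying real inner product space.\<close>

class complex_inner = real_inner +
  fixes scaleC :: "complex \<Rightarrow> 'a \<Rightarrow> 'a" (infixr "*\<^sub>C" 75)
    and cinner :: "'a \<Rightarrow> 'a \<Rightarrow> complex"
  assumes scaleC_add_right: "a *\<^sub>C (x + y) = a *\<^sub>C x + a *\<^sub>C y"
    and scaleC_add_left: "(a + b) *\<^sub>C x = a *\<^sub>C x + b *\<^sub>C x"
    and scaleC_scaleC: "a *\<^sub>C b *\<^sub>C x = (a * b) *\<^sub>C x"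
    and scaleC_of_real: "of_real r *\<^sub>C x = r *\<^sub>R x"
    and cinner_commute: "cinner x y = cnj (cinner y x)"
    and cinner_add_right: "cinner x (y + z) = cinner x y + cinner x z"
    and cinner_scaleC_right: "cinner x (a *\<^sub>C y) = a * cinner x y"
    and Re_cinner: "Re (cinner x y) = inner x y"

text \<open>Hilbert spaces are carried by subsets of a type, since the space underlying
  \<open>\<Oplus>\<^bsub>Y\<in>K\<^esub> Y\<close> depends on \<open>K\<close>.\<close>

definition hilbert_space :: "'h::complex_inner set \<Rightarrow> bool" where
  "hilbert_space H \<longleftrightarrow>
     0 \<in> H \<and> (\<forall>x\<in>H. \<forall>y\<in>H. x + y \<in> H) \<and> (\<forall>a. \<forall>x\<in>H. a *\<^sub>C x \<in> H) \<and> complete H"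

typedef 'i ell2 = "{f :: 'i \<Rightarrow> complex. (\<lambda>i. (cmod (f i))\<^sup>2) summable_on UNIV}"
  by (rule exI[of _ "\<lambda>_. 0"]) simp

lemma Rep_ell2_summable: "(\<lambda>i. (cmod (Rep_ell2 f i))\<^sup>2) summable_on UNIV"
  using Rep_ell2[of f] by simp

lemma ell2_eqI: "(\<And>i. Rep_ell2 f i = Rep_ell2 g i) \<Longrightarrow> f = g"
  by (metis Rep_ell2_inject ext)

lemma ell2_summable_add:
  fixes f g :: "'i \<Rightarrow> complex"
  assumes "(\<lambda>i. (cmod (f i))\<^sup>2) summable_on A" "(\<lambda>i. (cmod (g i))\<^sup>2) summable_on A"
  shows "(\<lambda>i. (cmod (f i + g i))\<^sup>2) summable_on A"
proof (rule summable_on_comparison_test)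
  show "(\<lambda>i. 2 * (cmod (f i))\<^sup>2 + 2 * (cmod (g i))\<^sup>2) summable_on A"
    using assms by (intro summable_on_add summable_on_cmult_right)
  fix i
  have "(cmod (f i + g i))\<^sup>2 \<le> (cmod (f i) + cmod (g i))\<^sup>2"
    by (intro power_mono norm_triangle_ineq) auto
  also have "\<dots> \<le> 2 * (cmod (f i))\<^sup>2 + 2 * (cmod (g i))\<^sup>2"
    using zero_le_power2[of "cmod (f i) - cmod (g i)"]
    by (simp add: power2_sum power2_diff)
  finally show "(cmod (f i + g i))\<^sup>2 \<le> 2 * (cmod (f i))\<^sup>2 + 2 * (cmod (g i))\<^sup>2" .
qed auto

lemma ell2_summable_scale:
  fixes f :: "'i \<Rightarrow> complex"
  assumes "(\<lambda>i. (cmod (f i))\<^sup>2) summable_on A"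
  shows "(\<lambda>i. (cmod (a * f i))\<^sup>2) summable_on A"
  using summable_on_cmult_right[OF assms, of "(cmod a)\<^sup>2"]
  by (simp add: norm_mult power_mult_distrib)

lemma ell2_summable_prod:
  fixes f g :: "'i \<Rightarrow> complex"
  assumes "(\<lambda>i. (cmod (f i))\<^sup>2) summable_on A" "(\<lambda>i. (cmod (g i))\<^sup>2) summable_on A"
  shows "(\<lambda>i. cnj (f i) * g i) summable_on A"
proof -
  have "(\<lambda>i. norm (cnj (f i) * g i)) summable_on A"
  proof (rule summable_on_comparison_test)
    show "(\<lambda>i. (cmod (f i))\<^sup>2 + (cmod (g i))\<^sup>2) summable_on A"
      using assms by (intro summable_on_add)
    fix i
    have "2 * (cmod (f i) * cmod (g i)) \<le> (cmod (f i))\<^sup>2 + (cmod (g i))\<^sup>2"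
      using zero_le_power2[of "cmod (f i) - cmod (g i)"] by (simp add: power2_diff)
    moreover have "0 \<le> cmod (f i) * cmod (g i)" by simp
    ultimately show "norm (cnj (f i) * g i) \<le> (cmod (f i))\<^sup>2 + (cmod (g i))\<^sup>2"
      unfolding norm_mult complex_mod_cnj by linarith
  qed auto
  thus ?thesis by (rule abs_summable_summable)
qed

setup_lifting type_definition_ell2

instantiation ell2 :: (type) complex_inner
begin

lift_definition zero_ell2 :: "'a ell2" is "\<lambda>_. 0" by simp

lift_definition plus_ell2 :: "'a ell2 \<Rightarrow> 'a ell2 \<Rightarrow> 'a ell2" is "\<lambda>f g i. f i + g i"
  by (simp add: ell2_summable_add)

lift_definition uminus_ell2 :: "'a ell2 \<Rightarrow> 'a ell2" is "\<lambda>f i. - f i" by simp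

lift_definition minus_ell2 :: "'a ell2 \<Rightarrow> 'a ell2 \<Rightarrow> 'a ell2" is "\<lambda>f g i. f i - g i"
  subgoal for f g using ell2_summable_add[of f UNIV "\<lambda>i. - g i"] by simp
  done

lift_definition scaleC_ell2 :: "complex \<Rightarrow> 'a ell2 \<Rightarrow> 'a ell2" is "\<lambda>a f i. a * f i"
  by (simp add: ell2_summable_scale)

lift_definition cinner_ell2 :: "'a ell2 \<Rightarrow> 'a ell2 \<Rightarrow> complex"
  is "\<lambda>f g. \<Sum>\<^sub>\<infinity>i. cnj (f i) * g i" .

definition scaleR_ell2 :: "real \<Rightarrow> 'a ell2 \<Rightarrow> 'a ell2" where
  "scaleR_ell2 r f = of_real r *\<^sub>C f"

definition inner_ell2 :: "'a ell2 \<Rightarrow> 'a ell2 \<Rightarrow> real" where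
  "inner_ell2 f g = Re (cinner f g)"

definition norm_ell2 :: "'a ell2 \<Rightarrow> real" where
  "norm_ell2 f = sqrt (inner f f)"

definition sgn_ell2 :: "'a ell2 \<Rightarrow> 'a ell2" where
  "sgn_ell2 f = scaleR (inverse (norm f)) f"

definition dist_ell2 :: "'a ell2 \<Rightarrow> 'a ell2 \<Rightarrow> real" where
  "dist_ell2 f g = norm (f - g)"

definition uniformity_ell2 :: "('a ell2 \<times> 'a ell2) filter" where
  "uniformity_ell2 = (INF e\<in>{0<..}. principal {(x, y). dist x y < e})"

definition open_ell2 :: "'a ell2 set \<Rightarrow> bool" where
  "open_ell2 U \<longleftrightarrow> (\<forall>x\<in>U. \<forall>\<^sub>F (x', y) in uniformity. x' = x \<longrightarrow> y \<in> U)"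

instance
proof
  fix x y z :: "'a ell2" and a b :: complex and r s :: real
  show "x + y + z = x + (y + z)" by transfer (simp add: add.assoc)
  show "x + y = y + x" by transfer (simp add: add.commute)
  show "0 + x = x" by transfer simp
  show "- x + x = 0" by transfer simp
  show "x - y = x + - y" by transfer simp
  show C1: "a *\<^sub>C (x + y) = a *\<^sub>C x + a *\<^sub>C y" for a and x y :: "'a ell2"
    by transfer (simp add: distrib_left)
  show C2: "(a + b) *\<^sub>C x = a *\<^sub>C x + b *\<^sub>C x" for a b and x :: "'a ell2"
    by transfer (simp add: distrib_right)
  show C3: "a *\<^sub>C b *\<^sub>C x = (a * b) *\<^sub>C x" for a b and x :: "'a ell2"
    by transfer (simp add: mult.assoc)
  have C4: "1 *\<^sub>C x = x" for x :: "'a ell2" by transfer simp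
  show "r *\<^sub>R (x + y) = r *\<^sub>R x + r *\<^sub>R y" by (simp add: scaleR_ell2_def C1)
  show "(r + s) *\<^sub>R x = r *\<^sub>R x + s *\<^sub>R x" by (simp add: scaleR_ell2_def C2)
  show "r *\<^sub>R s *\<^sub>R x = (r * s) *\<^sub>R x" by (simp add: scaleR_ell2_def C3)
  show "1 *\<^sub>R x = x" by (simp add: scaleR_ell2_def C4)
  show "sgn x = scaleR (inverse (norm x)) x" by (simp add: sgn_ell2_def)
  show "dist x y = norm (x - y)" by (rule dist_ell2_def)
  show "uniformity = (INF e\<in>{0<..}. principal {(x :: 'a ell2, y). dist x y < e})"
    by (rule uniformity_ell2_def)
  show "open U = (\<forall>x\<in>U. \<forall>\<^sub>F (x', y) in uniformity. x' = x \<longrightarrow> y \<in> U)" for U :: "'a ell2 set"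
    by (rule open_ell2_def)
  show "of_real r *\<^sub>C x = r *\<^sub>R x" by (simp add: scaleR_ell2_def)
  show comm: "cinner x y = cnj (cinner y x)" for x y :: "'a ell2"
    by transfer (simp flip: infsum_cnj add: mult.commute)
  show cadd: "cinner x (y + z) = cinner x y + cinner x z" for x y z :: "'a ell2"
    by transfer (simp add: distrib_left infsum_add ell2_summable_prod)
  show cscale: "cinner x (a *\<^sub>C y) = a * cinner x y" for a and x y :: "'a ell2"
    by transfer (simp add: mult.left_commute flip: infsum_cmult_right')
  show "Re (cinner x y) = inner x y" by (simp add: inner_ell2_def)
  show comm': "inner x y = inner y x" for x y :: "'a ell2"
    unfolding inner_ell2_def by (subst comm) simp
  show "inner (x + y) z = inner x z + inner y z"
    by (subst (1 2 3) comm') (simp add: inner_ell2_def cadd)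
  show "inner (r *\<^sub>R x) y = r * inner x y"
    by (subst (1 2) comm') (simp add: inner_ell2_def scaleR_ell2_def cscale)
  have self: "cinner x x = of_real (\<Sum>\<^sub>\<infinity>i. (cmod (Rep_ell2 x i))\<^sup>2)" for x :: "'a ell2"
  proof -
    have "cinner x x = (\<Sum>\<^sub>\<infinity>i. of_real ((cmod (Rep_ell2 x i))\<^sup>2))"
      unfolding cinner_ell2.rep_eq
      by (rule infsum_cong) (simp add: complex_norm_square mult.commute del: of_real_power)
    also have "\<dots> = of_real (\<Sum>\<^sub>\<infinity>i. (cmod (Rep_ell2 x i))\<^sup>2)"
      by (intro infsumI has_sum_of_real has_sum_infsum Rep_ell2_summable)
    finally show ?thesis .
  qed
  show "0 \<le> inner x x"
    by (simp add: inner_ell2_def self infsum_nonneg)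
  show "inner x x = 0 \<longleftrightarrow> x = 0"
  proof
    assume "inner x x = 0"
    hence "(\<Sum>\<^sub>\<infinity>i. (cmod (Rep_ell2 x i))\<^sup>2) \<le> 0" by (simp add: inner_ell2_def self)
    hence "(cmod (Rep_ell2 x i))\<^sup>2 = 0" for i
      by (rule nonneg_infsum_le_0D[OF _ Rep_ell2_summable]) auto
    thus "x = 0" by (intro ell2_eqI) (simp add: zero_ell2.rep_eq)
  next
    assume "x = 0"
    thus "inner x x = 0" by (simp add: inner_ell2_def self zero_ell2.rep_eq)
  qed
  show "norm x = sqrt (inner x x)" by (rule norm_ell2_def)
qed

end

lemma norm_ell2_sq: "(norm x)\<^sup>2 = (\<Sum>\<^sub>\<infinity>i. (cmod (Rep_ell2 x i))\<^sup>2)" for x :: "'i ell2"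
proof -
  have "cinner x x = (\<Sum>\<^sub>\<infinity>i. of_real ((cmod (Rep_ell2 x i))\<^sup>2))"
    unfolding cinner_ell2.rep_eq
    by (rule infsum_cong) (simp add: complex_norm_square mult.commute del: of_real_power)
  also have "\<dots> = of_real (\<Sum>\<^sub>\<infinity>i. (cmod (Rep_ell2 x i))\<^sup>2)"
    by (intro infsumI has_sum_of_real has_sum_infsum Rep_ell2_summable)
  finally show ?thesis
    by (metis Re_cinner Re_complex_of_real power2_norm_eq_inner)
qed

definition coord_space :: "'i set \<Rightarrow> 'i ell2 set" where
  "coord_space S = {f. \<forall>i. i \<notin> S \<longrightarrow> Rep_ell2 f i = 0}"

lemma complete_coord_space: "complete (coord_space S :: 'i ell2 set)"
proof (unfold complete_def, intro allI impI, elim conjE)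
  fix s :: "nat \<Rightarrow> 'i ell2"
  assume sS: "\<forall>n. s n \<in> coord_space S" and cau: "Cauchy s"
  have sum_le: "(\<Sum>i\<in>F. (cmod (Rep_ell2 x i))\<^sup>2) \<le> (norm x)\<^sup>2" if "finite F" for F and x :: "'i ell2"
    unfolding norm_ell2_sq
    by (rule finite_sum_le_infsum[OF Rep_ell2_summable that]) auto
  have comp: "cmod (Rep_ell2 x i) \<le> norm x" for x :: "'i ell2" and i
    using sum_le[of "{i}" x] by (simp add: power2_le_iff_abs_le)
  have lim: "\<exists>l. (\<lambda>n. Rep_ell2 (s n) i) \<longlonglongrightarrow> l" for i
  proof -
    have "Cauchy (\<lambda>n. Rep_ell2 (s n) i)"
    proof (rule CauchyI)
      fix e :: real assume "0 < e"
      then obtain N where N: "\<forall>m\<ge>N. \<forall>n\<ge>N. norm (s m - s n) < e"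
        using CauchyD[OF cau] by blast
      show "\<exists>N. \<forall>m\<ge>N. \<forall>n\<ge>N. norm (Rep_ell2 (s m) i - Rep_ell2 (s n) i) < e"
        using N comp[of "s _ - s _" i] unfolding minus_ell2.rep_eq
        by (meson le_less_trans)
    qed
    thus ?thesis using Cauchy_convergent convergent_def by blast
  qed
  then obtain l where l: "\<And>i. (\<lambda>n. Rep_ell2 (s n) i) \<longlonglongrightarrow> l i" by metis
  have bound: "(\<Sum>i\<in>F. (cmod (Rep_ell2 (s n) i - l i))\<^sup>2) \<le> e\<^sup>2"
    if "finite F" and e: "\<forall>m\<ge>N. norm (s n - s m) < e" for F n N e
  proof (rule tendsto_upperbound)
    show "(\<lambda>m. \<Sum>i\<in>F. (cmod (Rep_ell2 (s n) i - Rep_ell2 (s m) i))\<^sup>2)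
        \<longlonglongrightarrow> (\<Sum>i\<in>F. (cmod (Rep_ell2 (s n) i - l i))\<^sup>2)"
      by (intro tendsto_intros l)
    have "(\<Sum>i\<in>F. (cmod (Rep_ell2 (s n) i - Rep_ell2 (s m) i))\<^sup>2) \<le> e\<^sup>2" if "m \<ge> N" for m
    proof -
      have "(\<Sum>i\<in>F. (cmod (Rep_ell2 (s n) i - Rep_ell2 (s m) i))\<^sup>2) \<le> (norm (s n - s m))\<^sup>2"
        using sum_le[OF \<open>finite F\<close>, of "s n - s m"] by (simp add: minus_ell2.rep_eq)
      also have "\<dots> \<le> e\<^sup>2" using e that by (intro power_mono) (auto simp: less_imp_le)
      finally show ?thesis .
    qed
    thus "\<forall>\<^sub>F m in sequentially. (\<Sum>i\<in>F. (cmod (Rep_ell2 (s n) i - Rep_ell2 (s m) i))\<^sup>2) \<le> e\<^sup>2"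
      unfolding eventually_sequentially by blast
  qed simp
  have summ: "(\<lambda>i. (cmod (Rep_ell2 (s n) i - l i))\<^sup>2) summable_on UNIV"
    if "\<forall>m\<ge>N. norm (s n - s m) < e" for n N e
    by (rule nonneg_bdd_above_summable_on)
       (use bound[OF _ that] in \<open>auto simp: bdd_above_def\<close>)
  obtain N1 where N1: "\<forall>m\<ge>N1. norm (s N1 - s m) < 1"
    using CauchyD[OF cau, of 1] by fastforce
  have lsum: "(\<lambda>i. (cmod (l i))\<^sup>2) summable_on UNIV"
    using ell2_summable_add[OF Rep_ell2_summable[of "s N1"]
        ell2_summable_scale[OF summ[OF N1], of "-1"]] by simp
  define L where "L = Abs_ell2 l"
  have L: "Rep_ell2 L = l" unfolding L_def using lsum by (simp add: Abs_ell2_inverse)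
  have "s \<longlonglongrightarrow> L"
  proof (rule LIMSEQ_I)
    fix r :: real assume "0 < r"
    then obtain N where N: "\<forall>m\<ge>N. \<forall>n\<ge>N. norm (s m - s n) < r / 2"
      using CauchyD[OF cau, of "r/2"] by auto
    have "norm (s n - L) < r" if "n \<ge> N" for n
    proof -
      have e: "\<forall>m\<ge>N. norm (s n - s m) < r / 2" using N that by blast
      have "(norm (s n - L))\<^sup>2 \<le> (r/2)\<^sup>2"
        unfolding norm_ell2_sq minus_ell2.rep_eq L
        by (rule infsum_le_finite_sums[OF summ[OF e]]) (use bound[OF _ e] in auto)
      hence "norm (s n - L) \<le> r / 2" using \<open>0 < r\<close> by (simp add: power2_le_iff_abs_le)
      thus ?thesis using \<open>0 < r\<close> by simp
    qed
    thus "\<exists>no. \<forall>n\<ge>no. norm (s n - L) < r" by blast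
  qed
  moreover have "L \<in> coord_space S"
  proof -
    have "l i = 0" if "i \<notin> S" for i
    proof -
      have "(\<lambda>n. Rep_ell2 (s n) i) = (\<lambda>_. 0)"
        using sS that by (auto simp: coord_space_def)
      thus ?thesis using l[of i] by (simp add: LIMSEQ_const_iff)
    qed
    thus ?thesis by (simp add: coord_space_def L)
  qed
  ultimately show "\<exists>l\<in>coord_space S. s \<longlonglongrightarrow> l" by blast
qed

lemma hilbert_coord_space: "hilbert_space (coord_space S)"
  unfolding hilbert_space_def
  using complete_coord_space[of S]
  by (auto simp: coord_space_def zero_ell2.rep_eq plus_ell2.rep_eq scaleC_ell2.rep_eq)


section \<open>Bounded operators\<close>

text \<open>Operators on a Hilbert space \<open>H\<close> are total functions that vanish outside \<open>H\<close>, so that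
  equality of operators is equality of functions.\<close>

definition bounded_ops :: "'h::complex_inner set \<Rightarrow> ('h \<Rightarrow> 'h) set" where
  "bounded_ops H = {T.
     (\<forall>x\<in>H. T x \<in> H) \<and> (\<forall>x. x \<notin> H \<longrightarrow> T x = 0) \<and>
     (\<forall>x\<in>H. \<forall>y\<in>H. T (x + y) = T x + T y) \<and>
     (\<forall>a. \<forall>x\<in>H. T (a *\<^sub>C x) = a *\<^sub>C T x) \<and>
     (\<exists>C. \<forall>x\<in>H. norm (T x) \<le> C * norm x)}"

definition id_on :: "'h::complex_inner set \<Rightarrow> 'h \<Rightarrow> 'h" where
  "id_on H x = (if x \<in> H then x else 0)"

definition selfadjoint_on :: "'h::complex_inner set \<Rightarrow> ('h \<Rightarrow> 'h) \<Rightarrow> bool" where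
  "selfadjoint_on H T \<longleftrightarrow> (\<forall>x\<in>H. \<forall>y\<in>H. cinner (T x) y = cinner x (T y))"

definition selfadjoint_tuple :: "nat \<Rightarrow> 'h::complex_inner set \<Rightarrow> ('h \<Rightarrow> 'h) list \<Rightarrow> bool" where
  "selfadjoint_tuple g H A \<longleftrightarrow>
     length A = g \<and> (\<forall>T\<in>set A. T \<in> bounded_ops H \<and> selfadjoint_on H T)"

text \<open>Positivity of the operator matrix \<open>(T i j)\<close>, \<open>i, j < k\<close>, on \<open>H\<^sup>k\<close>.\<close>

definition positive_matrix ::
  "'h::complex_inner set \<Rightarrow> nat \<Rightarrow> (nat \<Rightarrow> nat \<Rightarrow> 'h \<Rightarrow> 'h) \<Rightarrow> bool" where
  "positive_matrix H k T \<longleftrightarrow>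
     (\<forall>h. (\<forall>i<k. h i \<in> H) \<longrightarrow> 0 \<le> (\<Sum>i<k. \<Sum>j<k. cinner (h i) (T i j (h j))))"

definition op_comb :: "(nat \<Rightarrow> complex) \<Rightarrow> ('h::complex_inner \<Rightarrow> 'h) list \<Rightarrow> 'h \<Rightarrow> 'h" where
  "op_comb c Ts x = (\<Sum>i<length Ts. c i *\<^sub>C (Ts ! i) x)"

definition op_span :: "('h::complex_inner \<Rightarrow> 'h) list \<Rightarrow> ('h \<Rightarrow> 'h) set" where
  "op_span Ts = {op_comb c Ts | c. True}"

definition op_lin_indep :: "('h::complex_inner \<Rightarrow> 'h) list \<Rightarrow> bool" where
  "op_lin_indep Ts \<longleftrightarrow> (\<forall>c. op_comb c Ts = (\<lambda>x. 0) \<longrightarrow> (\<forall>i<length Ts. c i = 0))"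


section \<open>Noncommutative polynomials\<close>

text \<open>A word \<open>x\<^bsub>j\<^sub>1\<^esub> \<dots> x\<^bsub>j\<^sub>k\<^esub>\<close> is the list \<open>[j\<^sub>1, \<dots>, j\<^sub>k]\<close>; the variables
  \<open>x\<^sub>1, \<dots>, x\<^sub>g\<close> are numbered from \<open>0\<close>.\<close>

type_synonym nc_poly = "nat list \<Rightarrow>\<^sub>0 complex"

definition nc_polys :: "nat \<Rightarrow> nc_poly set" where
  "nc_polys g = {p. \<forall>w\<in>Poly_Mapping.keys p. set w \<subseteq> {..<g}}"

definition nc_var :: "nat \<Rightarrow> nc_poly" where
  "nc_var j = Poly_Mapping.single [j] 1"

definition nc_star :: "nc_poly \<Rightarrow> nc_poly" where
  "nc_star p = Poly_Mapping.map cnj (Poly_Mapping.map_key rev p)"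

lemma lookup_nc_star: "Poly_Mapping.lookup (nc_star p) w = cnj (Poly_Mapping.lookup p (rev w))"
proof -
  have "inj (rev :: nat list \<Rightarrow> _)" by (rule injI) simp
  thus ?thesis
    unfolding nc_star_def
    by (simp add: Poly_Mapping.map.rep_eq Poly_Mapping.map_key.rep_eq when_def)
qed

definition symmetric_nc :: "nc_poly \<Rightarrow> bool" where
  "symmetric_nc p \<longleftrightarrow> nc_star p = p"

definition word_op ::
  "'h::complex_inner set \<Rightarrow> ('h \<Rightarrow> 'h) list \<Rightarrow> nat list \<Rightarrow> 'h \<Rightarrow> 'h" where
  "word_op H A w = foldr (\<lambda>j T. A ! j \<circ> T) w (id_on H)"

definition eval_op ::
  "'h::complex_inner set \<Rightarrow> nc_poly \<Rightarrow> ('h \<Rightarrow> 'h) list \<Rightarrow> 'h \<Rightarrow> 'h" where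
  "eval_op H p A x = (\<Sum>w\<in>Poly_Mapping.keys p. Poly_Mapping.lookup p w *\<^sub>C word_op H A w x)"

definition evals_op ::
  "'h::complex_inner set \<Rightarrow> nc_poly list \<Rightarrow> ('h \<Rightarrow> 'h) list \<Rightarrow> ('h \<Rightarrow> 'h) list" where
  "evals_op H \<Gamma> A = map (\<lambda>p. eval_op H p A) \<Gamma>"

definition word_mat :: "nat \<Rightarrow> complex mat list \<Rightarrow> nat list \<Rightarrow> complex mat" where
  "word_mat n X w = foldr (\<lambda>j M. X ! j * M) w (1\<^sub>m n)"

definition eval_mat :: "nat \<Rightarrow> nc_poly \<Rightarrow> complex mat list \<Rightarrow> complex mat" where
  "eval_mat n p X = Matrix.mat n n (\<lambda>(i, j).
     \<Sum>w\<in>Poly_Mapping.keys p. Poly_Mapping.lookup p w * word_mat n X w $$ (i, j))"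

definition evals_mat :: "nat \<Rightarrow> nc_poly list \<Rightarrow> complex mat list \<Rightarrow> complex mat list" where
  "evals_mat n \<Gamma> X = map (\<lambda>p. eval_mat n p X) \<Gamma>"


section \<open>Graded sets of matrix tuples\<close>

text \<open>Matrix sizes start at 1: level 0 of \<open>sa_mats g\<close>, hence of every graded set, is empty.\<close>

type_synonym graded = "nat \<Rightarrow> complex mat list set"

definition sa_mats :: "nat \<Rightarrow> graded" where
  "sa_mats g n = {X. 0 < n \<and> length X = g \<and>
     (\<forall>M\<in>set X. M \<in> carrier_mat n n \<and> mat_adjoint M = M)}"

definition graded_set :: "nat \<Rightarrow> graded \<Rightarrow> bool" where
  "graded_set g K \<longleftrightarrow> (\<forall>n. K n \<subseteq> sa_mats g n)"

definition isometry_mat :: "nat \<Rightarrow> nat \<Rightarrow> complex mat \<Rightarrow> bool" where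
  "isometry_mat n m V \<longleftrightarrow> 0 < m \<and> V \<in> carrier_mat n m \<and> mat_adjoint V * V = 1\<^sub>m m"

definition compress :: "complex mat \<Rightarrow> complex mat list \<Rightarrow> complex mat list" where
  "compress V X = map (\<lambda>M. mat_adjoint V * M * V) X"

definition tuple_sum :: "nat \<Rightarrow> nat \<Rightarrow> complex mat list \<Rightarrow> complex mat list \<Rightarrow> complex mat list" where
  "tuple_sum n m X Y = map2 (\<lambda>M N. four_block_mat M (0\<^sub>m n m) (0\<^sub>m m n) N) X Y"

definition free_set :: "nat \<Rightarrow> graded \<Rightarrow> bool" where
  "free_set g K \<longleftrightarrow> graded_set g K \<and>
     (\<forall>n m. \<forall>X\<in>K n. \<forall>Y\<in>K m. tuple_sum n m X Y \<in> K (n + m)) \<and>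
     (\<forall>n. \<forall>X\<in>K n. \<forall>U\<in>carrier_mat n n. mat_adjoint U * U = 1\<^sub>m n \<longrightarrow> compress U X \<in> K n)"

definition gamma_pair ::
  "nat \<Rightarrow> nc_poly list \<Rightarrow> nat \<Rightarrow> nat \<Rightarrow> complex mat list \<Rightarrow> complex mat \<Rightarrow> bool" where
  "gamma_pair g \<Gamma> n m X V \<longleftrightarrow> X \<in> sa_mats g n \<and> isometry_mat n m V \<and>
     compress V (evals_mat n \<Gamma> X) = evals_mat m \<Gamma> (compress V X)"

definition gamma_convex :: "nat \<Rightarrow> nc_poly list \<Rightarrow> graded \<Rightarrow> bool" where
  "gamma_convex g \<Gamma> K \<longleftrightarrow> free_set g K \<and>
     (\<forall>n m X V. X \<in> K n \<and> gamma_pair g \<Gamma> n m X V \<longrightarrow> compress V X \<in> K m)"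

definition matrix_convex :: "nat \<Rightarrow> graded \<Rightarrow> bool" where
  "matrix_convex g K \<longleftrightarrow> free_set g K \<and>
     (\<forall>n m X V. X \<in> K n \<and> isometry_mat n m V \<longrightarrow> compress V X \<in> K m)"

definition matco :: "nat \<Rightarrow> graded \<Rightarrow> graded" where
  "matco g J n = \<Inter>{C n | C. matrix_convex g C \<and> (\<forall>m. J m \<subseteq> C m)}"

text \<open>Convergence in the finite-dimensional space \<open>sa_mats g n\<close> is entrywise convergence.\<close>

definition tuple_tendsto ::
  "nat \<Rightarrow> nat \<Rightarrow> (nat \<Rightarrow> complex mat list) \<Rightarrow> complex mat list \<Rightarrow> bool" where
  "tuple_tendsto g n S X \<longleftrightarrow>
     (\<forall>l<g. \<forall>i<n. \<forall>j<n. (\<lambda>k. S k ! l $$ (i, j)) \<longlonglongrightarrow> X ! l $$ (i, j))"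

definition level_closure :: "nat \<Rightarrow> graded \<Rightarrow> graded" where
  "level_closure g K n = {X \<in> sa_mats g n. \<exists>S. (\<forall>k. S k \<in> K n) \<and> tuple_tendsto g n S X}"

definition closed_graded :: "nat \<Rightarrow> graded \<Rightarrow> bool" where
  "closed_graded g K \<longleftrightarrow> (\<forall>n. level_closure g K n \<subseteq> K n)"

definition psd_mat :: "nat \<Rightarrow> complex mat \<Rightarrow> bool" where
  "psd_mat n M \<longleftrightarrow> (\<forall>v\<in>carrier_vec n. 0 \<le> (M *\<^sub>v v) \<bullet>c v)"

definition sum_squares :: "nat \<Rightarrow> complex mat list \<Rightarrow> complex mat" where
  "sum_squares n X = foldr (\<lambda>M N. M * M + N) X (0\<^sub>m n n)"

definition bounded_graded :: "graded \<Rightarrow> bool" where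
  "bounded_graded K \<longleftrightarrow> (\<exists>R::real. 0 \<le> R \<and>
     (\<forall>n. \<forall>X\<in>K n. psd_mat n (of_real (R\<^sup>2) \<cdot>\<^sub>m 1\<^sub>m n - sum_squares n X)))"

definition gamma_image :: "nc_poly list \<Rightarrow> graded \<Rightarrow> graded" where
  "gamma_image \<Gamma> K n = evals_mat n \<Gamma> ` K n"

definition gamma_preimage :: "nat \<Rightarrow> nc_poly list \<Rightarrow> graded \<Rightarrow> graded" where
  "gamma_preimage g \<Gamma> J n = {X \<in> sa_mats g n. evals_mat n \<Gamma> X \<in> J n}"


section \<open>Direct sums of matrices\<close>

text \<open>\<open>M\<^sub>n(\<complex>)\<close> is identified with the operators on \<open>\<complex>\<^sup>n = coord_space {..<n}\<close>.\<close>

definition mat_op :: "nat \<Rightarrow> complex mat \<Rightarrow> nat ell2 \<Rightarrow> nat ell2" where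
  "mat_op n M f = (if f \<in> coord_space {..<n}
     then Abs_ell2 (\<lambda>i. if i < n then \<Sum>j<n. M $$ (i, j) * Rep_ell2 f j else 0)
     else 0)"

definition dsum_space :: "'a set \<Rightarrow> ('a \<Rightarrow> nat) \<Rightarrow> ('a \<times> nat) ell2 set" where
  "dsum_space I d = coord_space (SIGMA a:I. {..<d a})"

text \<open>The operator \<open>\<Oplus>\<^bsub>a\<in>I\<^esub> M a\<close> on \<open>\<Oplus>\<^bsub>a\<in>I\<^esub> \<complex>\<^bsup>d a\<^esup>\<close>. The argument of \<open>Abs_ell2\<close> is square
  summable for all \<open>f\<close> if the norms of the \<open>M a\<close> are uniformly bounded.\<close>

definition dsum_op ::
  "'a set \<Rightarrow> ('a \<Rightarrow> nat) \<Rightarrow> ('a \<Rightarrow> complex mat) \<Rightarrow> ('a \<times> nat) ell2 \<Rightarrow> ('a \<times> nat) ell2" where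
  "dsum_op I d M f = (if f \<in> dsum_space I d
     then Abs_ell2 (\<lambda>(a, i). if a \<in> I \<and> i < d a
                             then \<Sum>j<d a. M a $$ (i, j) * Rep_ell2 f (a, j) else 0)
     else 0)"

definition unitary_between ::
  "'h::complex_inner set \<Rightarrow> 'k::complex_inner set \<Rightarrow> ('h \<Rightarrow> 'k) \<Rightarrow> bool" where
  "unitary_between H K U \<longleftrightarrow> bij_betw U H K \<and>
     (\<forall>x\<in>H. \<forall>y\<in>H. U (x + y) = U x + U y) \<and>
     (\<forall>a. \<forall>x\<in>H. U (a *\<^sub>C x) = a *\<^sub>C U x) \<and>
     (\<forall>x\<in>H. \<forall>y\<in>H. cinner (U x) (U y) = cinner x y)"

text \<open>On an abstract Hilbert space, being a direct sum of matrix tuples means being one up to a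
  unitary identification. For a tuple \<open>A\<close> of bounded operators the \<open>B a\<close> are automatically
  uniformly bounded.\<close>

definition semi_finite ::
  "nat \<Rightarrow> 'h::complex_inner set \<Rightarrow> ('h \<Rightarrow> 'h) list \<Rightarrow> bool" where
  "semi_finite g H A \<longleftrightarrow>
     (\<exists>(I::nat set) d B U.
        (\<forall>a\<in>I. B a \<in> sa_mats g (d a)) \<and>
        unitary_between H (dsum_space I d) U \<and>
        (\<forall>j<g. \<forall>x\<in>H. U ((A ! j) x) = dsum_op I d (\<lambda>a. B a ! j) (U x)))"

text \<open>The tuple \<open>\<Oplus>\<^bsub>Y\<in>K\<^esub> Y\<close> and its Hilbert space, the summands being indexed by the points
  \<open>(n, Y)\<close> with \<open>Y \<in> K n\<close>.\<close>

definition hat_index :: "graded \<Rightarrow> (nat \<times> complex mat list) set" where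
  "hat_index K = {(n, Y). Y \<in> K n}"

definition hat_space :: "graded \<Rightarrow> ((nat \<times> complex mat list) \<times> nat) ell2 set" where
  "hat_space K = dsum_space (hat_index K) fst"

definition hat_tuple :: "nat \<Rightarrow> graded \<Rightarrow>
    (((nat \<times> complex mat list) \<times> nat) ell2 \<Rightarrow> ((nat \<times> complex mat list) \<times> nat) ell2) list" where
  "hat_tuple g K = map (\<lambda>j. dsum_op (hat_index K) fst (\<lambda>a. snd a ! j)) [0..<g]"


section \<open>\<open>\<Gamma>\<close>-operator systems\<close>

definition gamma_system ::
  "'h::complex_inner set \<Rightarrow> nc_poly list \<Rightarrow> ('h \<Rightarrow> 'h) list \<Rightarrow> ('h \<Rightarrow> 'h) set" where
  "gamma_system H \<Gamma> A = op_span (id_on H # evals_op H \<Gamma> A)"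

definition linear_on_ops ::
  "('h::complex_inner \<Rightarrow> 'h) set \<Rightarrow> (('h \<Rightarrow> 'h) \<Rightarrow> ('k::complex_inner \<Rightarrow> 'k)) \<Rightarrow> bool" where
  "linear_on_ops R \<phi> \<longleftrightarrow>
     (\<forall>S\<in>R. \<forall>T\<in>R. \<phi> (\<lambda>x. S x + T x) = (\<lambda>y. \<phi> S y + \<phi> T y)) \<and>
     (\<forall>a. \<forall>T\<in>R. \<phi> (\<lambda>x. a *\<^sub>C T x) = (\<lambda>y. a *\<^sub>C \<phi> T y))"

definition completely_positive ::
  "'h::complex_inner set \<Rightarrow> ('h \<Rightarrow> 'h) set \<Rightarrow> 'k::complex_inner set \<Rightarrow>
   (('h \<Rightarrow> 'h) \<Rightarrow> ('k \<Rightarrow> 'k)) \<Rightarrow> bool" where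
  "completely_positive H R K \<phi> \<longleftrightarrow>
     (\<forall>k T. (\<forall>i<k. \<forall>j<k. T i j \<in> R) \<and> positive_matrix H k T \<longrightarrow>
        positive_matrix K k (\<lambda>i j. \<phi> (T i j)))"

text \<open>\<open>\<phi>\<close> is a \<open>\<Gamma>\<close>-ucp map from the \<open>\<Gamma>\<close>-operator system of the \<open>g\<close>-tuple \<open>A\<close> on \<open>H\<close> to the
  bounded operators on \<open>K\<close>; only its values on the system matter.\<close>

definition gamma_ucp ::
  "nc_poly list \<Rightarrow> 'h::complex_inner set \<Rightarrow> ('h \<Rightarrow> 'h) list \<Rightarrow> 'k::complex_inner set \<Rightarrow>
   (('h \<Rightarrow> 'h) \<Rightarrow> ('k \<Rightarrow> 'k)) \<Rightarrow> bool" where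
  "gamma_ucp \<Gamma> H A K \<phi> \<longleftrightarrow>
     \<phi> ` gamma_system H \<Gamma> A \<subseteq> bounded_ops K \<and>
     linear_on_ops (gamma_system H \<Gamma> A) \<phi> \<and>
     \<phi> (id_on H) = id_on K \<and>
     completely_positive H (gamma_system H \<Gamma> A) K \<phi> \<and>
     map \<phi> (evals_op H \<Gamma> A) = evals_op K \<Gamma> (map \<phi> A)"

definition gamma_isomorphic ::
  "nc_poly list \<Rightarrow> 'h::complex_inner set \<Rightarrow> ('h \<Rightarrow> 'h) list \<Rightarrow>
   'k::complex_inner set \<Rightarrow> ('k \<Rightarrow> 'k) list \<Rightarrow> bool" where
  "gamma_isomorphic \<Gamma> H A K B \<longleftrightarrow>
     (\<exists>\<phi>. bij_betw \<phi> (gamma_system H \<Gamma> A) (gamma_system K \<Gamma> B) \<and>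
          gamma_ucp \<Gamma> H A K \<phi> \<and>
          gamma_ucp \<Gamma> K B H (inv_into (gamma_system H \<Gamma> A) \<phi>))"

definition gamma_matrix_range ::
  "nat \<Rightarrow> nc_poly list \<Rightarrow> 'h::complex_inner set \<Rightarrow> ('h \<Rightarrow> 'h) list \<Rightarrow> graded" where
  "gamma_matrix_range g \<Gamma> H A n = {X \<in> sa_mats g n.
     \<exists>\<phi>. gamma_ucp \<Gamma> H A (coord_space {..<n}) \<phi> \<and> map \<phi> A = map (mat_op n) X}"

end

(* A \<Gamma>-ucp map is determined by its values on the spanning operators, so everything is phrased in terms
   of one condition: whether the operator matrix with entries \<Sum>_l c_ijl T_l, where T_0 = I and
   T_l = \<gamma>_l(A), is positive. On a direct sum it is positive iff it is positive on every summand.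

   (a) Both A and \<Oplus>W(A) are direct sums of tuples from W(A), and the summands of A are among them; positivity
   on A passes to every point of W(A) by complete positivity. Hence the two systems have the same positive
   matrices, which already makes \<gamma>_l(A) \<mapsto> \<gamma>_l(\<Oplus>W(A)) a well-defined isomorphism.

   (b) For X in the matrix range of \<Oplus>K, consider the convex cone generated by the tuples
   (V*V, V*\<gamma>_1(Y)V, ..., V*\<gamma>_r(Y)V) with Y in K. A functional that is nonnegative on the cone is a positive
   matrix over the system of \<Oplus>K, hence nonnegative at (I, \<Gamma>(X)); so (I, \<Gamma>(X)) is a limit of elements of
   the cone. As \<Gamma>(0) = 0 and 0 \<in> K, the cone contains (P, 0) for every P close to I, so the first
   component of the approximants can be corrected to I, and then they belong to matco \<Gamma>(K). *)

theory Submission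
  imports Defs
begin

section \<open>Complex inner product spaces\<close>

text \<open>A linear relation between the spanning operators is itself a positivity condition: T = 0
  as soon as the 2 x 2 matrix with T in an off-diagonal corner and zeros elsewhere is positive. This
  is why equality of the positive matrices already yields a well-defined bijection. Direct sums make
  sense only for uniformly bounded families. For the matrix range this bound is also read off from
  positivity: a self-adjoint T has norm at most c iff the 2 x 2 matrix with diagonal c I and
  off-diagonal T is positive, and \<Gamma>-ucp maps preserve that. In (b) the cone need not be
  closed, so separation is replaced by an approximate version, which needs the norm of a cone
  element to be controlled by a functional. The trace of the first component serves, as each
  \<gamma>_l(Y) is bounded uniformly in Y. A first component P near I is corrected by adding
  \<epsilon> I + (I - P), which is positive if the entries of I - P are at most \<epsilon>/n; the
  sum (1 + \<epsilon>) I is then rescaled. Sums in the cone are compressions of direct sums, so in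
  the end a single isometry remains.\<close>

lemma scaleC_one [simp]: "1 *\<^sub>C x = (x :: 'h::complex_inner)"
  using scaleC_of_real[of 1 x] by simp

lemma scaleC_zero_left [simp]: "0 *\<^sub>C x = (0 :: 'h::complex_inner)"
  using scaleC_of_real[of 0 x] by simp

lemma scaleC_zero_right [simp]: "a *\<^sub>C 0 = (0 :: 'h::complex_inner)"
  using scaleC_add_right[of a 0 0] by simp

lemma scaleC_minus1: "(- 1) *\<^sub>C x = - (x :: 'h::complex_inner)"
  using scaleC_of_real[of "- 1" x] by simp

lemma scaleC_sum_right: "a *\<^sub>C sum f S = (\<Sum>i\<in>S. a *\<^sub>C (f i :: 'h::complex_inner))"
  by (induction S rule: infinite_finite_induct) (auto simp: scaleC_add_right)

lemma scaleC_diff_left: "(a - b) *\<^sub>C x = a *\<^sub>C x - b *\<^sub>C (x :: 'h::complex_inner)"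
  using scaleC_add_left[of "a - b" b x] by (simp add: algebra_simps)

lemma cinner_add_left: "cinner (x + y) z = cinner x z + cinner y (z :: 'h::complex_inner)"
  by (subst (1 2 3) cinner_commute) (simp add: cinner_add_right)

lemma cinner_scaleC_left: "cinner (a *\<^sub>C x) y = cnj a * cinner x (y :: 'h::complex_inner)"
  by (subst (1 2) cinner_commute) (simp add: cinner_scaleC_right)

lemma cinner_zero_right [simp]: "cinner x (0 :: 'h::complex_inner) = 0"
  using cinner_add_right[of x 0 0] by simp

lemma cinner_zero_left [simp]: "cinner (0 :: 'h::complex_inner) x = 0"
  using cinner_add_left[of 0 0 x] by simp

lemma cinner_minus_left: "cinner (- x) y = - cinner x (y :: 'h::complex_inner)"
  using cinner_scaleC_left[of "- 1" x y] by (simp add: scaleC_minus1)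

lemma cinner_sum_right: "cinner x (sum f S) = (\<Sum>i\<in>S. cinner x (f i :: 'h::complex_inner))"
  by (induction S rule: infinite_finite_induct) (auto simp: cinner_add_right)

lemma cinner_self: "cinner x x = of_real ((norm (x :: 'h::complex_inner))\<^sup>2)"
  using cinner_commute[of x x] Re_cinner[of x x]
  by (simp add: complex_eq_iff power2_norm_eq_inner)

lemma norm_scaleC: "norm (a *\<^sub>C x) = cmod a * norm (x :: 'h::complex_inner)"
proof -
  have "cinner (a *\<^sub>C x) (a *\<^sub>C x) = (a * cnj a) * cinner x x"
    by (simp add: cinner_scaleC_left cinner_scaleC_right)
  hence "of_real ((norm (a *\<^sub>C x))\<^sup>2) = (of_real ((cmod a * norm x)\<^sup>2) :: complex)"
    by (simp only: cinner_self flip: complex_norm_square of_real_mult) (simp add: power_mult_distrib)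
  hence "(norm (a *\<^sub>C x))\<^sup>2 = (cmod a * norm x)\<^sup>2"
    using of_real_eq_iff by blast
  thus ?thesis by (simp add: power2_eq_iff_nonneg)
qed

lemma cinner_norm_le: "cmod (cinner x y) \<le> norm x * norm (y :: 'h::complex_inner)"
proof -
  \<comment> \<open>The conjugate phase makes the product real and nonnegative, which reduces the
    claim to the real Cauchy-Schwarz inequality. As \<open>sgn 0 = 0\<close>, only
    \<open>cmod u \<le> 1\<close> can be asserted.\<close>
  define u where "u = cnj (sgn (cinner x y))"
  have "of_real (cmod (cinner x y)) = u * cinner x y"
    using complex_norm_square[of "cinner x y"]
    by (cases "cinner x y = 0")
       (auto simp: u_def sgn_div_norm complex_cnj_divide scaleR_conv_of_real power2_eq_square field_simps)
  also have "\<dots> = cinner x (u *\<^sub>C y)" by (simp add: cinner_scaleC_right)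
  finally have "cmod (cinner x y) = inner x (u *\<^sub>C y)"
    by (metis Re_cinner Re_complex_of_real)
  also have "\<dots> \<le> norm x * norm (u *\<^sub>C y)" by (rule norm_cauchy_schwarz)
  also have "\<dots> \<le> norm x * norm y"
  proof -
    have "cmod u \<le> 1" by (simp add: u_def norm_sgn)
    thus ?thesis by (simp add: norm_scaleC mult_left_mono mult_left_le_one_le)
  qed
  finally show ?thesis .
qed

section \<open>Linear and isometric maps between subspaces\<close>

definition linear_subspace :: "'h::complex_inner set \<Rightarrow> bool" where
  "linear_subspace H \<longleftrightarrow>
     0 \<in> H \<and> (\<forall>x\<in>H. \<forall>y\<in>H. x + y \<in> H) \<and> (\<forall>a. \<forall>x\<in>H. a *\<^sub>C x \<in> H)"

lemma linear_subspaceD: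
  assumes "linear_subspace H"
  shows "0 \<in> H" "x \<in> H \<Longrightarrow> y \<in> H \<Longrightarrow> x + y \<in> H" "x \<in> H \<Longrightarrow> a *\<^sub>C x \<in> H"
  using assms by (auto simp: linear_subspace_def)

lemma linear_subspace_sum:
  assumes "linear_subspace H" "\<And>i. i \<in> S \<Longrightarrow> f i \<in> H"
  shows "sum f S \<in> H"
  using assms(2) by (induction S rule: infinite_finite_induct) (auto intro: linear_subspaceD[OF assms(1)])

lemma hilbert_space_linear_subspace: "hilbert_space H \<Longrightarrow> linear_subspace H"
  by (simp add: hilbert_space_def linear_subspace_def)

lemma linear_subspace_coord_space: "linear_subspace (coord_space S)"
  by (rule hilbert_space_linear_subspace[OF hilbert_coord_space])

text \<open>The map leads from the first set to the second and is unconstrained elsewhere. Besides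
  operators on one space this covers the inclusion of a block, the projection onto one, and
  unitaries.\<close>

definition linear_between ::
  "'h::complex_inner set \<Rightarrow> 'k::complex_inner set \<Rightarrow> ('h \<Rightarrow> 'k) \<Rightarrow> bool" where
  "linear_between K H J \<longleftrightarrow> J ` K \<subseteq> H \<and>
     (\<forall>x\<in>K. \<forall>y\<in>K. J (x + y) = J x + J y) \<and> (\<forall>a. \<forall>x\<in>K. J (a *\<^sub>C x) = a *\<^sub>C J x)"

definition isometric_between ::
  "'h::complex_inner set \<Rightarrow> 'k::complex_inner set \<Rightarrow> ('h \<Rightarrow> 'k) \<Rightarrow> bool" where
  "isometric_between K H J \<longleftrightarrow> linear_between K H J \<and>
     (\<forall>x\<in>K. \<forall>y\<in>K. cinner (J x) (J y) = cinner x y)"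

lemma linear_betweenD:
  assumes "linear_between K H J"
  shows "x \<in> K \<Longrightarrow> J x \<in> H" "x \<in> K \<Longrightarrow> y \<in> K \<Longrightarrow> J (x + y) = J x + J y"
    "x \<in> K \<Longrightarrow> J (a *\<^sub>C x) = a *\<^sub>C J x"
  using assms by (auto simp: linear_between_def)

lemma linear_between_sum:
  assumes J: "linear_between K H J" and K: "linear_subspace K" and f: "\<And>i. i \<in> S \<Longrightarrow> f i \<in> K"
  shows "J (sum f S) = (\<Sum>i\<in>S. J (f i))"
proof -
  have 0: "J 0 = 0"
    using linear_betweenD(3)[OF J linear_subspaceD(1)[OF K], of 0] by simp
  show ?thesis using f
    by (induction S rule: infinite_finite_induct)
       (auto simp: 0 linear_betweenD(2)[OF J] linear_subspace_sum[OF K])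
qed

lemma isometric_between_norm:
  assumes "isometric_between K H J" "x \<in> K"
  shows "norm (J x) = norm x"
proof -
  have "(of_real ((norm (J x))\<^sup>2) :: complex) = of_real ((norm x)\<^sup>2)"
    unfolding cinner_self[symmetric] using assms by (auto simp: isometric_between_def)
  hence "(norm (J x))\<^sup>2 = (norm x)\<^sup>2" using of_real_eq_iff by blast
  thus ?thesis by (simp add: power2_eq_iff_nonneg)
qed

lemma isometric_between_eqD:
  assumes J: "isometric_between K H J" and K: "linear_subspace K" and "x \<in> K" "y \<in> K" "J x = J y"
  shows "x = y"
proof -
  have L: "linear_between K H J" using J by (simp add: isometric_between_def)
  have my: "(- 1) *\<^sub>C y \<in> K" using linear_subspaceD(3)[OF K \<open>y \<in> K\<close>] .
  have "J (x + (- 1) *\<^sub>C y) = J x + (- 1) *\<^sub>C J y"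
    by (simp only: linear_betweenD(2)[OF L \<open>x \<in> K\<close> my] linear_betweenD(3)[OF L \<open>y \<in> K\<close>])
  hence "J (x + (- 1) *\<^sub>C y) = 0" using assms(5) by (simp add: scaleC_minus1)
  hence "norm (x + (- 1) *\<^sub>C y) = 0"
    using isometric_between_norm[OF J linear_subspaceD(2)[OF K \<open>x \<in> K\<close> my]] by simp
  thus ?thesis by (simp add: scaleC_minus1)
qed


section \<open>Bounded operators and evaluation of polynomials\<close>

lemma bounded_opsD:
  assumes "T \<in> bounded_ops H"
  shows "x \<in> H \<Longrightarrow> T x \<in> H" "x \<notin> H \<Longrightarrow> T x = 0"
    "x \<in> H \<Longrightarrow> y \<in> H \<Longrightarrow> T (x + y) = T x + T y" "x \<in> H \<Longrightarrow> T (a *\<^sub>C x) = a *\<^sub>C T x"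
  using assms by (auto simp: bounded_ops_def)

lemma bounded_ops_bound:
  assumes "T \<in> bounded_ops H"
  obtains C where "C > 0" "\<And>x. x \<in> H \<Longrightarrow> norm (T x) \<le> C * norm x"
proof -
  obtain C where C: "\<forall>x\<in>H. norm (T x) \<le> C * norm x" using assms by (auto simp: bounded_ops_def)
  show thesis
  proof (rule that[of "max C 1"])
    fix x assume "x \<in> H"
    hence "norm (T x) \<le> C * norm x" using C by blast
    also have "\<dots> \<le> max C 1 * norm x" by (intro mult_right_mono) auto
    finally show "norm (T x) \<le> max C 1 * norm x" .
  qed simp
qed

lemma bounded_ops_zero_apply: "T \<in> bounded_ops H \<Longrightarrow> T 0 = 0"
  using bounded_opsD(2)[of T H 0] bounded_opsD(4)[of T H 0 0] by (cases "0 \<in> H") auto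

lemma bounded_opsI:
  assumes "linear_between H H T" "\<And>x. x \<notin> H \<Longrightarrow> T x = 0" "\<And>x. x \<in> H \<Longrightarrow> norm (T x) \<le> C * norm x"
  shows "T \<in> bounded_ops H"
  using assms by (auto simp: bounded_ops_def linear_between_def)

lemma id_on_bounded_ops: "linear_subspace H \<Longrightarrow> id_on H \<in> bounded_ops H"
  by (rule bounded_opsI[of _ _ 1]) (auto simp: id_on_def linear_between_def linear_subspaceD)

lemma comp_bounded_ops:
  assumes S: "S \<in> bounded_ops H" and T: "T \<in> bounded_ops H"
  shows "S \<circ> T \<in> bounded_ops H"
proof -
  obtain C where C: "C > 0" "\<And>x. x \<in> H \<Longrightarrow> norm (S x) \<le> C * norm x" using bounded_ops_bound[OF S] by blast
  obtain D where D: "D > 0" "\<And>x. x \<in> H \<Longrightarrow> norm (T x) \<le> D * norm x" using bounded_ops_bound[OF T] by blast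
  show ?thesis
  proof (rule bounded_opsI[of _ _ "C * D"])
    show "linear_between H H (S \<circ> T)"
      using bounded_opsD[OF S] bounded_opsD[OF T] by (auto simp: linear_between_def)
    show "(S \<circ> T) x = 0" if "x \<notin> H" for x
      using bounded_opsD(2)[OF T that] bounded_ops_zero_apply[OF S] by simp
    fix x assume x: "x \<in> H"
    have "norm (S (T x)) \<le> C * norm (T x)" using C(2) bounded_opsD(1)[OF T x] .
    also have "\<dots> \<le> C * (D * norm x)" using C(1) D(2)[OF x] by (intro mult_left_mono) auto
    finally show "norm ((S \<circ> T) x) \<le> C * D * norm x" by (simp add: mult.assoc)
  qed
qed

lemma lincomb_bounded_ops:
  assumes H: "linear_subspace H" and T: "\<And>i. i \<in> S \<Longrightarrow> T i \<in> bounded_ops H"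
  shows "(\<lambda>x. \<Sum>i\<in>S. c i *\<^sub>C T i x) \<in> bounded_ops H"
  using T
proof (induction S rule: infinite_finite_induct)
  case (insert j S)
  define R where "R = (\<lambda>x. \<Sum>i\<in>S. c i *\<^sub>C T i x)"
  have R: "R \<in> bounded_ops H" using insert by (simp add: R_def)
  have Tj: "T j \<in> bounded_ops H" using insert by simp
  obtain C where C: "C > 0" "\<And>x. x \<in> H \<Longrightarrow> norm (T j x) \<le> C * norm x" using bounded_ops_bound[OF Tj] by blast
  obtain D where D: "D > 0" "\<And>x. x \<in> H \<Longrightarrow> norm (R x) \<le> D * norm x" using bounded_ops_bound[OF R] by blast
  have "(\<lambda>x. c j *\<^sub>C T j x + R x) \<in> bounded_ops H"
  proof (rule bounded_opsI[of _ _ "cmod (c j) * C + D"])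
    show "linear_between H H (\<lambda>x. c j *\<^sub>C T j x + R x)"
      using bounded_opsD[OF Tj] bounded_opsD[OF R] linear_subspaceD[OF H]
      by (auto simp: linear_between_def scaleC_add_right scaleC_scaleC mult_ac)
    show "c j *\<^sub>C T j x + R x = 0" if "x \<notin> H" for x
      using bounded_opsD(2)[OF Tj that] bounded_opsD(2)[OF R that] by simp
    fix x assume x: "x \<in> H"
    have "norm (c j *\<^sub>C T j x + R x) \<le> cmod (c j) * norm (T j x) + norm (R x)"
      using norm_triangle_ineq[of "c j *\<^sub>C T j x" "R x"] by (simp add: norm_scaleC)
    also have "\<dots> \<le> cmod (c j) * (C * norm x) + D * norm x"
      by (intro add_mono mult_left_mono C(2) D(2) x) auto
    finally show "norm (c j *\<^sub>C T j x + R x) \<le> (cmod (c j) * C + D) * norm x"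
      by (simp add: algebra_simps)
  qed
  thus ?case using insert by (simp add: R_def)
qed (rule bounded_opsI[of _ _ 0]; auto simp: linear_between_def linear_subspaceD[OF H])+

lemma word_op_bounded_ops:
  assumes "linear_subspace H" "\<And>j. j < g \<Longrightarrow> A ! j \<in> bounded_ops H" "set w \<subseteq> {..<g}"
  shows "word_op H A w \<in> bounded_ops H"
  using assms(3)
  by (induction w) (auto simp: word_op_def intro!: comp_bounded_ops assms(2) id_on_bounded_ops[OF assms(1)])

lemma eval_op_bounded_ops:
  assumes "linear_subspace H" "\<And>j. j < g \<Longrightarrow> A ! j \<in> bounded_ops H" "p \<in> nc_polys g"
  shows "eval_op H p A \<in> bounded_ops H"
proof -
  have "(\<lambda>x. \<Sum>w\<in>Poly_Mapping.keys p. Poly_Mapping.lookup p w *\<^sub>C word_op H A w x) \<in> bounded_ops H"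
    by (rule lincomb_bounded_ops[OF assms(1)])
       (use assms(3) in \<open>auto simp: nc_polys_def intro!: word_op_bounded_ops[OF assms(1,2)]\<close>)
  thus ?thesis by (simp add: eval_op_def[abs_def])
qed

text \<open>Every word ends in \<open>id_on H\<close>, which kills vectors outside \<open>H\<close>;
  bounded operators vanish there too, so the two total functions agree everywhere.\<close>

lemma eval_op_nc_var:
  assumes "A ! j \<in> bounded_ops H"
  shows "eval_op H (nc_var j) A = A ! j"
proof
  fix x
  have "(A ! j) (id_on H x) = (A ! j) x"
    using bounded_opsD(2)[OF assms] bounded_ops_zero_apply[OF assms] by (auto simp: id_on_def)
  thus "eval_op H (nc_var j) A x = (A ! j) x"
    by (simp add: eval_op_def nc_var_def word_op_def)
qed

text \<open>The relation AJ = JB on \<open>K\<close>. It passes to products, hence to all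
  noncommutative polynomials, which a mere compression J*AJ = B does not.\<close>

definition intertwines ::
  "nat \<Rightarrow> 'h::complex_inner set \<Rightarrow> ('h \<Rightarrow> 'h) list \<Rightarrow> ('k::complex_inner \<Rightarrow> 'k) list \<Rightarrow> ('h \<Rightarrow> 'k) \<Rightarrow> bool"
  where "intertwines g K B A J \<longleftrightarrow> (\<forall>j<g. \<forall>x\<in>K. (A ! j) (J x) = J ((B ! j) x))"

lemma eval_op_intertwines:
  assumes J: "linear_between K H J" "intertwines g K B A J"
    and K: "linear_subspace K" and B: "\<And>j. j < g \<Longrightarrow> B ! j \<in> bounded_ops K"
    and p: "p \<in> nc_polys g" and x: "x \<in> K"
  shows "eval_op H p A (J x) = J (eval_op K p B x)"
proof -
  \<comment> \<open>Membership in \<open>K\<close> is carried along because the intertwining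
    relation is only known there.\<close>
  have word: "word_op H A w (J x) = J (word_op K B w x) \<and> word_op K B w x \<in> K"
    if "set w \<subseteq> {..<g}" for w
    using that
  proof (induction w)
    case Nil
    thus ?case using x linear_betweenD(1)[OF J(1) x] by (simp add: word_op_def id_on_def)
  next
    case (Cons j w)
    thus ?case using J(2) bounded_opsD(1)[OF B]
      by (auto simp: word_op_def intertwines_def)
  qed
  have w: "set w \<subseteq> {..<g}" if "w \<in> Poly_Mapping.keys p" for w
    using p that by (auto simp: nc_polys_def)
  have "eval_op H p A (J x) = (\<Sum>w\<in>Poly_Mapping.keys p. J (Poly_Mapping.lookup p w *\<^sub>C word_op K B w x))"
    unfolding eval_op_def by (intro sum.cong refl) (simp add: word[OF w] linear_betweenD(3)[OF J(1)])
  also have "\<dots> = J (eval_op K p B x)"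
    unfolding eval_op_def
    by (rule linear_between_sum[OF J(1) K, symmetric]) (use word[OF w] linear_subspaceD(3)[OF K] in auto)
  finally show ?thesis .
qed

section \<open>Positivity on \<open>\<Gamma>\<close>-operator systems\<close>

abbreviation (input) gens :: "'h::complex_inner set \<Rightarrow> nc_poly list \<Rightarrow> ('h \<Rightarrow> 'h) list \<Rightarrow> ('h \<Rightarrow> 'h) list" where
  "gens H \<Gamma> A \<equiv> id_on H # evals_op H \<Gamma> A"

text \<open>Positivity is attached to the coefficient array rather than to operators, so that
  systems on different spaces can be compared before there is a map between them.\<close>

definition gamma_positive ::
  "nc_poly list \<Rightarrow> 'h::complex_inner set \<Rightarrow> ('h \<Rightarrow> 'h) list \<Rightarrow> nat \<Rightarrow> (nat \<Rightarrow> nat \<Rightarrow> nat \<Rightarrow> complex) \<Rightarrow> bool"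
  where "gamma_positive \<Gamma> H A k c \<longleftrightarrow> positive_matrix H k (\<lambda>i j. op_comb (c i j) (gens H \<Gamma> A))"

lemma length_evals_op [simp]: "length (evals_op H \<Gamma> A) = length \<Gamma>"
  by (simp add: evals_op_def)

lemma nth_evals_op [simp]: "i < length \<Gamma> \<Longrightarrow> evals_op H \<Gamma> A ! i = eval_op H (\<Gamma> ! i) A"
  by (simp add: evals_op_def)

lemma op_comb_unit: "i < length Ts \<Longrightarrow> op_comb (\<lambda>l. if l = i then a else 0) Ts x = a *\<^sub>C (Ts ! i) x"
  by (simp add: op_comb_def if_distrib[of "\<lambda>c. c *\<^sub>C _"] cong: if_cong)

lemma op_comb_add: "op_comb (\<lambda>l. c l + d l) Ts x = op_comb c Ts x + op_comb d Ts x"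
  by (simp add: op_comb_def scaleC_add_left sum.distrib)

lemma op_comb_scale: "op_comb (\<lambda>l. a * c l) Ts x = a *\<^sub>C op_comb c Ts x"
  by (simp add: op_comb_def scaleC_sum_right scaleC_scaleC)

lemma op_comb_diff: "op_comb (\<lambda>l. c l - d l) Ts x = op_comb c Ts x - op_comb d Ts x"
  by (simp add: op_comb_def scaleC_diff_left sum_subtractf)

lemma op_comb_eq_iff_diff:
  "op_comb c Ts = op_comb d Ts \<longleftrightarrow> op_comb (\<lambda>l. c l - d l) Ts = (\<lambda>x. 0)"
  by (auto simp: fun_eq_iff op_comb_diff)

lemma op_comb_zero: "op_comb (\<lambda>l. 0) Ts x = 0"
  by (simp add: op_comb_def)

lemma gamma_systemI: "op_comb c (gens H \<Gamma> A) \<in> gamma_system H \<Gamma> A"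
  by (auto simp: gamma_system_def op_span_def)

lemma gamma_systemE:
  assumes "T \<in> gamma_system H \<Gamma> A"
  obtains c where "T = op_comb c (gens H \<Gamma> A)"
  using assms by (auto simp: gamma_system_def op_span_def)

lemma positive_matrix_cong:
  assumes "\<And>i j x. i < k \<Longrightarrow> j < k \<Longrightarrow> x \<in> H \<Longrightarrow> S i j x = T i j x"
  shows "positive_matrix H k S \<longleftrightarrow> positive_matrix H k T"
proof -
  have "(\<Sum>i<k. \<Sum>j<k. cinner (h i) (S i j (h j))) = (\<Sum>i<k. \<Sum>j<k. cinner (h i) (T i j (h j)))"
    if "\<forall>i<k. h i \<in> H" for h
    using that assms by (intro sum.cong refl) auto
  thus ?thesis by (auto simp: positive_matrix_def)
qed

text \<open>The form over \<open>B\<close> at vectors \<open>h i\<close> is the form over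
  \<open>A\<close> at their images under \<open>J\<close>.\<close>

lemma gamma_positive_isometric:
  assumes J: "isometric_between K H J"
    and comb: "\<And>c x. x \<in> K \<Longrightarrow> op_comb c (gens H \<Gamma> A) (J x) = J (op_comb c (gens K \<Gamma> B) x)"
    and stable: "\<And>c x. x \<in> K \<Longrightarrow> op_comb c (gens K \<Gamma> B) x \<in> K"
    and pos: "gamma_positive \<Gamma> H A k c"
  shows "gamma_positive \<Gamma> K B k c"
  unfolding gamma_positive_def positive_matrix_def
proof (intro allI impI)
  fix h assume h: "\<forall>i<k. h i \<in> K"
  have "cinner (J (h i)) (op_comb (c i j) (gens H \<Gamma> A) (J (h j))) =
        cinner (h i) (op_comb (c i j) (gens K \<Gamma> B) (h j))" if "i < k" "j < k" for i j
    using that h J stable by (simp add: comb isometric_between_def)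
  moreover have "0 \<le> (\<Sum>i<k. \<Sum>j<k. cinner (J (h i)) (op_comb (c i j) (gens H \<Gamma> A) (J (h j))))"
    using pos[unfolded gamma_positive_def positive_matrix_def, rule_format, of "\<lambda>i. J (h i)"] h J
    by (auto simp: isometric_between_def linear_between_def)
  ultimately show "0 \<le> (\<Sum>i<k. \<Sum>j<k. cinner (h i) (op_comb (c i j) (gens K \<Gamma> B) (h j)))"
    by simp
qed

text \<open>Pairing \<open>h\<^sub>0 = - T h\<^sub>1\<close> with the matrix whose only nonzero entry is \<open>T\<close> in position \<open>(0, 1)\<close>
  shows that its positivity forces \<open>T = 0\<close>.\<close>

lemma positive_corner_iff_zero:
  assumes T: "T \<in> bounded_ops H" and H: "linear_subspace H"
  shows "positive_matrix H 2 (\<lambda>i j. if i = 0 \<and> j = 1 then T else (\<lambda>x. 0)) \<longleftrightarrow> T = (\<lambda>x. 0)"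
proof
  assume pos: "positive_matrix H 2 (\<lambda>i j. if i = 0 \<and> j = 1 then T else (\<lambda>x. 0))"
  show "T = (\<lambda>x. 0)"
  proof
    fix x
    show "T x = 0"
    proof (cases "x \<in> H")
      case True
      have Tx: "(- 1) *\<^sub>C T x \<in> H" using True bounded_opsD(1)[OF T] linear_subspaceD(3)[OF H] by blast
      define h where "h = (\<lambda>i::nat. if i = 0 then (- 1) *\<^sub>C T x else x)"
      have "\<forall>i<2. h i \<in> H" using Tx True by (simp add: h_def)
      hence "0 \<le> (\<Sum>i<2. \<Sum>j<2. cinner (h i) ((if i = 0 \<and> j = 1 then T else (\<lambda>x. 0)) (h j)))"
        using pos unfolding positive_matrix_def by blast
      hence "0 \<le> - cinner (T x) (T x)"
        by (simp add: h_def numeral_2_eq_2 cinner_minus_left scaleC_minus1)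
      hence "(norm (T x))\<^sup>2 \<le> 0" by (simp add: cinner_self less_eq_complex_def flip: of_real_power)
      thus ?thesis by simp
    qed (rule bounded_opsD(2)[OF T])
  qed
qed (simp add: positive_matrix_def if_distrib[of "\<lambda>T. T _"] cong: if_cong)

locale gamma_tuple =
  fixes g :: nat and \<Gamma> :: "nc_poly list"
  assumes g_le: "g \<le> length \<Gamma>"
    and Gamma_poly: "p \<in> set \<Gamma> \<Longrightarrow> p \<in> nc_polys g"
    and Gamma_sym: "p \<in> set \<Gamma> \<Longrightarrow> symmetric_nc p"
    and Gamma_var: "j < g \<Longrightarrow> \<Gamma> ! j = nc_var j"
begin

definition op_tuple :: "'h::complex_inner set \<Rightarrow> ('h \<Rightarrow> 'h) list \<Rightarrow> bool" where
  "op_tuple H A \<longleftrightarrow> linear_subspace H \<and> length A = g \<and> (\<forall>j<g. A ! j \<in> bounded_ops H)"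

lemma op_tupleD:
  assumes "op_tuple H A"
  shows "linear_subspace H" "length A = g" "j < g \<Longrightarrow> A ! j \<in> bounded_ops H"
  using assms by (auto simp: op_tuple_def)

lemma gens_bounded_ops:
  assumes "op_tuple H A" "i < Suc (length \<Gamma>)"
  shows "gens H \<Gamma> A ! i \<in> bounded_ops H"
  using assms(2)
  by (cases i) (auto intro!: id_on_bounded_ops eval_op_bounded_ops op_tupleD[OF assms(1)] Gamma_poly)

lemma op_comb_bounded_ops:
  assumes "op_tuple H A"
  shows "op_comb c (gens H \<Gamma> A) \<in> bounded_ops H"
  unfolding op_comb_def[abs_def]
  by (rule lincomb_bounded_ops[OF op_tupleD(1)[OF assms]]) (simp del: nth_Cons_Suc add: gens_bounded_ops[OF assms])

lemma evals_op_var: "op_tuple H A \<Longrightarrow> j < g \<Longrightarrow> evals_op H \<Gamma> A ! j = A ! j"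
  using g_le by (simp add: Gamma_var eval_op_nc_var op_tupleD)

lemma op_comb_intertwines:
  assumes J: "linear_between K H J" "intertwines g K B A J" and B: "op_tuple K B" and x: "x \<in> K"
  shows "op_comb c (gens H \<Gamma> A) (J x) = J (op_comb c (gens K \<Gamma> B) x)"
proof -
  have K: "linear_subspace K" by (rule op_tupleD[OF B])
  have gen: "(gens H \<Gamma> A ! i) (J x) = J ((gens K \<Gamma> B ! i) x)" if "i < Suc (length \<Gamma>)" for i
  proof (cases i)
    case 0
    thus ?thesis using x linear_betweenD(1)[OF J(1) x] by (simp add: id_on_def)
  next
    case (Suc l)
    have "\<Gamma> ! l \<in> nc_polys g" using that Suc by (auto intro: Gamma_poly)
    thus ?thesis using eval_op_intertwines[OF J K op_tupleD(3)[OF B] _ x] that Suc by simp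
  qed
  have "op_comb c (gens H \<Gamma> A) (J x) = (\<Sum>i<Suc (length \<Gamma>). J (c i *\<^sub>C (gens K \<Gamma> B ! i) x))"
    unfolding op_comb_def
    by (intro sum.cong) (auto simp del: nth_Cons_Suc
        simp: gen linear_betweenD(3)[OF J(1)] bounded_opsD(1)[OF gens_bounded_ops[OF B] x])
  also have "\<dots> = J (op_comb c (gens K \<Gamma> B) x)"
    unfolding op_comb_def
    by (subst linear_between_sum[OF J(1) K])
       (auto simp del: nth_Cons_Suc intro!: linear_subspaceD(3)[OF K] bounded_opsD(1)[OF gens_bounded_ops[OF B] x])
  finally show ?thesis .
qed

lemma gamma_positive_intertwines:
  assumes J: "isometric_between K H J" "intertwines g K B A J" and B: "op_tuple K B"
    and "gamma_positive \<Gamma> H A k c"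
  shows "gamma_positive \<Gamma> K B k c"
proof (rule gamma_positive_isometric[OF J(1) _ _ assms(4)])
  show "op_comb c (gens H \<Gamma> A) (J x) = J (op_comb c (gens K \<Gamma> B) x)" if "x \<in> K" for c x
    using J that by (intro op_comb_intertwines[OF _ _ B]) (auto simp: isometric_between_def)
  show "op_comb c (gens K \<Gamma> B) x \<in> K" if "x \<in> K" for c x
    by (rule bounded_opsD(1)[OF op_comb_bounded_ops[OF B] that])
qed

text \<open>Unit coefficient vectors show that \<phi> sends each \<gamma>_l(A) to \<gamma>_l(B). As
  the first g polynomials are the variables, it sends A to B, and the identity required of a
  \<Gamma>-ucp map follows. Complete positivity is the hypothesis on coefficient arrays, after
  choosing coefficients for each entry.\<close>

lemma gamma_ucpI:
  assumes A: "op_tuple H A" and B: "op_tuple K B"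
    and \<phi>: "\<And>c. \<phi> (op_comb c (gens H \<Gamma> A)) = op_comb c (gens K \<Gamma> B)"
    and pos: "\<And>k c. gamma_positive \<Gamma> H A k c \<Longrightarrow> gamma_positive \<Gamma> K B k c"
  shows "gamma_ucp \<Gamma> H A K \<phi>" and "map \<phi> A = B"
proof -
  have unit: "\<phi> (gens H \<Gamma> A ! i) = gens K \<Gamma> B ! i" if "i < Suc (length \<Gamma>)" for i
  proof -
    have "op_comb (\<lambda>l. if l = i then 1 else 0) (gens H \<Gamma> A) = gens H \<Gamma> A ! i"
         "op_comb (\<lambda>l. if l = i then 1 else 0) (gens K \<Gamma> B) = gens K \<Gamma> B ! i"
      using that by (auto simp: op_comb_unit simp del: nth_Cons_Suc)
    thus ?thesis using \<phi>[of "\<lambda>l. if l = i then 1 else 0"] by simp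
  qed
  have evals: "map \<phi> (evals_op H \<Gamma> A) = evals_op K \<Gamma> B"
    by (rule nth_equalityI) (use unit[of "Suc _"] in auto)
  show map: "map \<phi> A = B"
  proof (rule nth_equalityI)
    fix j assume "j < length (map \<phi> A)"
    hence "j < g" by (simp add: op_tupleD[OF A])
    moreover from this have "\<phi> (A ! j) = B ! j"
      using unit[of "Suc j"] evals_op_var[OF A] evals_op_var[OF B] g_le by simp
    ultimately show "map \<phi> A ! j = B ! j" by (simp add: op_tupleD[OF A])
  qed (simp add: op_tupleD[OF A] op_tupleD[OF B])
  show "gamma_ucp \<Gamma> H A K \<phi>"
    unfolding gamma_ucp_def
  proof (intro conjI)
    show "\<phi> ` gamma_system H \<Gamma> A \<subseteq> bounded_ops K"
      using op_comb_bounded_ops[OF B] by (auto elim!: gamma_systemE simp: \<phi>)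
    show "linear_on_ops (gamma_system H \<Gamma> A) \<phi>"
      unfolding linear_on_ops_def
      by (auto elim!: gamma_systemE simp: \<phi> simp flip: op_comb_add op_comb_scale)
    show "\<phi> (id_on H) = id_on K" using unit[of 0] by simp
    show "completely_positive H (gamma_system H \<Gamma> A) K \<phi>"
      unfolding completely_positive_def
    proof (intro allI impI, elim conjE)
      fix k T
      assume T: "\<forall>i<k. \<forall>j<k. T i j \<in> gamma_system H \<Gamma> A" and TP: "positive_matrix H k T"
      have "\<exists>c. i < k \<and> j < k \<longrightarrow> T i j = op_comb c (gens H \<Gamma> A)" for i j
        using T by (meson gamma_systemE)
      then obtain c where c: "\<And>i j. i < k \<Longrightarrow> j < k \<Longrightarrow> T i j = op_comb (c i j) (gens H \<Gamma> A)"
        by metis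
      have "gamma_positive \<Gamma> H A k c"
        using TP unfolding gamma_positive_def by (subst positive_matrix_cong[where T = T]) (auto simp: c)
      hence "gamma_positive \<Gamma> K B k c" by (rule pos)
      thus "positive_matrix K k (\<lambda>i j. \<phi> (T i j))"
        unfolding gamma_positive_def by (subst positive_matrix_cong) (auto simp: c \<phi>)
    qed
    show "map \<phi> (evals_op H \<Gamma> A) = evals_op K \<Gamma> (map \<phi> A)" by (simp only: evals map)
  qed
qed

text \<open>Linearity reduces this to the generators, where it is unitality together with the
  polynomial identities.\<close>

lemma gamma_ucp_op_comb:
  assumes "gamma_ucp \<Gamma> H A K \<phi>"
  shows "\<phi> (op_comb c (gens H \<Gamma> A)) = op_comb c (gens K \<Gamma> (map \<phi> A))"
proof -
  define E where "E = gens H \<Gamma> A"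
  define F where "F = gens K \<Gamma> (map \<phi> A)"
  have lin: "\<phi> (\<lambda>x. op_comb c E x + op_comb d E x) = (\<lambda>y. \<phi> (op_comb c E) y + \<phi> (op_comb d E) y)"
            "\<phi> (\<lambda>x. a *\<^sub>C op_comb c E x) = (\<lambda>y. a *\<^sub>C \<phi> (op_comb c E) y)" for c d a
    using assms by (auto simp: gamma_ucp_def linear_on_ops_def E_def gamma_systemI)
  have unit: "\<phi> (E ! i) = F ! i" if "i < Suc (length \<Gamma>)" for i
  proof (cases i)
    case (Suc l)
    have "\<phi> (E ! i) = map \<phi> (evals_op H \<Gamma> A) ! l" using that Suc by (simp add: E_def)
    also have "map \<phi> (evals_op H \<Gamma> A) = evals_op K \<Gamma> (map \<phi> A)"
      using assms by (simp add: gamma_ucp_def)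
    finally show ?thesis using Suc by (simp add: F_def)
  qed (use assms in \<open>simp add: gamma_ucp_def E_def F_def\<close>)
  \<comment> \<open>\<open>linear_on_ops\<close> speaks of sums of two operators, so the
    coefficients are switched on one at a time.\<close>
  have "\<phi> (op_comb (\<lambda>l. if l < m then c l else 0) E) = op_comb (\<lambda>l. if l < m then c l else 0) F"
    if "m \<le> Suc (length \<Gamma>)" for m
    using that
  proof (induction m)
    case 0
    have "op_comb (\<lambda>l. 0) E = (\<lambda>x. 0 *\<^sub>C op_comb c E x)" by (auto simp: op_comb_zero)
    hence "\<phi> (op_comb (\<lambda>l. 0) E) = (\<lambda>y. 0)" by (simp only: lin(2)) simp
    thus ?case by (simp add: op_comb_zero[abs_def])
  next
    case (Suc m)
    define u where "u = (\<lambda>l. if l = m then 1 else 0 :: complex)"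
    have split: "(\<lambda>l. if l < Suc m then c l else 0) = (\<lambda>l. (if l < m then c l else 0) + c m * u l)"
      by (auto simp: u_def fun_eq_iff less_Suc_eq)
    have u: "op_comb u E = E ! m" "op_comb u F = F ! m"
      using Suc.prems by (auto simp: u_def op_comb_unit E_def F_def simp del: nth_Cons_Suc)
    have "\<phi> (op_comb (\<lambda>l. if l < Suc m then c l else 0) E) =
        (\<lambda>y. \<phi> (op_comb (\<lambda>l. if l < m then c l else 0) E) y + \<phi> (op_comb (\<lambda>l. c m * u l) E) y)"
      unfolding split op_comb_add[abs_def] by (rule lin(1))
    also have "\<phi> (op_comb (\<lambda>l. c m * u l) E) = op_comb (\<lambda>l. c m * u l) F"
      unfolding op_comb_scale[abs_def]
      using lin(2)[of "c m" u] Suc.prems by (simp add: u unit)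
    finally show ?case
      unfolding split op_comb_add[abs_def] using Suc by simp
  qed
  from this[of "Suc (length \<Gamma>)"] have "\<phi> (op_comb (\<lambda>l. if l < Suc (length \<Gamma>) then c l else 0) E) =
      op_comb (\<lambda>l. if l < Suc (length \<Gamma>) then c l else 0) F" by simp
  moreover have "op_comb (\<lambda>l. if l < Suc (length \<Gamma>) then c l else 0) E = op_comb c E"
    "op_comb (\<lambda>l. if l < Suc (length \<Gamma>) then c l else 0) F = op_comb c F"
    by (auto simp: op_comb_def E_def F_def intro!: sum.cong)
  ultimately show ?thesis by (simp add: E_def F_def)
qed

lemma gamma_ucp_gamma_positive:
  assumes "gamma_ucp \<Gamma> H A K \<phi>" "gamma_positive \<Gamma> H A k c"
  shows "gamma_positive \<Gamma> K (map \<phi> A) k c"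
proof -
  have "positive_matrix K k (\<lambda>i j. \<phi> (op_comb (c i j) (gens H \<Gamma> A)))"
    using assms by (auto simp: gamma_ucp_def completely_positive_def gamma_positive_def gamma_systemI)
  thus ?thesis by (simp add: gamma_positive_def gamma_ucp_op_comb[OF assms(1)])
qed

text \<open>This puts linear relations among the generators into the language of
  \<open>gamma_positive\<close>, so that systems with the same positive arrays have the same
  relations.\<close>

lemma op_comb_eq_zero_iff:
  assumes "op_tuple H A"
  shows "op_comb c (gens H \<Gamma> A) = (\<lambda>x. 0) \<longleftrightarrow>
    gamma_positive \<Gamma> H A 2 (\<lambda>i j. if i = 0 \<and> j = 1 then c else (\<lambda>l. 0))"
proof -
  have "(\<lambda>i j. op_comb (if i = 0 \<and> j = 1 then c else (\<lambda>l. 0)) (gens H \<Gamma> A)) =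
    (\<lambda>i j. if i = (0::nat) \<and> j = (1::nat) then op_comb c (gens H \<Gamma> A) else (\<lambda>x. 0))"
    by (auto simp: fun_eq_iff op_comb_zero)
  thus ?thesis
    unfolding gamma_positive_def
    by (simp only: positive_corner_iff_zero[OF op_comb_bounded_ops[OF assms] op_tupleD(1)[OF assms]])
qed

lemma gamma_isomorphicI:
  assumes A: "op_tuple H A" and B: "op_tuple K B"
    and pos: "\<And>k c. gamma_positive \<Gamma> H A k c \<longleftrightarrow> gamma_positive \<Gamma> K B k c"
  shows "gamma_isomorphic \<Gamma> H A K B"
proof -
  define E where "E = gens H \<Gamma> A"
  define F where "F = gens K \<Gamma> B"
  have eq: "op_comb c E = op_comb d E \<longleftrightarrow> op_comb c F = op_comb d F" for c d
  proof -
    show ?thesis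
      unfolding E_def F_def
      by (simp only: op_comb_eq_iff_diff[of c]  op_comb_eq_zero_iff[OF A] op_comb_eq_zero_iff[OF B] pos)
  qed
  \<comment> \<open>A choice of coefficients for \<open>T\<close>; by \<open>eq\<close> the value
    does not depend on it.\<close>
  define \<phi> where "\<phi> = (\<lambda>T. op_comb (SOME c. T = op_comb c E) F)"
  have \<phi>: "\<phi> (op_comb c E) = op_comb c F" for c
    unfolding \<phi>_def by (rule someI2[where a = c]) (auto simp: eq)
  have sys: "gamma_system H \<Gamma> A = range (\<lambda>c. op_comb c E)" "gamma_system K \<Gamma> B = range (\<lambda>c. op_comb c F)"
    by (auto simp: gamma_system_def op_span_def E_def F_def)
  have inj: "inj_on \<phi> (gamma_system H \<Gamma> A)" by (auto simp: inj_on_def sys \<phi> eq)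
  have bij: "bij_betw \<phi> (gamma_system H \<Gamma> A) (gamma_system K \<Gamma> B)"
    unfolding bij_betw_def using inj by (auto simp: sys \<phi> image_iff)
  have inv: "inv_into (gamma_system H \<Gamma> A) \<phi> (op_comb c F) = op_comb c E" for c
    using inv_into_f_f[OF inj, of "op_comb c E"] by (simp add: \<phi> sys)
  have "gamma_ucp \<Gamma> H A K \<phi>"
    by (rule gamma_ucpI(1)[OF A B]) (use \<phi> pos in \<open>auto simp: E_def F_def\<close>)
  moreover have "gamma_ucp \<Gamma> K B H (inv_into (gamma_system H \<Gamma> A) \<phi>)"
    by (rule gamma_ucpI(1)[OF B A]) (use inv pos in \<open>auto simp: E_def F_def\<close>)
  ultimately show ?thesis unfolding gamma_isomorphic_def using bij by blast
qed

end

section \<open>Matrices as operators and direct sums\<close>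

lemma Rep_Abs_ell2_finite:
  assumes "finite S" "\<And>i. i \<notin> S \<Longrightarrow> f i = 0"
  shows "Rep_ell2 (Abs_ell2 f) = f"
proof (rule Abs_ell2_inverse)
  have "(\<lambda>i. (cmod (f i))\<^sup>2) summable_on S" using assms(1) by simp
  also have "?this \<longleftrightarrow> (\<lambda>i. (cmod (f i))\<^sup>2) summable_on UNIV"
    by (rule summable_on_cong_neutral) (use assms in auto)
  finally show "f \<in> {f. (\<lambda>i. (cmod (f i))\<^sup>2) summable_on UNIV}" by simp
qed

lemma Rep_Abs_ell2_if:
  assumes "finite {i. P i}"
  shows "Rep_ell2 (Abs_ell2 (\<lambda>i. if P i then f i else 0)) = (\<lambda>i. if P i then f i else 0)"
  by (rule Rep_Abs_ell2_finite[OF assms]) simp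

lemma cinner_ell2_has_sum:
  "((\<lambda>i. cnj (Rep_ell2 f i) * Rep_ell2 h i) has_sum cinner f h) UNIV"
  unfolding cinner_ell2.rep_eq
  by (rule has_sum_infsum) (rule ell2_summable_prod[OF Rep_ell2_summable Rep_ell2_summable])

lemma coord_spaceD: "f \<in> coord_space S \<Longrightarrow> i \<notin> S \<Longrightarrow> Rep_ell2 f i = 0"
  by (simp add: coord_space_def)

lemma cinner_ell2_finite:
  assumes "finite S" "f \<in> coord_space S"
  shows "cinner f h = (\<Sum>i\<in>S. cnj (Rep_ell2 f i) * Rep_ell2 h i)"
proof -
  have "((\<lambda>i. cnj (Rep_ell2 f i) * Rep_ell2 h i) has_sum cinner f h) S"
    using cinner_ell2_has_sum[of f h]
    by (rule has_sum_cong_neutral[THEN iffD1, rotated -1]) (use assms in \<open>auto simp: coord_spaceD\<close>)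
  thus ?thesis using assms(1) by (simp add: has_sum_finite_iff)
qed

lemma norm_ell2_finite:
  assumes "finite S" "f \<in> coord_space S"
  shows "(norm f)\<^sup>2 = (\<Sum>i\<in>S. (cmod (Rep_ell2 f i))\<^sup>2)"
proof -
  have "(of_real ((norm f)\<^sup>2) :: complex) = (\<Sum>i\<in>S. of_real ((cmod (Rep_ell2 f i))\<^sup>2))"
    unfolding cinner_self[symmetric] cinner_ell2_finite[OF assms]
    by (intro sum.cong refl) (simp add: complex_norm_square mult.commute del: of_real_power)
  thus ?thesis unfolding of_real_sum[symmetric] of_real_eq_iff .
qed

lemma sum_le_norm_ell2:
  assumes "finite S"
  shows "(\<Sum>i\<in>S. (cmod (Rep_ell2 f i))\<^sup>2) \<le> (norm f)\<^sup>2"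
  unfolding norm_ell2_sq by (rule finite_sum_le_infsum[OF Rep_ell2_summable assms]) auto

lemma Rep_ell2_le_norm: "cmod (Rep_ell2 f i) \<le> norm f"
  using sum_le_norm_ell2[of "{i}" f] by (simp add: power2_le_iff_abs_le)

lemma mat_op_in_coord_space: "mat_op n M f \<in> coord_space {..<n}"
  by (simp add: mat_op_def Rep_Abs_ell2_if coord_space_def zero_ell2.rep_eq)

lemma Rep_mat_op:
  assumes "f \<in> coord_space {..<n}"
  shows "Rep_ell2 (mat_op n M f) i = (if i < n then \<Sum>j<n. M $$ (i, j) * Rep_ell2 f j else 0)"
  using assms by (simp add: mat_op_def Rep_Abs_ell2_if)

lemma mat_op_linear_between: "linear_between (coord_space {..<n}) (coord_space {..<n}) (mat_op n M)"
  unfolding linear_between_def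
  using mat_op_in_coord_space linear_subspaceD[OF linear_subspace_coord_space[of "{..<n}"]]
  by (auto intro!: ell2_eqI
      simp: Rep_mat_op plus_ell2.rep_eq scaleC_ell2.rep_eq algebra_simps sum.distrib sum_distrib_left)

lemma mat_op_bounded_ops: "mat_op n M \<in> bounded_ops (coord_space {..<n})"
proof (rule bounded_opsI[OF mat_op_linear_between])
  define C where "C = (\<Sum>i<n. (\<Sum>j<n. cmod (M $$ (i, j)))\<^sup>2)"
  fix f assume f: "f \<in> coord_space {..<n}"
  have "(norm (mat_op n M f))\<^sup>2 = (\<Sum>i<n. (cmod (\<Sum>j<n. M $$ (i, j) * Rep_ell2 f j))\<^sup>2)"
    using f by (simp add: norm_ell2_finite[OF _ mat_op_in_coord_space] Rep_mat_op)
  also have "\<dots> \<le> (\<Sum>i<n. (\<Sum>j<n. cmod (M $$ (i, j)) * norm f)\<^sup>2)"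
    by (intro sum_mono power_mono order_trans[OF norm_sum])
       (auto simp: norm_mult intro!: mult_left_mono Rep_ell2_le_norm)
  also have "\<dots> = C * (norm f)\<^sup>2"
    by (simp add: C_def sum_distrib_right power_mult_distrib flip: sum_distrib_right)
  also have "\<dots> = (sqrt C * norm f)\<^sup>2"
    by (simp add: power_mult_distrib C_def sum_nonneg)
  finally show "norm (mat_op n M f) \<le> sqrt C * norm f"
    by (rule power2_le_imp_le) (auto simp: C_def sum_nonneg)
qed (simp add: mat_op_def)

lemma mat_op_one: "mat_op n (1\<^sub>m n) = id_on (coord_space {..<n})"
proof
  fix f
  show "mat_op n (1\<^sub>m n) f = id_on (coord_space {..<n}) f"
  proof (cases "f \<in> coord_space {..<n}")
    case True
    show ?thesis
    proof (rule ell2_eqI)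
      fix i
      have "(\<Sum>j<n. 1\<^sub>m n $$ (i, j) * Rep_ell2 f j) = (\<Sum>j<n. if j = i then Rep_ell2 f j else 0)" if "i < n"
        using that by (intro sum.cong) auto
      thus "Rep_ell2 (mat_op n (1\<^sub>m n) f) i = Rep_ell2 (id_on (coord_space {..<n}) f) i"
        using True by (auto simp: Rep_mat_op id_on_def coord_spaceD)
    qed
  qed (simp add: mat_op_def id_on_def)
qed

lemma mat_op_mult:
  assumes "M \<in> carrier_mat n n" "N \<in> carrier_mat n n"
  shows "mat_op n (M * N) = mat_op n M \<circ> mat_op n N"
proof
  fix f
  show "mat_op n (M * N) f = (mat_op n M \<circ> mat_op n N) f"
  proof (cases "f \<in> coord_space {..<n}")
    case True
    have "(\<Sum>j<n. (M * N) $$ (i, j) * Rep_ell2 f j) =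
        (\<Sum>l<n. M $$ (i, l) * (\<Sum>j<n. N $$ (l, j) * Rep_ell2 f j))" if "i < n" for i
    proof -
      have "(M * N) $$ (i, j) = (\<Sum>l<n. M $$ (i, l) * N $$ (l, j))" if "j < n" for j
        using assms that \<open>i < n\<close> by (auto simp: scalar_prod_def lessThan_atLeast0 intro!: sum.cong)
      hence "(\<Sum>j<n. (M * N) $$ (i, j) * Rep_ell2 f j) =
          (\<Sum>j<n. \<Sum>l<n. M $$ (i, l) * N $$ (l, j) * Rep_ell2 f j)"
        by (simp add: sum_distrib_right)
      also have "\<dots> = (\<Sum>l<n. \<Sum>j<n. M $$ (i, l) * N $$ (l, j) * Rep_ell2 f j)"
        by (rule sum.swap)
      finally show ?thesis by (simp add: sum_distrib_left mult.assoc)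
    qed
    thus ?thesis
      by (intro ell2_eqI) (simp add: Rep_mat_op[OF True] Rep_mat_op[OF mat_op_in_coord_space])
  qed (simp add: bounded_opsD(2)[OF mat_op_bounded_ops] bounded_ops_zero_apply[OF mat_op_bounded_ops])
qed

lemma word_mat_carrier:
  assumes "X \<in> sa_mats g n" "set w \<subseteq> {..<g}"
  shows "word_mat n X w \<in> carrier_mat n n"
  using assms(2)
proof (induction w)
  case (Cons j w)
  hence "X ! j \<in> carrier_mat n n" using assms(1) by (auto simp: sa_mats_def)
  moreover have "word_mat n X w \<in> carrier_mat n n" using Cons by simp
  ultimately show ?case by (simp add: word_mat_def)
qed (simp add: word_mat_def)

lemma word_op_mat:
  assumes "X \<in> sa_mats g n" "set w \<subseteq> {..<g}"
  shows "word_op (coord_space {..<n}) (map (mat_op n) X) w = mat_op n (word_mat n X w)"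
  using assms(2)
proof (induction w)
  case (Cons j w)
  have "j < length X" "X ! j \<in> carrier_mat n n" using assms(1) Cons by (auto simp: sa_mats_def)
  thus ?case
    using Cons word_mat_carrier[OF assms(1), of w] by (simp add: word_op_def word_mat_def mat_op_mult)
qed (simp add: word_op_def word_mat_def mat_op_one)

lemma sum_Rep_ell2: "Rep_ell2 (sum f S) i = (\<Sum>s\<in>S. Rep_ell2 (f s) i)"
  by (induction S rule: infinite_finite_induct) (auto simp: zero_ell2.rep_eq plus_ell2.rep_eq)

lemma eval_op_mat:
  assumes "X \<in> sa_mats g n" "p \<in> nc_polys g"
  shows "eval_op (coord_space {..<n}) p (map (mat_op n) X) = mat_op n (eval_mat n p X)"
proof
  fix f
  have w: "set w \<subseteq> {..<g}" if "w \<in> Poly_Mapping.keys p" for w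
    using assms(2) that by (auto simp: nc_polys_def)
  have op: "eval_op (coord_space {..<n}) p (map (mat_op n) X) f =
      (\<Sum>w\<in>Poly_Mapping.keys p. Poly_Mapping.lookup p w *\<^sub>C mat_op n (word_mat n X w) f)"
    unfolding eval_op_def by (intro sum.cong refl) (simp add: word_op_mat[OF assms(1) w])
  show "eval_op (coord_space {..<n}) p (map (mat_op n) X) f = mat_op n (eval_mat n p X) f"
  proof (cases "f \<in> coord_space {..<n}")
    case True
    show ?thesis
    proof (rule ell2_eqI)
      fix i
      have "(\<Sum>w\<in>Poly_Mapping.keys p. Poly_Mapping.lookup p w * (\<Sum>j<n. word_mat n X w $$ (i, j) * Rep_ell2 f j)) =
          (\<Sum>j<n. eval_mat n p X $$ (i, j) * Rep_ell2 f j)" if "i < n"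
        using that
        by (simp add: eval_mat_def sum_distrib_left sum_distrib_right mult.assoc) (rule sum.swap)
      thus "Rep_ell2 (eval_op (coord_space {..<n}) p (map (mat_op n) X) f) i =
          Rep_ell2 (mat_op n (eval_mat n p X) f) i"
        by (simp add: op sum_Rep_ell2 scaleC_ell2.rep_eq Rep_mat_op[OF True])
    qed
  qed (simp add: op, simp add: mat_op_def)
qed

section \<open>Blocks of a direct sum: projections and inclusions\<close>

definition block :: "nat \<Rightarrow> 'a \<Rightarrow> ('a \<times> nat) ell2 \<Rightarrow> nat ell2" where
  "block n a f = Abs_ell2 (\<lambda>i. if i < n then Rep_ell2 f (a, i) else 0)"

text \<open>The inclusion adjoint to \<open>block\<close>. Both take the size of the block as an
  argument, since the index \<open>a\<close> does not determine it.\<close>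

definition embed_block :: "nat \<Rightarrow> 'a \<Rightarrow> nat ell2 \<Rightarrow> ('a \<times> nat) ell2" where
  "embed_block n a v = Abs_ell2 (\<lambda>p. if fst p = a \<and> snd p < n then Rep_ell2 v (snd p) else 0)"

lemma Rep_block: "Rep_ell2 (block n a f) i = (if i < n then Rep_ell2 f (a, i) else 0)"
  by (simp add: block_def Rep_Abs_ell2_if)

lemma Rep_embed_block: "Rep_ell2 (embed_block n a v) (b, i) = (if b = a \<and> i < n then Rep_ell2 v i else 0)"
proof -
  have "{p. fst p = a \<and> snd p < n} = {a} \<times> {..<n}" by auto
  hence "finite {p. fst p = a \<and> snd p < n}" by simp
  thus ?thesis by (simp add: embed_block_def Rep_Abs_ell2_if)
qed

lemma block_in_coord_space: "block n a f \<in> coord_space {..<n}"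
  by (simp add: coord_space_def Rep_block)

lemma block_linear_between: "linear_between (dsum_space I d) (coord_space {..<n}) (block n a)"
  unfolding linear_between_def
  by (auto intro!: ell2_eqI simp: block_in_coord_space Rep_block plus_ell2.rep_eq scaleC_ell2.rep_eq)

lemma embed_block_in_dsum_space: "a \<in> I \<Longrightarrow> embed_block (d a) a v \<in> dsum_space I d"
  by (auto simp: dsum_space_def coord_space_def Rep_embed_block)

lemma embed_block_isometric_between:
  assumes "a \<in> I"
  shows "isometric_between (coord_space {..<d a}) (dsum_space I d) (embed_block (d a) a)"
  unfolding isometric_between_def linear_between_def
proof (intro conjI ballI allI)
  show "embed_block (d a) a ` coord_space {..<d a} \<subseteq> dsum_space I d"
    using embed_block_in_dsum_space[of a I d] assms by blast
  fix x y :: "nat ell2" and z :: complex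
  show "embed_block (d a) a (x + y) = embed_block (d a) a x + embed_block (d a) a y"
  proof (rule ell2_eqI)
    fix p show "Rep_ell2 (embed_block (d a) a (x + y)) p = Rep_ell2 (embed_block (d a) a x + embed_block (d a) a y) p"
      by (cases p) (simp add: plus_ell2.rep_eq Rep_embed_block)
  qed
  show "embed_block (d a) a (z *\<^sub>C x) = z *\<^sub>C embed_block (d a) a x"
  proof (rule ell2_eqI)
    fix p show "Rep_ell2 (embed_block (d a) a (z *\<^sub>C x)) p = Rep_ell2 (z *\<^sub>C embed_block (d a) a x) p"
      by (cases p) (simp add: scaleC_ell2.rep_eq Rep_embed_block)
  qed
  assume x: "x \<in> coord_space {..<d a}"
  have prod_eq: "{a} \<times> {..<d a} = Pair a ` {..<d a}" by auto
  have "embed_block (d a) a x \<in> coord_space ({a} \<times> {..<d a})"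
    by (auto simp: coord_space_def Rep_embed_block)
  hence "cinner (embed_block (d a) a x) (embed_block (d a) a y) = (\<Sum>p\<in>{a} \<times> {..<d a}. cnj (Rep_ell2 (embed_block (d a) a x) p) * Rep_ell2 (embed_block (d a) a y) p)"
    by (intro cinner_ell2_finite) auto
  also have "\<dots> = (\<Sum>i<d a. cnj (Rep_ell2 x i) * Rep_ell2 y i)"
    by (simp add: prod_eq sum.reindex inj_on_def Rep_embed_block)
  also have "\<dots> = cinner x y" using x by (simp add: cinner_ell2_finite[of "{..<d a}"])
  finally show "cinner (embed_block (d a) a x) (embed_block (d a) a y) = cinner x y" .
qed

text \<open>A vector from one block has finitely many nonzero coordinates, so
  \<open>Abs_ell2\<close> is applied to a square summable family even before the \<open>M a\<close>
  are known to be uniformly bounded. It is in that situation that the summands of a semi-finite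
  tuple are recognized as points of the matrix range.\<close>

lemma dsum_op_embed_block:
  assumes "a \<in> I" "v \<in> coord_space {..<d a}"
  shows "dsum_op I d M (embed_block (d a) a v) = embed_block (d a) a (mat_op (d a) (M a) v)"
proof -
  have "(\<lambda>(b, i). if b \<in> I \<and> i < d b then \<Sum>j<d b. M b $$ (i, j) * Rep_ell2 (embed_block (d a) a v) (b, j) else 0) =
      (\<lambda>p. if fst p = a \<and> snd p < d a then Rep_ell2 (mat_op (d a) (M a) v) (snd p) else 0)"
  proof (intro ext, clarify)
    fix b i
    show "(if b \<in> I \<and> i < d b then \<Sum>j<d b. M b $$ (i, j) * Rep_ell2 (embed_block (d a) a v) (b, j) else 0) =
      (if fst (b, i) = a \<and> snd (b, i) < d a then Rep_ell2 (mat_op (d a) (M a) v) (snd (b, i)) else 0)"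
      using assms by (cases "b = a") (auto simp: Rep_embed_block Rep_mat_op)
  qed
  thus ?thesis
    unfolding dsum_op_def by (simp add: embed_block_in_dsum_space[OF assms(1)]) (simp add: embed_block_def)
qed

text \<open>Regrouping the coordinate sum block by block; this turns a form on the direct sum into
  the sum of the forms on the summands.\<close>

lemma cinner_has_sum_blocks:
  assumes "f \<in> dsum_space I d"
  shows "((\<lambda>a. cinner (block (d a) a f) (block (d a) a h)) has_sum cinner f h) I"
proof (rule has_sum_Sigma[OF isUCont_plus])
  show "((\<lambda>p. cnj (Rep_ell2 f p) * Rep_ell2 h p) has_sum cinner f h) (SIGMA a:I. {..<d a})"
    using cinner_ell2_has_sum[of f h]
    by (rule has_sum_cong_neutral[THEN iffD1, rotated -1])
       (use assms in \<open>auto simp: dsum_space_def coord_spaceD\<close>)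
  fix a
  show "((\<lambda>i. cnj (Rep_ell2 f (a, i)) * Rep_ell2 h (a, i)) has_sum
      cinner (block (d a) a f) (block (d a) a h)) {..<d a}"
    by (rule has_sum_finiteI) (auto simp: cinner_ell2_finite[OF _ block_in_coord_space] Rep_block)
qed

text \<open>A common bound on the operator norms of the \<open>M a\<close>, under which
  \<open>dsum_op\<close> applies \<open>Abs_ell2\<close> to square summable families only.\<close>

definition dsum_bounded :: "'a set \<Rightarrow> ('a \<Rightarrow> nat) \<Rightarrow> ('a \<Rightarrow> complex mat) \<Rightarrow> bool" where
  "dsum_bounded I d M \<longleftrightarrow>
     (\<exists>c\<ge>0. \<forall>a\<in>I. \<forall>v\<in>coord_space {..<d a}. norm (mat_op (d a) (M a) v) \<le> c * norm v)"

context
  fixes I :: "'a set" and d :: "'a \<Rightarrow> nat" and M :: "'a \<Rightarrow> complex mat"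
  assumes bounded: "dsum_bounded I d M"
begin

text \<open>The coordinates before \<open>Abs_ell2\<close> is applied, so that they can be estimated
  before they are known to be square summable.\<close>

private definition dsum_fun :: "('a \<times> nat) ell2 \<Rightarrow> 'a \<times> nat \<Rightarrow> complex" where
  "dsum_fun f = (\<lambda>(a, i). if a \<in> I \<and> i < d a then \<Sum>j<d a. M a $$ (i, j) * Rep_ell2 f (a, j) else 0)"

text \<open>The hypothesis controls a block only as a whole, so a finite set of coordinates is
  enlarged to all blocks of \<open>I\<close> that it meets. The same estimate gives square
  summability and, later, the bound on the operator.\<close>

private lemma dsum_fun_bound:
  obtains c where "c \<ge> 0" "\<And>F f. finite F \<Longrightarrow> (\<Sum>p\<in>F. (cmod (dsum_fun f p))\<^sup>2) \<le> (c * norm f)\<^sup>2"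
proof -
  obtain c where c: "c \<ge> 0"
    "\<And>a v. a \<in> I \<Longrightarrow> v \<in> coord_space {..<d a} \<Longrightarrow> norm (mat_op (d a) (M a) v) \<le> c * norm v"
    using bounded by (auto simp: dsum_bounded_def)
  show thesis
  proof (rule that[OF c(1)])
    fix F :: "('a \<times> nat) set" and f :: "('a \<times> nat) ell2"
    assume F: "finite F"
    define u where "u = (\<lambda>p. (cmod (dsum_fun f p))\<^sup>2)"
    define G where "G = fst ` F \<inter> I"
    have G: "finite G" "G \<subseteq> I" using F by (auto simp: G_def)
    have block: "(\<Sum>i<d a. u (a, i)) \<le> c\<^sup>2 * (\<Sum>i<d a. (cmod (Rep_ell2 f (a, i)))\<^sup>2)" if a: "a \<in> G" for a
    proof -
      have "(\<Sum>i<d a. u (a, i)) = (norm (mat_op (d a) (M a) (block (d a) a f)))\<^sup>2"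
        using G(2) a by (subst norm_ell2_finite[OF _ mat_op_in_coord_space])
          (auto simp: u_def dsum_fun_def Rep_mat_op[OF block_in_coord_space] Rep_block intro!: sum.cong)
      also have "\<dots> \<le> (c * norm (block (d a) a f))\<^sup>2"
        using c(2)[of a] G(2) a by (intro power_mono) (auto simp: block_in_coord_space)
      also have "\<dots> = c\<^sup>2 * (\<Sum>i<d a. (cmod (Rep_ell2 f (a, i)))\<^sup>2)"
        by (simp add: power_mult_distrib norm_ell2_finite[OF _ block_in_coord_space] Rep_block)
      finally show ?thesis .
    qed
    have "sum u F = sum u (F \<inter> (SIGMA a:I. {..<d a}))"
      using F by (intro sum.mono_neutral_right) (auto simp: u_def dsum_fun_def split: if_splits)
    also have "\<dots> \<le> sum u (SIGMA a:G. {..<d a})"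
      using G by (intro sum_mono2) (auto simp: u_def G_def image_iff Bex_def)
    also have "\<dots> = (\<Sum>a\<in>G. \<Sum>i<d a. u (a, i))" using G by (simp add: sum.Sigma)
    also have "\<dots> \<le> (\<Sum>a\<in>G. c\<^sup>2 * (\<Sum>i<d a. (cmod (Rep_ell2 f (a, i)))\<^sup>2))"
      by (intro sum_mono block)
    also have "\<dots> = c\<^sup>2 * (\<Sum>p\<in>(SIGMA a:G. {..<d a}). (cmod (Rep_ell2 f p))\<^sup>2)"
      using G by (simp add: sum.Sigma case_prod_unfold flip: sum_distrib_left)
    also have "\<dots> \<le> c\<^sup>2 * (norm f)\<^sup>2" using G by (intro mult_left_mono sum_le_norm_ell2) auto
    finally show "(\<Sum>p\<in>F. (cmod (dsum_fun f p))\<^sup>2) \<le> (c * norm f)\<^sup>2"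
      by (simp add: u_def power_mult_distrib)
  qed
qed

private lemma Rep_dsum_fun:
  assumes "f \<in> dsum_space I d"
  shows "Rep_ell2 (dsum_op I d M f) = dsum_fun f"
proof -
  obtain c where c: "\<And>F. finite F \<Longrightarrow> (\<Sum>p\<in>F. (cmod (dsum_fun f p))\<^sup>2) \<le> (c * norm f)\<^sup>2"
    using dsum_fun_bound by metis
  have "(\<lambda>p. (cmod (dsum_fun f p))\<^sup>2) summable_on UNIV"
  proof (rule nonneg_bdd_above_summable_on)
    show "bdd_above (sum (\<lambda>p. (cmod (dsum_fun f p))\<^sup>2) ` {F. F \<subseteq> UNIV \<and> finite F})"
      by (rule bdd_aboveI[of _ "(c * norm f)\<^sup>2"]) (use c in blast)
  qed simp
  moreover have "dsum_op I d M f = Abs_ell2 (dsum_fun f)"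
    using assms by (simp add: dsum_op_def dsum_fun_def)
  ultimately show ?thesis by (simp add: Abs_ell2_inverse)
qed

lemma Rep_dsum_op:
  assumes "f \<in> dsum_space I d"
  shows "Rep_ell2 (dsum_op I d M f) (a, i) =
    (if a \<in> I \<and> i < d a then \<Sum>j<d a. M a $$ (i, j) * Rep_ell2 f (a, j) else 0)"
  by (simp add: Rep_dsum_fun[OF assms] dsum_fun_def)

lemma dsum_op_in_dsum_space: "f \<in> dsum_space I d \<Longrightarrow> dsum_op I d M f \<in> dsum_space I d"
  using Rep_dsum_op[of f] by (auto simp: dsum_space_def coord_space_def)

lemma dsum_op_linear_between: "linear_between (dsum_space I d) (dsum_space I d) (dsum_op I d M)"
proof -
  have S: "linear_subspace (dsum_space I d)"
    unfolding dsum_space_def by (rule linear_subspace_coord_space)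
  have "dsum_op I d M (x + y) = dsum_op I d M x + dsum_op I d M y"
    if "x \<in> dsum_space I d" "y \<in> dsum_space I d" for x y
  proof (rule ell2_eqI)
    fix p show "Rep_ell2 (dsum_op I d M (x + y)) p = Rep_ell2 (dsum_op I d M x + dsum_op I d M y) p"
      using that linear_subspaceD(2)[OF S that]
      by (cases p) (simp add: Rep_dsum_op plus_ell2.rep_eq distrib_left sum.distrib)
  qed
  moreover have "dsum_op I d M (z *\<^sub>C x) = z *\<^sub>C dsum_op I d M x" if "x \<in> dsum_space I d" for z x
  proof (rule ell2_eqI)
    fix p show "Rep_ell2 (dsum_op I d M (z *\<^sub>C x)) p = Rep_ell2 (z *\<^sub>C dsum_op I d M x) p"
      using that linear_subspaceD(3)[OF S that]
      by (cases p) (simp add: Rep_dsum_op scaleC_ell2.rep_eq sum_distrib_left mult.left_commute)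
  qed
  ultimately show ?thesis using dsum_op_in_dsum_space by (auto simp: linear_between_def)
qed

lemma dsum_op_bounded_ops: "dsum_op I d M \<in> bounded_ops (dsum_space I d)"
proof -
  obtain c where c0: "c \<ge> 0"
    and c: "\<And>F f. finite F \<Longrightarrow> (\<Sum>p\<in>F. (cmod (dsum_fun f p))\<^sup>2) \<le> (c * norm f)\<^sup>2"
    using dsum_fun_bound by metis
  show ?thesis
  proof (rule bounded_opsI[OF dsum_op_linear_between])
    show "dsum_op I d M f = 0" if "f \<notin> dsum_space I d" for f
      using that by (simp add: dsum_op_def)
    fix f assume f: "f \<in> dsum_space I d"
    have "(norm (dsum_op I d M f))\<^sup>2 \<le> (c * norm f)\<^sup>2"
      unfolding norm_ell2_sq
      by (rule infsum_le_finite_sums[OF Rep_ell2_summable]) (use c[of _ f] in \<open>simp add: Rep_dsum_fun[OF f]\<close>)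
    thus "norm (dsum_op I d M f) \<le> c * norm f" by (rule power2_le_imp_le) (use c0 in simp)
  qed
qed

lemma block_dsum_op:
  assumes "a \<in> I" "f \<in> dsum_space I d"
  shows "block (d a) a (dsum_op I d M f) = mat_op (d a) (M a) (block (d a) a f)"
  using assms
  by (intro ell2_eqI) (simp add: Rep_block Rep_dsum_op Rep_mat_op[OF block_in_coord_space])

end

lemma has_sum_finite_sum:
  fixes f :: "'i \<Rightarrow> 'a \<Rightarrow> 'b::topological_comm_monoid_add"
  assumes "\<And>i. i \<in> S \<Longrightarrow> (f i has_sum s i) A"
  shows "((\<lambda>x. \<Sum>i\<in>S. f i x) has_sum (\<Sum>i\<in>S. s i)) A"
  using assms by (induction S rule: infinite_finite_induct) (auto intro: has_sum_add)

section \<open>Self-adjointness\<close>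

lemma cinner_sum_left: "cinner (sum f S) y = (\<Sum>i\<in>S. cinner (f i) (y :: 'h::complex_inner))"
  by (induction S rule: infinite_finite_induct) (auto simp: cinner_add_left)

text \<open>The word \<open>v\<close> ends in \<open>id_on H\<close>, which disappears only on
  \<open>H\<close>.\<close>

lemma word_op_append: "word_op H A (v @ w) y = word_op H A v (word_op H A w y)"
  if "word_op H A w y \<in> H"
  using that by (induction v) (auto simp: word_op_def id_on_def)

lemma word_op_adjoint:
  assumes H: "linear_subspace H" and A: "\<And>j. j < g \<Longrightarrow> A ! j \<in> bounded_ops H \<and> selfadjoint_on H (A ! j)"
    and w: "set w \<subseteq> {..<g}" and x: "x \<in> H" and y: "y \<in> H"
  shows "cinner (word_op H A w x) y = cinner x (word_op H A (rev w) y)"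
  using w y
proof (induction w arbitrary: y)
  case Nil
  thus ?case using x by (simp add: word_op_def id_on_def)
next
  case (Cons j w)
  have j: "A ! j \<in> bounded_ops H" "selfadjoint_on H (A ! j)" using A Cons.prems by auto
  have wx: "word_op H A w x \<in> H"
    by (rule bounded_opsD(1)[OF word_op_bounded_ops[OF H, of g] x]) (use A Cons.prems in auto)
  have Ay: "(A ! j) y \<in> H" using bounded_opsD(1)[OF j(1)] Cons.prems by auto
  have single: "word_op H A [j] y = (A ! j) y" using Cons.prems by (simp add: word_op_def id_on_def)
  have "cinner (word_op H A (j # w) x) y = cinner ((A ! j) (word_op H A w x)) y"
    by (simp add: word_op_def)
  also have "\<dots> = cinner (word_op H A w x) ((A ! j) y)"
    using j(2) wx Cons.prems by (simp add: selfadjoint_on_def)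
  also have "\<dots> = cinner x (word_op H A (rev w) ((A ! j) y))"
    using Cons.prems Ay by (intro Cons.IH) auto
  also have "\<dots> = cinner x (word_op H A (rev (j # w)) y)"
    using Ay by (simp add: word_op_append single)
  finally show ?case .
qed

text \<open>Moving a word to the other side of the inner product reverses it, and the coefficient
  leaves the first argument conjugated. Symmetry of \<open>p\<close> says that this merely permutes
  the terms of \<open>p\<close>, by \<open>rev\<close>.\<close>

lemma eval_op_selfadjoint_on:
  assumes H: "linear_subspace H" and A: "\<And>j. j < g \<Longrightarrow> A ! j \<in> bounded_ops H \<and> selfadjoint_on H (A ! j)"
    and p: "p \<in> nc_polys g" "symmetric_nc p"
  shows "selfadjoint_on H (eval_op H p A)"
  unfolding selfadjoint_on_def
proof (intro ballI)
  fix x y assume x: "x \<in> H" and y: "y \<in> H"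
  have sym: "cnj (Poly_Mapping.lookup p w) = Poly_Mapping.lookup p (rev w)" for w
    using p(2) lookup_nc_star[of p "rev w"] by (simp add: symmetric_nc_def)
  have keys: "rev w \<in> Poly_Mapping.keys p \<longleftrightarrow> w \<in> Poly_Mapping.keys p" for w
    using sym[of w] by (metis complex_cnj_zero_iff in_keys_iff)
  have w: "set w \<subseteq> {..<g}" if "w \<in> Poly_Mapping.keys p" for w
    using p(1) that by (auto simp: nc_polys_def)
  have "cinner (eval_op H p A x) y =
      (\<Sum>w\<in>Poly_Mapping.keys p. Poly_Mapping.lookup p (rev w) * cinner x (word_op H A (rev w) y))"
    unfolding eval_op_def cinner_sum_left
    by (intro sum.cong refl) (simp add: cinner_scaleC_left sym word_op_adjoint[OF H A w x y])
  also have "\<dots> = (\<Sum>w\<in>Poly_Mapping.keys p. Poly_Mapping.lookup p w * cinner x (word_op H A w y))"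
    by (rule sum.reindex_bij_witness[of _ rev rev]) (auto simp: keys)
  also have "\<dots> = cinner x (eval_op H p A y)"
    by (simp add: eval_op_def cinner_sum_right cinner_scaleC_right)
  finally show "cinner (eval_op H p A x) y = cinner x (eval_op H p A y)" .
qed

lemma mat_adjoint_carrier: "M \<in> carrier_mat n m \<Longrightarrow> mat_adjoint M \<in> carrier_mat m n"
  by (auto simp: mat_adjoint_def)

lemma index_mat_adjoint:
  assumes "M \<in> carrier_mat n m" "i < m" "j < n"
  shows "mat_adjoint M $$ (i, j) = cnj (M $$ (j, i))"
  using assms by (simp add: mat_adjoint_def mat_of_rows_def cols_def)

definition unit_ell2 :: "nat \<Rightarrow> nat ell2" where
  "unit_ell2 i = Abs_ell2 (\<lambda>j. if j = i then 1 else 0)"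

lemma Rep_unit_ell2: "Rep_ell2 (unit_ell2 i) j = (if j = i then 1 else 0)"
  by (simp add: unit_ell2_def Rep_Abs_ell2_if)

lemma unit_ell2_in_coord_space: "i < n \<Longrightarrow> unit_ell2 i \<in> coord_space {..<n}"
  by (simp add: coord_space_def Rep_unit_ell2)

lemma cinner_mat_op_unit:
  assumes "i < n" "j < n"
  shows "cinner (unit_ell2 i) (mat_op n M (unit_ell2 j)) = M $$ (i, j)"
proof -
  have "cinner (unit_ell2 i) (mat_op n M (unit_ell2 j)) = (\<Sum>l<n. cnj (if l = i then 1 else 0) * M $$ (l, j))"
    using assms
    by (subst cinner_ell2_finite[of "{..<n}"])
       (auto simp: unit_ell2_in_coord_space Rep_unit_ell2 Rep_mat_op if_distrib cong: if_cong intro!: sum.cong)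
  also have "\<dots> = M $$ (i, j)" using assms(1) by (simp add: if_distrib[of cnj] if_distrib[of "\<lambda>x. x * _"] cong: if_cong)
  finally show ?thesis .
qed

lemma cinner_mat_op:
  assumes "f \<in> coord_space {..<n}" "h \<in> coord_space {..<n}"
  shows "cinner f (mat_op n M h) = (\<Sum>p<n. \<Sum>q<n. cnj (Rep_ell2 f p) * M $$ (p, q) * Rep_ell2 h q)"
  using assms by (simp add: cinner_ell2_finite[of "{..<n}"] Rep_mat_op sum_distrib_left mult.assoc)

lemma mat_op_selfadjoint_on_iff:
  assumes M: "M \<in> carrier_mat n n"
  shows "selfadjoint_on (coord_space {..<n}) (mat_op n M) \<longleftrightarrow> mat_adjoint M = M"
proof
  assume sa: "selfadjoint_on (coord_space {..<n}) (mat_op n M)"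
  show "mat_adjoint M = M"
  proof (rule eq_matI)
    fix i j assume "i < dim_row M" "j < dim_col M"
    hence ij: "i < n" "j < n" using M by auto
    have "M $$ (i, j) = cinner (mat_op n M (unit_ell2 i)) (unit_ell2 j)"
      using sa ij by (simp add: selfadjoint_on_def unit_ell2_in_coord_space cinner_mat_op_unit)
    also have "\<dots> = cnj (M $$ (j, i))"
      by (subst cinner_commute) (simp add: cinner_mat_op_unit ij)
    finally show "mat_adjoint M $$ (i, j) = M $$ (i, j)" by (simp add: index_mat_adjoint[OF M ij])
  qed (use mat_adjoint_carrier[OF M] M in auto)
next
  assume adj: "mat_adjoint M = M"
  show "selfadjoint_on (coord_space {..<n}) (mat_op n M)"
    unfolding selfadjoint_on_def
  proof (intro ballI)
    fix x y assume x: "x \<in> coord_space {..<n}" and y: "y \<in> coord_space {..<n}"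
    have "cinner (mat_op n M x) y = cnj (\<Sum>p<n. \<Sum>q<n. cnj (Rep_ell2 y p) * M $$ (p, q) * Rep_ell2 x q)"
      by (subst cinner_commute) (simp only: cinner_mat_op[OF y x])
    also have "\<dots> = (\<Sum>p<n. \<Sum>q<n. cnj (Rep_ell2 x q) * cnj (M $$ (p, q)) * Rep_ell2 y p)"
      by (simp add: mult_ac)
    also have "\<dots> = (\<Sum>q<n. \<Sum>p<n. cnj (Rep_ell2 x q) * cnj (M $$ (p, q)) * Rep_ell2 y p)"
      by (rule sum.swap)
    also have "\<dots> = (\<Sum>q<n. \<Sum>p<n. cnj (Rep_ell2 x q) * M $$ (q, p) * Rep_ell2 y p)"
      by (intro sum.cong refl) (simp add: index_mat_adjoint[OF M, unfolded adj, symmetric])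
    also have "\<dots> = cinner x (mat_op n M y)" by (simp only: cinner_mat_op[OF x y])
    finally show "cinner (mat_op n M x) y = cinner x (mat_op n M y)" .
  qed
qed

lemma sa_matsD:
  assumes "X \<in> sa_mats g n"
  shows "0 < n" "length X = g" "j < g \<Longrightarrow> X ! j \<in> carrier_mat n n" "j < g \<Longrightarrow> mat_adjoint (X ! j) = X ! j"
  using assms by (auto simp: sa_mats_def)

lemma unitary_between_inv:
  assumes U: "unitary_between H K U" and H: "linear_subspace H"
  shows "isometric_between K H (inv_into H U)"
proof -
  define V where "V = inv_into H U"
  have bij: "bij_betw U H K" using U by (simp add: unitary_between_def)
  have V: "V y \<in> H" "U (V y) = y" if "y \<in> K" for y
    using bij that by (auto simp: V_def bij_betw_def inv_into_into f_inv_into_f)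
  have VU: "V (U x) = x" if "x \<in> H" for x
    using bij that by (auto simp: V_def bij_betw_def)
  have add: "V (x + y) = V x + V y" if "x \<in> K" "y \<in> K" for x y
    using VU[of "V x + V y"] U V that linear_subspaceD(2)[OF H] by (simp add: unitary_between_def)
  have scale: "V (a *\<^sub>C x) = a *\<^sub>C V x" if "x \<in> K" for a x
    using VU[of "a *\<^sub>C V x"] U V that linear_subspaceD(3)[OF H] by (simp add: unitary_between_def)
  have "cinner (V x) (V y) = cinner x y" if "x \<in> K" "y \<in> K" for x y
  proof -
    have "cinner (U (V x)) (U (V y)) = cinner (V x) (V y)"
      using U V(1)[OF that(1)] V(1)[OF that(2)] unfolding unitary_between_def by blast
    thus ?thesis by (simp add: V that)
  qed
  thus ?thesis using add scale V unfolding V_def[symmetric] isometric_between_def linear_between_def by auto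
qed

section \<open>Norm bounds as positivity of 2 x 2 operator matrices\<close>

lemma selfadjoint_positive_matrix:
  assumes T: "T \<in> bounded_ops H" "selfadjoint_on H T" and "c > 0"
    and c: "\<And>x. x \<in> H \<Longrightarrow> norm (T x) \<le> c * norm x"
  shows "positive_matrix H 2 (\<lambda>i j. if i = j then (\<lambda>x. of_real c *\<^sub>C x) else T)"
  unfolding positive_matrix_def
proof (intro allI impI)
  fix h assume "\<forall>i<(2::nat). h i \<in> H"
  hence h: "h 0 \<in> H" "h 1 \<in> H" by auto
  have "cinner (h 1) (T (h 0)) = cnj (cinner (h 0) (T (h 1)))"
    using T(2) h by (metis selfadjoint_on_def cinner_commute)
  hence eq: "(\<Sum>i<2. \<Sum>j<2. cinner (h i) ((if i = j then (\<lambda>x. of_real c *\<^sub>C x) else T) (h j))) =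
      of_real (c * (norm (h 0))\<^sup>2 + c * (norm (h 1))\<^sup>2 + 2 * Re (cinner (h 0) (T (h 1))))"
    by (simp add: numeral_2_eq_2 cinner_scaleC_right cinner_self complex_eq_iff)
  have "c * norm (h 0) * norm (h 1) * 2 \<le> c * (norm (h 0))\<^sup>2 + c * (norm (h 1))\<^sup>2"
    using mult_left_mono[OF zero_le_power2[of "norm (h 0) - norm (h 1)"], of c] \<open>c > 0\<close>
    by (simp add: power2_diff algebra_simps)
  moreover have "\<bar>Re (cinner (h 0) (T (h 1)))\<bar> \<le> norm (h 0) * (c * norm (h 1))"
    using abs_Re_le_cmod[of "cinner (h 0) (T (h 1))"] cinner_norm_le[of "h 0" "T (h 1)"]
      mult_left_mono[OF c[OF h(2)], of "norm (h 0)"] by simp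
  ultimately have "0 \<le> c * (norm (h 0))\<^sup>2 + c * (norm (h 1))\<^sup>2 + 2 * Re (cinner (h 0) (T (h 1)))"
    by (simp add: mult_ac)
  thus "0 \<le> (\<Sum>i<2. \<Sum>j<2. cinner (h i) ((if i = j then (\<lambda>x. of_real c *\<^sub>C x) else T) (h j)))"
    unfolding eq by (simp add: less_eq_complex_def)
qed

text \<open>Together with its converse above, this makes a norm bound a condition on a positive
  matrix over the system, hence one that completely positive unital maps preserve.\<close>

lemma positive_matrix_norm_le:
  assumes T: "T \<in> bounded_ops H" "selfadjoint_on H T" and H: "linear_subspace H" and c: "c > 0"
    and pos: "positive_matrix H 2 (\<lambda>i j. if i = j then (\<lambda>x. of_real c *\<^sub>C x) else T)" and x: "x \<in> H"
  shows "norm (T x) \<le> c * norm x"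
proof -
  \<comment> \<open>For fixed second entry \<open>x\<close> this choice minimises c |h0|^2 + 2 Re
    <h0, Tx> + c |x|^2 over h0; the minimum is c |x|^2 - |Tx|^2 / c.\<close>
  define h where "h = (\<lambda>i::nat. if i = 0 then of_real (- 1 / c) *\<^sub>C T x else x)"
  have Tx: "T x \<in> H" by (rule bounded_opsD(1)[OF T(1) x])
  have "\<forall>i<2. h i \<in> H" using x linear_subspaceD(3)[OF H Tx] by (simp add: h_def)
  hence "0 \<le> (\<Sum>i<2. \<Sum>j<2. cinner (h i) ((if i = j then (\<lambda>x. of_real c *\<^sub>C x) else T) (h j)))"
    using pos unfolding positive_matrix_def by blast
  also have "\<dots> = of_real c * cinner (h 0) (h 0) + cinner (h 0) (T x) + cinner x (T (h 0)) + of_real c * cinner x x"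
    by (simp add: numeral_2_eq_2 cinner_scaleC_right h_def)
  also have "cinner x (T (h 0)) = cinner (T x) (h 0)"
    using T(2) x \<open>\<forall>i<2. h i \<in> H\<close> by (simp add: selfadjoint_on_def)
  also have "cinner (h 0) (h 0) = of_real ((norm (T x))\<^sup>2 / c\<^sup>2)"
    using c by (simp add: h_def cinner_self norm_scaleC norm_divide power_divide)
  also have "cinner (h 0) (T x) = of_real (- ((norm (T x))\<^sup>2 / c))"
    by (simp add: h_def cinner_scaleC_left cinner_self)
  also have "cinner (T x) (h 0) = of_real (- ((norm (T x))\<^sup>2 / c))"
    by (simp add: h_def cinner_scaleC_right cinner_self)
  also have "of_real c * of_real ((norm (T x))\<^sup>2 / c\<^sup>2) + of_real (- ((norm (T x))\<^sup>2 / c)) +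
      of_real (- ((norm (T x))\<^sup>2 / c)) + of_real c * cinner x x =
      of_real (c * (norm x)\<^sup>2 - (norm (T x))\<^sup>2 / c)"
    using c by (simp add: cinner_self field_simps power2_eq_square)
  finally have "0 \<le> c * (norm x)\<^sup>2 - (norm (T x))\<^sup>2 / c" by (simp add: less_eq_complex_def)
  hence "(norm (T x))\<^sup>2 \<le> (c * norm x)\<^sup>2" using c by (simp add: field_simps power2_eq_square)
  thus ?thesis by (rule power2_le_imp_le) (use c in simp)
qed


section \<open>\<open>\<Gamma>\<close>-matrix ranges\<close>

context gamma_tuple
begin

text \<open>The hat tuple is the case of \<open>hat_index\<close>; a semi-finite tuple is unitarily
  equivalent to the case of a countable index set.\<close>

definition dsum_tuple :: "'a set \<Rightarrow> ('a \<Rightarrow> nat) \<Rightarrow> ('a \<Rightarrow> complex mat list) \<Rightarrow> (('a \<times> nat) ell2 \<Rightarrow> ('a \<times> nat) ell2) list"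
  where "dsum_tuple I d X = map (\<lambda>j. dsum_op I d (\<lambda>a. X a ! j)) [0..<g]"

lemma hat_tuple_eq: "hat_tuple g K = dsum_tuple (hat_index K) fst snd"
  by (simp add: hat_tuple_def dsum_tuple_def)

lemma op_tuple_mat:
  assumes "X \<in> sa_mats g n"
  shows "op_tuple (coord_space {..<n}) (map (mat_op n) X)"
  using sa_matsD[OF assms] by (simp add: op_tuple_def linear_subspace_coord_space mat_op_bounded_ops)

lemma op_tuple_dsum:
  assumes "\<And>j. j < g \<Longrightarrow> dsum_bounded I d (\<lambda>a. X a ! j)"
  shows "op_tuple (dsum_space I d) (dsum_tuple I d X)"
  using assms
  by (simp add: op_tuple_def dsum_tuple_def dsum_op_bounded_ops) (simp add: dsum_space_def linear_subspace_coord_space)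

text \<open>Downwards, positivity is restricted along the inclusion of a block. Upwards, the
  projection onto a block intertwines as well, so the form on the direct sum is the convergent sum
  of its values on the blocks.\<close>

lemma gamma_positive_dsum_iff:
  assumes X: "\<And>a. a \<in> I \<Longrightarrow> X a \<in> sa_mats g (d a)"
    and bd: "\<And>j. j < g \<Longrightarrow> dsum_bounded I d (\<lambda>a. X a ! j)"
  shows "gamma_positive \<Gamma> (dsum_space I d) (dsum_tuple I d X) k c \<longleftrightarrow>
    (\<forall>a\<in>I. gamma_positive \<Gamma> (coord_space {..<d a}) (map (mat_op (d a)) (X a)) k c)"
proof (intro iffI ballI)
  fix a assume a: "a \<in> I" and pos: "gamma_positive \<Gamma> (dsum_space I d) (dsum_tuple I d X) k c"
  have "intertwines g (coord_space {..<d a}) (map (mat_op (d a)) (X a)) (dsum_tuple I d X) (embed_block (d a) a)"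
    using sa_matsD(2)[OF X[OF a]] a by (simp add: intertwines_def dsum_tuple_def dsum_op_embed_block)
  thus "gamma_positive \<Gamma> (coord_space {..<d a}) (map (mat_op (d a)) (X a)) k c"
    using gamma_positive_intertwines embed_block_isometric_between[of a I d, OF a] op_tuple_mat[OF X[OF a]] pos by blast
next
  assume pos: "\<forall>a\<in>I. gamma_positive \<Gamma> (coord_space {..<d a}) (map (mat_op (d a)) (X a)) k c"
  define T where "T = (\<lambda>i j. op_comb (c i j) (gens (dsum_space I d) \<Gamma> (dsum_tuple I d X)))"
  show "gamma_positive \<Gamma> (dsum_space I d) (dsum_tuple I d X) k c"
    unfolding gamma_positive_def positive_matrix_def T_def[symmetric]
  proof (intro allI impI)
    fix h assume h: "\<forall>i<k. h i \<in> dsum_space I d"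
    define t where "t = (\<lambda>a. \<Sum>i<k. \<Sum>j<k. cinner (block (d a) a (h i)) (block (d a) a (T i j (h j))))"
    have t0: "0 \<le> t a" if a: "a \<in> I" for a
    proof -
      have "intertwines g (dsum_space I d) (dsum_tuple I d X) (map (mat_op (d a)) (X a)) (block (d a) a)"
        using sa_matsD(2)[OF X[OF a]] a
        by (simp add: intertwines_def dsum_tuple_def block_dsum_op[OF bd])
      hence "block (d a) a (T i j (h j)) =
          op_comb (c i j) (gens (coord_space {..<d a}) \<Gamma> (map (mat_op (d a)) (X a))) (block (d a) a (h j))"
        if "j < k" for i j
        unfolding T_def using h that
        by (intro op_comb_intertwines[OF block_linear_between _ op_tuple_dsum[OF bd], symmetric]) auto
      hence "t a = (\<Sum>i<k. \<Sum>j<k. cinner (block (d a) a (h i))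
          (op_comb (c i j) (gens (coord_space {..<d a}) \<Gamma> (map (mat_op (d a)) (X a))) (block (d a) a (h j))))"
        by (simp add: t_def)
      also have "0 \<le> \<dots>"
        using pos[rule_format, OF a, unfolded gamma_positive_def positive_matrix_def, rule_format,
            of "\<lambda>i. block (d a) a (h i)"]
        by (simp add: block_in_coord_space)
      finally show ?thesis .
    qed
    have "(t has_sum (\<Sum>i<k. \<Sum>j<k. cinner (h i) (T i j (h j)))) I"
      unfolding t_def by (intro has_sum_finite_sum cinner_has_sum_blocks) (use h in auto)
    hence "(\<Sum>i<k. \<Sum>j<k. cinner (h i) (T i j (h j))) = infsum t I" "t summable_on I"
      by (auto simp: infsumI has_sum_imp_summable)
    thus "0 \<le> (\<Sum>i<k. \<Sum>j<k. cinner (h i) (T i j (h j)))"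
      using infsum_nonneg_complex[of t I] t0 by simp
  qed
qed

lemma gamma_matrix_rangeI:
  assumes X: "X \<in> sa_mats g n" and A: "op_tuple H A"
    and J: "isometric_between (coord_space {..<n}) H J"
      "intertwines g (coord_space {..<n}) (map (mat_op n) X) A J"
  shows "X \<in> gamma_matrix_range g \<Gamma> H A n"
proof -
  define K where "K = coord_space {..<n}"
  define B where "B = map (mat_op n) X"
  have B: "op_tuple K B" unfolding K_def B_def by (rule op_tuple_mat[OF X])
  have JL: "linear_between K H J" using J(1) by (simp add: isometric_between_def K_def)
  have inj: "inj_on J K"
    using isometric_between_eqD[OF J(1)[folded K_def] op_tupleD(1)[OF B]] by (auto intro: inj_onI)
  \<comment> \<open>This is J*TJ: every operator of the system maps the range of \<open>J\<close>
    into itself, where the inverse of \<open>J\<close> acts as its adjoint.\<close>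
  define \<phi> where "\<phi> = (\<lambda>T y. if y \<in> K then inv_into K J (T (J y)) else 0)"
  have \<phi>: "\<phi> (op_comb c (gens H \<Gamma> A)) = op_comb c (gens K \<Gamma> B)" for c
  proof
    fix y
    show "\<phi> (op_comb c (gens H \<Gamma> A)) y = op_comb c (gens K \<Gamma> B) y"
    proof (cases "y \<in> K")
      case True
      have "op_comb c (gens H \<Gamma> A) (J y) = J (op_comb c (gens K \<Gamma> B) y)"
        by (rule op_comb_intertwines[OF JL _ B True]) (use J(2) in \<open>simp add: K_def B_def\<close>)
      thus ?thesis
        using True inv_into_f_f[OF inj] bounded_opsD(1)[OF op_comb_bounded_ops[OF B] True] by (simp add: \<phi>_def)
    qed (simp add: \<phi>_def bounded_opsD(2)[OF op_comb_bounded_ops[OF B]])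
  qed
  have pos: "gamma_positive \<Gamma> K B k c" if "gamma_positive \<Gamma> H A k c" for k c
    by (rule gamma_positive_intertwines[OF _ _ B that]) (use J in \<open>auto simp: K_def B_def\<close>)
  show ?thesis
    using X gamma_ucpI[where \<phi> = \<phi>, OF A B \<phi> pos] unfolding gamma_matrix_range_def K_def B_def by blast
qed

lemma gamma_positive_matrix_range:
  assumes "X \<in> gamma_matrix_range g \<Gamma> H A n" "gamma_positive \<Gamma> H A k c"
  shows "gamma_positive \<Gamma> (coord_space {..<n}) (map (mat_op n) X) k c"
  using assms gamma_ucp_gamma_positive[where K = "coord_space {..<n}"] by (fastforce simp: gamma_matrix_range_def)

text \<open>Index 0 of the generators is I and index \<open>Suc j\<close> is A_j, so the matrix that
  encodes a norm bound on A_j comes from a coefficient array.\<close>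

lemma gamma_positive_norm_iff:
  assumes A: "op_tuple H A" and j: "j < g"
  shows "gamma_positive \<Gamma> H A 2
      (\<lambda>i k. if i = k then (\<lambda>l. if l = 0 then of_real c else 0) else (\<lambda>l. if l = Suc j then 1 else 0)) \<longleftrightarrow>
    positive_matrix H 2 (\<lambda>i k. if i = k then (\<lambda>x. of_real c *\<^sub>C x) else A ! j)"
proof -
  have "op_comb (\<lambda>l. if l = 0 then of_real c else 0) (gens H \<Gamma> A) x = of_real c *\<^sub>C x" if "x \<in> H" for x
    using that by (simp add: op_comb_unit id_on_def)
  moreover have "op_comb (\<lambda>l. if l = Suc j then 1 else 0) (gens H \<Gamma> A) x = (A ! j) x" for x
    using evals_op_var[OF A j] g_le j by (simp add: op_comb_unit)
  ultimately show ?thesis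
    unfolding gamma_positive_def by (intro positive_matrix_cong) auto
qed

text \<open>A bound for A_j is inherited by the whole matrix range, with the same constant at every
  level, because it is encoded by a positive matrix over the system. This makes the direct sum over
  W(A) bounded.\<close>

lemma gamma_matrix_range_norm_le:
  assumes A: "op_tuple H A" "selfadjoint_on H (A ! j)" and j: "j < g"
  obtains c where "c > 0"
    "\<And>n Y v. Y \<in> gamma_matrix_range g \<Gamma> H A n \<Longrightarrow> v \<in> coord_space {..<n} \<Longrightarrow>
      norm (mat_op n (Y ! j) v) \<le> c * norm v"
proof -
  obtain c where c: "c > 0" "\<And>x. x \<in> H \<Longrightarrow> norm ((A ! j) x) \<le> c * norm x"
    using bounded_ops_bound[OF op_tupleD(3)[OF A(1) j]] by blast
  define C where "C = (\<lambda>i k::nat. if i = k then (\<lambda>l. if l = 0 then of_real c else 0)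
    else (\<lambda>l. if l = Suc j then 1 else 0 :: complex))"
  have pos: "gamma_positive \<Gamma> H A 2 C"
    unfolding C_def gamma_positive_norm_iff[OF A(1) j]
    by (rule selfadjoint_positive_matrix[OF op_tupleD(3)[OF A(1) j] A(2) c])
  show thesis
  proof (rule that[OF c(1)])
    fix n Y v assume Y: "Y \<in> gamma_matrix_range g \<Gamma> H A n" and v: "v \<in> coord_space {..<n}"
    have sa: "Y \<in> sa_mats g n" using Y by (simp add: gamma_matrix_range_def)
    note Y_nth = sa_matsD(2,3,4)[OF sa]
    have "gamma_positive \<Gamma> (coord_space {..<n}) (map (mat_op n) Y) 2 C"
      by (rule gamma_positive_matrix_range[OF Y pos])
    hence "positive_matrix (coord_space {..<n}) 2
        (\<lambda>i k. if i = k then (\<lambda>x. of_real c *\<^sub>C x) else mat_op n (Y ! j))"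
      unfolding C_def gamma_positive_norm_iff[OF op_tuple_mat[OF sa] j] by (simp only: nth_map Y_nth(1) j)
    thus "norm (mat_op n (Y ! j) v) \<le> c * norm v"
      using positive_matrix_norm_le[OF mat_op_bounded_ops _ linear_subspace_coord_space c(1) _ v]
        mat_op_selfadjoint_on_iff[OF Y_nth(2)[OF j]] Y_nth(3)[OF j] by blast
  qed
qed

lemma dsum_bounded_hat:
  assumes "\<And>j. j < g \<Longrightarrow> \<exists>c\<ge>0. \<forall>n. \<forall>Y\<in>K n. \<forall>v\<in>coord_space {..<n}. norm (mat_op n (Y ! j) v) \<le> c * norm v"
    and "j < g"
  shows "dsum_bounded (hat_index K) fst (\<lambda>a. snd a ! j)"
  using assms(1)[OF assms(2)] by (fastforce simp: dsum_bounded_def hat_index_def)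

lemma gamma_positive_hat_iff:
  assumes K: "graded_set g K"
    and bd: "\<And>j. j < g \<Longrightarrow> dsum_bounded (hat_index K) fst (\<lambda>a. snd a ! j)"
  shows "gamma_positive \<Gamma> (hat_space K) (hat_tuple g K) k c \<longleftrightarrow>
    (\<forall>n. \<forall>Y\<in>K n. gamma_positive \<Gamma> (coord_space {..<n}) (map (mat_op n) Y) k c)"
proof -
  have "snd a \<in> sa_mats g (fst a)" if "a \<in> hat_index K" for a
    using that K by (fastforce simp: hat_index_def graded_set_def)
  thus ?thesis
    unfolding hat_space_def hat_tuple_eq
    by (subst gamma_positive_dsum_iff[OF _ bd]) (auto simp: hat_index_def)
qed

text \<open>Compression of the hat tuple to its block with index \<open>(n, Y)\<close> is the
  required \<Gamma>-ucp map.\<close>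

lemma subset_gamma_matrix_range_hat:
  assumes K: "graded_set g K"
    and bd: "\<And>j. j < g \<Longrightarrow> dsum_bounded (hat_index K) fst (\<lambda>a. snd a ! j)"
  shows "K n \<subseteq> gamma_matrix_range g \<Gamma> (hat_space K) (hat_tuple g K) n"
proof
  fix Y assume Y: "Y \<in> K n"
  have sa: "Y \<in> sa_mats g n" using K Y by (auto simp: graded_set_def)
  have idx: "(n, Y) \<in> hat_index K" using Y by (simp add: hat_index_def)
  show "Y \<in> gamma_matrix_range g \<Gamma> (hat_space K) (hat_tuple g K) n"
  proof (rule gamma_matrix_rangeI[OF sa])
    show "op_tuple (hat_space K) (hat_tuple g K)"
      unfolding hat_space_def hat_tuple_eq by (rule op_tuple_dsum[OF bd])
    show "isometric_between (coord_space {..<n}) (hat_space K) (embed_block n (n, Y))"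
      using embed_block_isometric_between[OF idx, of fst] by (simp add: hat_space_def)
    show "intertwines g (coord_space {..<n}) (map (mat_op n) Y) (hat_tuple g K) (embed_block n (n, Y))"
      using dsum_op_embed_block[OF idx, where d = fst] sa_matsD(2)[OF sa]
      by (simp add: intertwines_def hat_tuple_def)
  qed
qed

section \<open>Part (a): semi-finite tuples and the hat system of their matrix range\<close>

lemma semi_finite_gamma_isomorphic:
  assumes H: "hilbert_space H" and A: "selfadjoint_tuple g H A" and sf: "semi_finite g H A"
  shows "gamma_isomorphic \<Gamma> H A (hat_space (gamma_matrix_range g \<Gamma> H A))
    (hat_tuple g (gamma_matrix_range g \<Gamma> H A))"
proof -
  define W where "W = gamma_matrix_range g \<Gamma> H A"
  have Hs: "linear_subspace H" by (rule hilbert_space_linear_subspace[OF H])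
  have A_op: "op_tuple H A" using A Hs by (auto simp: selfadjoint_tuple_def op_tuple_def)
  have A_sa: "selfadjoint_on H (A ! j)" if "j < g" for j
    using A that by (auto simp: selfadjoint_tuple_def)
  have W: "graded_set g W" by (auto simp: graded_set_def W_def gamma_matrix_range_def)
  have Wbd: "\<exists>c\<ge>0. \<forall>n. \<forall>Y\<in>W n. \<forall>v\<in>coord_space {..<n}. norm (mat_op n (Y ! j) v) \<le> c * norm v"
    if "j < g" for j
    using gamma_matrix_range_norm_le[OF A_op A_sa[OF that] that] unfolding W_def by (metis less_imp_le)
  have bd: "dsum_bounded (hat_index W) fst (\<lambda>a. snd a ! j)" if "j < g" for j
    by (rule dsum_bounded_hat[OF Wbd that])
  have hat_iff: "gamma_positive \<Gamma> (hat_space W) (hat_tuple g W) k c \<longleftrightarrow>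
      (\<forall>n. \<forall>Y\<in>W n. gamma_positive \<Gamma> (coord_space {..<n}) (map (mat_op n) Y) k c)" for k c
    by (rule gamma_positive_hat_iff[OF W bd])
  obtain I :: "nat set" and d B U where B: "\<forall>a\<in>I. B a \<in> sa_mats g (d a)"
    and U: "unitary_between H (dsum_space I d) U"
    and UA: "\<forall>j<g. \<forall>x\<in>H. U ((A ! j) x) = dsum_op I d (\<lambda>a. B a ! j) (U x)"
    using sf unfolding semi_finite_def by blast
  define V where "V = inv_into H U"
  have V: "isometric_between (dsum_space I d) H V"
    unfolding V_def by (rule unitary_between_inv[OF U Hs])
  have bij: "bij_betw U H (dsum_space I d)" using U by (simp add: unitary_between_def)
  have UV: "U (V y) = y" if "y \<in> dsum_space I d" for y
    using bij that by (auto simp: V_def bij_betw_def f_inv_into_f)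
  have VU: "V (U x) = x" if "x \<in> H" for x
    using bij that by (auto simp: V_def bij_betw_def)
  \<comment> \<open>A block of the direct sum is carried back to \<open>H\<close> by the inverse of
    the unitary.\<close>
  have BW: "B a \<in> W (d a)" if a: "a \<in> I" for a
    unfolding W_def
  proof (rule gamma_matrix_rangeI[OF _ A_op])
    show sa: "B a \<in> sa_mats g (d a)" using B a by blast
    note E = embed_block_isometric_between[OF a, of d]
    show "isometric_between (coord_space {..<d a}) H (V \<circ> embed_block (d a) a)"
      using E V by (auto simp: isometric_between_def linear_between_def image_subset_iff)
    show "intertwines g (coord_space {..<d a}) (map (mat_op (d a)) (B a)) A (V \<circ> embed_block (d a) a)"
      unfolding intertwines_def
    proof (intro allI impI ballI)
      fix j v assume j: "j < g" and v: "v \<in> coord_space {..<d a}"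
      define y where "y = embed_block (d a) a v"
      have y: "y \<in> dsum_space I d" unfolding y_def by (rule embed_block_in_dsum_space[OF a])
      have Vy: "V y \<in> H" using V y by (auto simp: isometric_between_def linear_between_def)
      have "(A ! j) (V y) = V (U ((A ! j) (V y)))"
        using VU bounded_opsD(1)[OF op_tupleD(3)[OF A_op j] Vy] by simp
      also have "U ((A ! j) (V y)) = dsum_op I d (\<lambda>a. B a ! j) y" using UA j Vy UV[OF y] by simp
      also have "\<dots> = embed_block (d a) a (mat_op (d a) (B a ! j) v)"
        unfolding y_def by (rule dsum_op_embed_block[of a I v d, OF a v])
      finally show "(A ! j) ((V \<circ> embed_block (d a) a) v) =
          (V \<circ> embed_block (d a) a) ((map (mat_op (d a)) (B a) ! j) v)"
        using sa_matsD(2)[OF sa] j by (simp add: y_def)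
    qed
  qed
  \<comment> \<open>The \<open>B a\<close> inherit their uniform bound from the matrix range that
    contains them; from here on their direct sum is a tuple of bounded operators.\<close>
  have Bbd: "dsum_bounded I d (\<lambda>a. B a ! j)" if "j < g" for j
    using Wbd[OF that] BW unfolding dsum_bounded_def by blast
  have "gamma_positive \<Gamma> H A k c \<longleftrightarrow> gamma_positive \<Gamma> (hat_space W) (hat_tuple g W) k c" for k c
  proof
    assume "gamma_positive \<Gamma> H A k c"
    thus "gamma_positive \<Gamma> (hat_space W) (hat_tuple g W) k c"
      unfolding hat_iff
      using gamma_positive_matrix_range[where H = H and A = A, folded W_def] by blast
  next
    assume "gamma_positive \<Gamma> (hat_space W) (hat_tuple g W) k c"
    hence "gamma_positive \<Gamma> (dsum_space I d) (dsum_tuple I d B) k c"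
      unfolding hat_iff using BW B
      by (subst gamma_positive_dsum_iff[OF _ Bbd]) auto
    moreover have "isometric_between H (dsum_space I d) U"
      using U bij by (auto simp: unitary_between_def isometric_between_def linear_between_def bij_betw_def)
    moreover have "intertwines g H A (dsum_tuple I d B) U"
      using UA by (simp add: intertwines_def dsum_tuple_def)
    ultimately show "gamma_positive \<Gamma> H A k c" using gamma_positive_intertwines A_op by blast
  qed
  moreover have "op_tuple (hat_space W) (hat_tuple g W)"
    unfolding hat_space_def hat_tuple_eq by (rule op_tuple_dsum[OF bd])
  ultimately show ?thesis unfolding W_def[symmetric] by (intro gamma_isomorphicI[OF A_op])
qed

end

section \<open>Operator bounds for bounded graded sets\<close>

lemma mat_mult_vec_self_adjoint:
  fixes M :: "complex mat"
  assumes M: "M \<in> carrier_mat n n" "mat_adjoint M = M" and f: "f \<in> coord_space {..<n}"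
  shows "((M * M) *\<^sub>v vec n (Rep_ell2 f)) \<bullet>c vec n (Rep_ell2 f) = of_real ((norm (mat_op n M f))\<^sup>2)"
proof -
  have eq: "(N *\<^sub>v vec n (Rep_ell2 f)) \<bullet>c vec n (Rep_ell2 f) = cinner f (mat_op n N f)"
    if N: "N \<in> carrier_mat n n" for N
  proof -
    have "(N *\<^sub>v vec n (Rep_ell2 f)) \<bullet>c vec n (Rep_ell2 f) =
        (\<Sum>i<n. (\<Sum>j<n. N $$ (i, j) * Rep_ell2 f j) * cnj (Rep_ell2 f i))"
      using N by (auto simp: scalar_prod_def lessThan_atLeast0 intro!: sum.cong)
    also have "\<dots> = cinner f (mat_op n N f)"
      using f by (simp add: cinner_ell2_finite[of "{..<n}"] Rep_mat_op mult.commute)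
    finally show ?thesis .
  qed
  have sa: "selfadjoint_on (coord_space {..<n}) (mat_op n M)"
    by (simp add: mat_op_selfadjoint_on_iff M)
  have "((M * M) *\<^sub>v vec n (Rep_ell2 f)) \<bullet>c vec n (Rep_ell2 f) = cinner f (mat_op n M (mat_op n M f))"
    by (simp add: eq[OF mult_carrier_mat[OF M(1) M(1)]] mat_op_mult[OF M(1) M(1)] del: assoc_mult_mat_vec)
  also have "\<dots> = cinner (mat_op n M f) (mat_op n M f)"
    using sa f mat_op_in_coord_space[of n M f] unfolding selfadjoint_on_def by metis
  finally show ?thesis by (simp only: cinner_self)
qed

text \<open>Testing R^2 - \<Sum> X_j^2 on a vector f bounds the sum of all |X_j f|^2 by R^2 |f|^2,
  and hence each of its terms.\<close>

lemma bounded_graded_norm_le: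
  assumes K: "graded_set g K" "bounded_graded K"
  obtains R where "R \<ge> 0"
    "\<And>j n X v. j < g \<Longrightarrow> X \<in> K n \<Longrightarrow> v \<in> coord_space {..<n} \<Longrightarrow> norm (mat_op n (X ! j) v) \<le> R * norm v"
proof -
  obtain R where R: "R \<ge> 0"
    "\<And>n X. X \<in> K n \<Longrightarrow> psd_mat n (of_real (R\<^sup>2) \<cdot>\<^sub>m 1\<^sub>m n - sum_squares n X)"
    using K(2) by (auto simp: bounded_graded_def)
  show thesis
  proof (rule that[OF R(1)])
    fix j n X f assume j: "j < g" and X: "X \<in> K n" and f: "f \<in> coord_space {..<n}"
    define v where "v = vec n (Rep_ell2 f)"
    have v: "v \<in> carrier_vec n" by (simp add: v_def)
    have sa: "X \<in> sa_mats g n" using K(1) X by (auto simp: graded_set_def)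
    have sum: "sum_squares n Xs \<in> carrier_mat n n \<and>
        (sum_squares n Xs *\<^sub>v v) \<bullet>c v = of_real (\<Sum>M\<leftarrow>Xs. (norm (mat_op n M f))\<^sup>2)"
      if "\<forall>M\<in>set Xs. M \<in> carrier_mat n n \<and> mat_adjoint M = M" for Xs
      using that
    proof (induction Xs)
      case Nil
      have "0\<^sub>m n n *\<^sub>v v = 0\<^sub>v n" using v by auto
      thus ?case using v by (simp add: sum_squares_def)
    next
      case (Cons M Xs)
      have M: "M \<in> carrier_mat n n" "mat_adjoint M = M" using Cons.prems by auto
      have IH: "sum_squares n Xs \<in> carrier_mat n n"
        "(sum_squares n Xs *\<^sub>v v) \<bullet>c v = of_real (\<Sum>M\<leftarrow>Xs. (norm (mat_op n M f))\<^sup>2)"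
        using Cons by auto
      have "((M * M + sum_squares n Xs) *\<^sub>v v) \<bullet>c v = ((M * M) *\<^sub>v v) \<bullet>c v + (sum_squares n Xs *\<^sub>v v) \<bullet>c v"
        using M(1) IH(1) v by (subst add_mult_distrib_mat_vec[of _ n n], auto intro!: add_scalar_prod_distrib[of _ n])
      thus ?case
        using M(1) IH mat_mult_vec_self_adjoint[OF M f] by (simp add: sum_squares_def v_def)
    qed
    have X_nth: "\<forall>M\<in>set X. M \<in> carrier_mat n n \<and> mat_adjoint M = M" using sa by (simp add: sa_mats_def)
    have vv: "v \<bullet>c v = of_real ((norm f)\<^sup>2)"
      using f unfolding cinner_self[symmetric]
      by (simp add: v_def cinner_ell2_finite[of "{..<n}"] scalar_prod_def lessThan_atLeast0 mult.commute)
    have dist: "(z \<cdot>\<^sub>v v - w) \<bullet>c v = z * (v \<bullet>c v) - w \<bullet>c v" if "w \<in> carrier_vec n" for z w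
      using v that by (simp add: minus_scalar_prod_distrib[of "z \<cdot>\<^sub>v v" n w])
    have "(of_real (R\<^sup>2) \<cdot>\<^sub>m 1\<^sub>m n - sum_squares n X) *\<^sub>v v = of_real (R\<^sup>2) \<cdot>\<^sub>v v - sum_squares n X *\<^sub>v v"
      using sum[OF X_nth] v by (subst minus_mult_distrib_mat_vec[of _ n n]) auto
    hence "((of_real (R\<^sup>2) \<cdot>\<^sub>m 1\<^sub>m n - sum_squares n X) *\<^sub>v v) \<bullet>c v =
        of_real (R\<^sup>2) * (v \<bullet>c v) - (sum_squares n X *\<^sub>v v) \<bullet>c v"
      by (simp only: dist[OF mult_mat_vec_carrier[OF conjunct1[OF sum[OF X_nth]] v]])
    moreover have "0 \<le> ((of_real (R\<^sup>2) \<cdot>\<^sub>m 1\<^sub>m n - sum_squares n X) *\<^sub>v v) \<bullet>c v"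
      using R(2)[OF X] v unfolding psd_mat_def by blast
    ultimately have "0 \<le> (of_real (R\<^sup>2 * (norm f)\<^sup>2 - (\<Sum>M\<leftarrow>X. (norm (mat_op n M f))\<^sup>2)) :: complex)"
      using sum[OF X_nth] by (simp add: vv)
    hence "(\<Sum>M\<leftarrow>X. (norm (mat_op n M f))\<^sup>2) \<le> (R * norm f)\<^sup>2"
      by (simp add: less_eq_complex_def power_mult_distrib)
    moreover have "(norm (mat_op n (X ! j) f))\<^sup>2 \<le> (\<Sum>M\<leftarrow>X. (norm (mat_op n M f))\<^sup>2)"
      using j sa_matsD(2)[OF sa]
      by (intro member_le_sum_list) auto
    ultimately have "(norm (mat_op n (X ! j) f))\<^sup>2 \<le> (R * norm f)\<^sup>2" by linarith
    thus "norm (mat_op n (X ! j) f) \<le> R * norm f"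
      by (rule power2_le_imp_le) (use R(1) in simp)
  qed
qed

section \<open>Approximation from convex cones\<close>

text \<open>A near-minimiser \<open>c\<close> of the distance from \<open>x\<close> to the cone gives a functional \<open>c - x\<close> that is
  nonnegative on the cone up to a multiple of \<open>e\<close>; neither completeness of the space nor closedness
  of the cone is needed.\<close>

lemma cone_bidual_approx:
  fixes C :: "'a::real_inner set"
  assumes zero: "0 \<in> C" and add: "\<And>c d. c \<in> C \<Longrightarrow> d \<in> C \<Longrightarrow> c + d \<in> C"
    and scale: "\<And>c t. c \<in> C \<Longrightarrow> t \<ge> 0 \<Longrightarrow> t *\<^sub>R c \<in> C"
    and M: "M \<ge> 0" "\<And>c. c \<in> C \<Longrightarrow> norm c \<le> M * inner e c"
    and dual: "\<And>F. (\<And>c. c \<in> C \<Longrightarrow> 0 \<le> inner F c) \<Longrightarrow> 0 \<le> inner F x"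
    and "\<delta> > 0"
  shows "\<exists>c\<in>C. norm (x - c) < \<delta>"
proof (rule ccontr)
  assume "\<not> ?thesis"
  hence far: "\<delta> \<le> norm (x - c)" if "c \<in> C" for c using that by force
  define D where "D = (INF c\<in>C. (norm (x - c))\<^sup>2)"
  have bdd: "bdd_below ((\<lambda>c. (norm (x - c))\<^sup>2) ` C)" by (rule bdd_belowI[of _ 0]) auto
  have D_le: "D \<le> (norm (x - c))\<^sup>2" if "c \<in> C" for c
    unfolding D_def by (rule cINF_lower[OF bdd that])
  have "\<delta>\<^sup>2 \<le> D"
    unfolding D_def using zero far \<open>\<delta> > 0\<close> by (intro cINF_greatest power_mono) auto
  hence D_pos: "D > 0" using \<open>\<delta> > 0\<close> by (smt (verit) zero_less_power)
  \<comment> \<open>In |F|^2 = <F,c> - <F,x> the first term will cost (1 + |c|^2) / 2 and the second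
    M |<e,x>|, each times \<eta>; the norm of c is at most D + 1 + |x|.\<close>
  define B where "B = (1 + (D + 1 + norm x)\<^sup>2) / 2 + M * \<bar>inner e x\<bar>"
  have B: "B > 0" using M(1) by (auto simp: B_def intro!: add_pos_nonneg)
  have le: "D \<le> \<eta> * B" if \<eta>: "0 < \<eta>" "\<eta> \<le> 1" for \<eta>
  proof -
    \<comment> \<open>The infimum is approached to within \<eta>^2, because the variations below are
      of order \<eta> and the resulting inequalities are divided by it.\<close>
    have "\<exists>c\<in>C. (norm (x - c))\<^sup>2 < D + \<eta>\<^sup>2"
      using cINF_less_iff[OF _ bdd, of "D + \<eta>\<^sup>2"] zero \<eta>(1) unfolding D_def[symmetric] by auto
    then obtain c where c: "c \<in> C" "(norm (x - c))\<^sup>2 < D + \<eta>\<^sup>2" by blast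
    define F where "F = c - x"
    have F: "inner F F < D + \<eta>\<^sup>2" using c(2) by (simp add: F_def norm_minus_commute power2_norm_eq_inner)
    have var: "D \<le> inner F F + 2 * inner F v + inner v v" if "c + v \<in> C" for v
    proof -
      have "D \<le> (norm (x - (c + v)))\<^sup>2" by (rule D_le[OF that])
      also have "\<dots> = inner F F + 2 * inner F v + inner v v"
        by (simp add: power2_norm_eq_inner F_def inner_diff_left inner_diff_right inner_add_left
            inner_add_right inner_commute algebra_simps)
      finally show ?thesis .
    qed
    \<comment> \<open>Moving c by a distance \<eta> along d shows <F,d> \<ge> - \<eta> |d|, and the
      bound |d| \<le> M <e,d> absorbs the defect.\<close>
    have "0 \<le> inner (F + (\<eta> * M) *\<^sub>R e) d" if d: "d \<in> C" for d
    proof (cases "d = 0")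
      case False
      define t where "t = \<eta> / norm d"
      have t: "t > 0" "t * norm d = \<eta>" using False \<eta>(1) by (auto simp: t_def)
      have "c + t *\<^sub>R d \<in> C" using t by (intro add c(1) scale d) auto
      from var[OF this] have "D \<le> inner F F + 2 * (t * inner F d) + (t * norm d)\<^sup>2"
        by (simp add: power_mult_distrib power2_norm_eq_inner) (simp add: power2_eq_square)
      hence "- (\<eta> * \<eta>) \<le> t * inner F d" using F t(2) by (simp add: power2_eq_square)
      moreover have "t * (\<eta> * norm d) = \<eta> * \<eta>" using t(2) by (metis mult.left_commute)
      ultimately have "t * (- (\<eta> * norm d)) \<le> t * inner F d" by (simp only: mult_minus_right)
      hence "- (\<eta> * norm d) \<le> inner F d" using t(1) by (simp only: mult_le_cancel_left_pos)
      moreover have "\<eta> * norm d \<le> \<eta> * (M * inner e d)" using M(2)[OF d] \<eta>(1) by (intro mult_left_mono) auto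
      ultimately show ?thesis by (simp add: inner_add_left mult.assoc)
    qed simp
    from dual[OF this] have Fx: "- (\<eta> * (M * inner e x)) \<le> inner F x"
      by (simp add: inner_add_left mult.assoc)
    \<comment> \<open>Shrinking c inside the cone bounds <F,c> from above by a term of order
      \<eta>.\<close>
    have "c + (- \<eta>) *\<^sub>R c \<in> C"
      using scale[OF c(1), of "1 - \<eta>"] \<eta>(2) by (simp add: scaleR_diff_left)
    from var[OF this] have "D \<le> inner F F - 2 * (\<eta> * inner F c) + (\<eta> * norm c)\<^sup>2"
      by (simp add: power_mult_distrib power2_norm_eq_inner) (simp add: power2_eq_square)
    hence "\<eta> * (2 * inner F c) \<le> \<eta> * (\<eta> * (1 + (norm c)\<^sup>2))"
      using F by (simp add: power2_eq_square algebra_simps)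
    hence Fc: "2 * inner F c \<le> \<eta> * (1 + (norm c)\<^sup>2)" using \<eta>(1) by simp
    have "(norm F)\<^sup>2 \<le> (D + 1)\<^sup>2"
    proof -
      have "(norm F)\<^sup>2 \<le> D + 1"
        using F \<eta> power_le_one[of \<eta> 2] by (simp add: power2_norm_eq_inner)
      also have "\<dots> \<le> (D + 1)\<^sup>2" using D_pos by (simp add: power2_eq_square)
      finally show ?thesis .
    qed
    hence "norm F \<le> D + 1" by (rule power2_le_imp_le) (use D_pos in simp)
    hence "norm c \<le> D + 1 + norm x"
      using norm_triangle_ineq[of F x] by (simp add: F_def)
    hence "(norm c)\<^sup>2 \<le> (D + 1 + norm x)\<^sup>2" by (intro power_mono) auto
    hence "\<eta> * (1 + (norm c)\<^sup>2) \<le> \<eta> * (1 + (D + 1 + norm x)\<^sup>2)" using \<eta>(1) by (intro mult_left_mono) auto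
    moreover have "\<eta> * (M * inner e x) \<le> \<eta> * (M * \<bar>inner e x\<bar>)" using \<eta>(1) M(1) by (intro mult_left_mono) auto
    moreover have "D \<le> inner F F" using var[of 0] c(1) by simp
    moreover have "inner F F = inner F c - inner F x" by (simp add: F_def inner_diff_right)
    moreover have "\<eta> * B = \<eta> * (1 + (D + 1 + norm x)\<^sup>2) / 2 + \<eta> * (M * \<bar>inner e x\<bar>)"
      by (simp add: B_def distrib_left)
    ultimately show "D \<le> \<eta> * B" using Fx Fc by linarith
  qed
  define \<eta> where "\<eta> = min 1 (D / (2 * B))"
  have "0 < \<eta>" "\<eta> \<le> 1" using D_pos B by (auto simp: \<eta>_def)
  from le[OF this] have "D \<le> \<eta> * B" .
  also have "\<dots> \<le> D / (2 * B) * B" using B by (intro mult_right_mono) (auto simp: \<eta>_def)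
  also have "\<dots> < D" using B D_pos by simp
  finally show False by simp
qed


section \<open>The cone of compressions\<close>

text \<open>Tuples of \<open>m\<close> matrices of size \<open>n\<close> as vectors of one inner
  product space: padding by zeros makes the type independent of the sizes.\<close>

definition qvec :: "nat \<Rightarrow> nat \<Rightarrow> (nat \<Rightarrow> nat \<Rightarrow> nat \<Rightarrow> complex) \<Rightarrow> (nat \<times> nat \<times> nat) ell2" where
  "qvec m n f = Abs_ell2 (\<lambda>p. if p \<in> {..<m} \<times> {..<n} \<times> {..<n} then f (fst p) (fst (snd p)) (snd (snd p)) else 0)"

lemma Rep_qvec: "Rep_ell2 (qvec m n f) (i, a, b) = (if i < m \<and> a < n \<and> b < n then f i a b else 0)"
proof -
  have "finite {p. p \<in> {..<m} \<times> {..<n} \<times> {..<n}}" by simp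
  thus ?thesis unfolding qvec_def by (subst Rep_Abs_ell2_if) auto
qed

lemma ell2_eqI3: "(\<And>i a b. Rep_ell2 f (i, a, b) = Rep_ell2 h (i, a, b)) \<Longrightarrow> f = h"
  by (rule ell2_eqI) (metis prod.collapse)

lemma qvec_in_coord_space: "qvec m n f \<in> coord_space ({..<m} \<times> {..<n} \<times> {..<n})"
  by (auto simp: coord_space_def Rep_qvec)

lemma cinner_qvec:
  "cinner F (qvec m n f) = (\<Sum>i<m. \<Sum>a<n. \<Sum>b<n. cnj (Rep_ell2 F (i, a, b)) * f i a b)"
proof -
  have "cinner F (qvec m n f) = cnj (\<Sum>p\<in>{..<m} \<times> {..<n} \<times> {..<n}. cnj (Rep_ell2 (qvec m n f) p) * Rep_ell2 F p)"
    by (subst cinner_commute) (simp only: cinner_ell2_finite[OF _ qvec_in_coord_space] finite_cartesian_product finite_lessThan)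
  also have "\<dots> = (\<Sum>i<m. \<Sum>a<n. \<Sum>b<n. cnj (Rep_ell2 F (i, a, b)) * f i a b)"
    by (simp add: sum.cartesian_product' Rep_qvec mult.commute)
  finally show ?thesis .
qed

lemma norm_qvec_le: "norm (qvec m n f) \<le> (\<Sum>i<m. \<Sum>a<n. \<Sum>b<n. cmod (f i a b))"
proof -
  define S where "S = {..<m} \<times> {..<n} \<times> {..<n}"
  define u where "u = (\<lambda>p. cmod (Rep_ell2 (qvec m n f) p))"
  have S: "finite S" by (simp add: S_def)
  have "(norm (qvec m n f))\<^sup>2 = (\<Sum>p\<in>S. u p * u p)"
    unfolding u_def S_def by (subst norm_ell2_finite[OF _ qvec_in_coord_space]) (auto simp: power2_eq_square)
  also have "\<dots> \<le> (\<Sum>p\<in>S. u p * sum u S)"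
    using S by (intro sum_mono mult_left_mono member_le_sum) (auto simp: u_def)
  also have "\<dots> = (sum u S)\<^sup>2" by (simp add: power2_eq_square flip: sum_distrib_right)
  finally have "norm (qvec m n f) \<le> sum u S" by (rule power2_le_imp_le) (auto simp: u_def intro: sum_nonneg)
  also have "\<dots> = (\<Sum>i<m. \<Sum>a<n. \<Sum>b<n. cmod (f i a b))"
    by (simp add: S_def u_def sum.cartesian_product' Rep_qvec)
  finally show ?thesis .
qed

text \<open>The \<open>i\<close>-th array is \<open>V\<^sup>*T\<^sub>iV\<close>, where \<open>V\<close> maps the unit vector \<open>e\<^sub>a\<close> to \<open>h a\<close>; the index \<open>0\<close> belongs to \<open>T\<^sub>0 = I\<close>.\<close>

definition gvec ::
  "nc_poly list \<Rightarrow> 'h::complex_inner set \<Rightarrow> ('h \<Rightarrow> 'h) list \<Rightarrow> nat \<Rightarrow> (nat \<Rightarrow> 'h) \<Rightarrow> (nat \<times> nat \<times> nat) ell2" where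
  "gvec \<Gamma> H A n h = qvec (Suc (length \<Gamma>)) n (\<lambda>i a b. cinner (h a) ((gens H \<Gamma> A ! i) (h b)))"

text \<open>The real functional \<open>inner F\<close> sees only the real part of the complex
  pairing with \<open>F\<close>, while a positive matrix has a real form. Adding the conjugate
  transpose repairs this and doubles the value. The generator index comes last, as
  \<open>gamma_positive\<close> expects.\<close>

definition herm_coeffs :: "(nat \<times> nat \<times> nat) ell2 \<Rightarrow> nat \<Rightarrow> nat \<Rightarrow> nat \<Rightarrow> complex" where
  "herm_coeffs F = (\<lambda>a b i. cnj (Rep_ell2 F (i, a, b)) + Rep_ell2 F (i, b, a))"

lemma herm_coeffs_pairing:
  assumes sa: "\<And>i. i < Suc (length \<Gamma>) \<Longrightarrow> selfadjoint_on H (gens H \<Gamma> A ! i)"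
    and h: "\<And>a. a < n \<Longrightarrow> h a \<in> H"
  shows "(\<Sum>a<n. \<Sum>b<n. cinner (h a) (op_comb (herm_coeffs F a b) (gens H \<Gamma> A) (h b))) =
    of_real (2 * inner F (gvec \<Gamma> H A n h))"
proof -
  define m where "m = Suc (length \<Gamma>)"
  define q where "q = (\<lambda>i a b. cinner (h a) ((gens H \<Gamma> A ! i) (h b)))"
  define S where "S = (\<Sum>i<m. \<Sum>a<n. \<Sum>b<n. cnj (Rep_ell2 F (i, a, b)) * q i a b)"
  have S: "S = cinner F (gvec \<Gamma> H A n h)"
    by (simp only: S_def gvec_def cinner_qvec m_def q_def)
  \<comment> \<open>As the generators are self-adjoint, conjugation only exchanges a and b; so the
    conjugate of the pairing is a pairing with the same entries.\<close>
  have q: "cnj (q i a b) = q i b a" if "i < m" "a < n" "b < n" for i a b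
  proof -
    have "q i b a = cinner ((gens H \<Gamma> A ! i) (h b)) (h a)"
      unfolding q_def using sa[of i] h that by (simp add: selfadjoint_on_def m_def)
    thus ?thesis unfolding q_def by (simp only: cinner_commute[of "h a"] complex_cnj_cnj)
  qed
  have "cnj S = (\<Sum>i<m. \<Sum>a<n. \<Sum>b<n. Rep_ell2 F (i, a, b) * q i b a)"
    by (simp add: S_def q)
  also have "\<dots> = (\<Sum>i<m. \<Sum>a<n. \<Sum>b<n. Rep_ell2 F (i, b, a) * q i a b)"
    by (rule sum.cong[OF refl]) (rule sum.swap)
  finally have "S + cnj S = (\<Sum>i<m. \<Sum>a<n. \<Sum>b<n. herm_coeffs F a b i * q i a b)"
    by (simp add: S_def herm_coeffs_def distrib_right sum.distrib)
  also have "\<dots> = (\<Sum>a<n. \<Sum>i<m. \<Sum>b<n. herm_coeffs F a b i * q i a b)"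
    by (rule sum.swap)
  also have "\<dots> = (\<Sum>a<n. \<Sum>b<n. \<Sum>i<m. herm_coeffs F a b i * q i a b)"
    by (rule sum.cong[OF refl]) (rule sum.swap)
  also have "\<dots> = (\<Sum>a<n. \<Sum>b<n. cinner (h a) (op_comb (herm_coeffs F a b) (gens H \<Gamma> A) (h b)))"
    by (simp add: op_comb_def cinner_sum_right cinner_scaleC_right q_def m_def del: sum.lessThan_Suc)
  finally show ?thesis
    unfolding S by (simp add: complex_add_cnj Re_cinner)
qed

context gamma_tuple
begin

lemma gens_selfadjoint_on:
  assumes A: "op_tuple H A" "\<And>j. j < g \<Longrightarrow> selfadjoint_on H (A ! j)" and i: "i < Suc (length \<Gamma>)"
  shows "selfadjoint_on H (gens H \<Gamma> A ! i)"
proof (cases i)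
  case 0
  thus ?thesis by (simp add: selfadjoint_on_def id_on_def)
next
  case (Suc l)
  hence "\<Gamma> ! l \<in> set \<Gamma>" using i by simp
  thus ?thesis
    using Suc i eval_op_selfadjoint_on[OF op_tupleD(1)[OF A(1)], of g A "\<Gamma> ! l"]
      op_tupleD(3)[OF A(1)] A(2) Gamma_poly Gamma_sym by simp
qed

lemma gens_mat:
  assumes X: "X \<in> sa_mats g n"
  shows "gens (coord_space {..<n}) \<Gamma> (map (mat_op n) X) = map (mat_op n) (1\<^sub>m n # evals_mat n \<Gamma> X)"
  using Gamma_poly by (auto simp: mat_op_one evals_op_def evals_mat_def eval_op_mat[OF X])

lemma gens_mat_selfadjoint_on:
  assumes X: "X \<in> sa_mats g n" and i: "i < Suc (length \<Gamma>)"
  shows "selfadjoint_on (coord_space {..<n}) (gens (coord_space {..<n}) \<Gamma> (map (mat_op n) X) ! i)"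
  using sa_matsD[OF X] i
  by (intro gens_selfadjoint_on[OF op_tuple_mat[OF X]]) (auto simp: mat_op_selfadjoint_on_iff)

text \<open>\<open>level_closure\<close> admits self-adjoint limits only; for \<Gamma>(X) this rests
  on the symmetry of the polynomials.\<close>

lemma evals_mat_sa_mats:
  assumes X: "X \<in> sa_mats g n"
  shows "evals_mat n \<Gamma> X \<in> sa_mats (length \<Gamma>) n"
proof -
  have "M \<in> carrier_mat n n \<and> mat_adjoint M = M" if M: "M \<in> set (evals_mat n \<Gamma> X)" for M
  proof -
    have carrier: "M \<in> carrier_mat n n" using M by (auto simp: evals_mat_def eval_mat_def)
    obtain l where l: "l < length \<Gamma>" "M = evals_mat n \<Gamma> X ! l"
      using M unfolding in_set_conv_nth by (auto simp: evals_mat_def)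
    hence "selfadjoint_on (coord_space {..<n}) (mat_op n M)"
      using gens_mat_selfadjoint_on[OF X, of "Suc l"] unfolding gens_mat[OF X] by (simp add: evals_mat_def)
    thus ?thesis using carrier by (simp add: mat_op_selfadjoint_on_iff)
  qed
  thus ?thesis using sa_matsD(1)[OF X] by (simp add: sa_mats_def) (simp add: evals_mat_def)
qed

text \<open>The generators allow arbitrary V, isometric or not, so nonnegative multiples need no
  rule of their own: they come from rescaling V by a square root.\<close>

inductive_set gcone :: "graded \<Rightarrow> nat \<Rightarrow> (nat \<times> nat \<times> nat) ell2 set" for K n where
  gen: "Y \<in> K N \<Longrightarrow> (\<And>a. a < n \<Longrightarrow> h a \<in> coord_space {..<N}) \<Longrightarrow>
    gvec \<Gamma> (coord_space {..<N}) (map (mat_op N) Y) n h \<in> gcone K n"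
| add: "c \<in> gcone K n \<Longrightarrow> d \<in> gcone K n \<Longrightarrow> c + d \<in> gcone K n"

lemma Rep_gvec:
  "Rep_ell2 (gvec \<Gamma> H A n h) (i, a, b) =
    (if i < Suc (length \<Gamma>) \<and> a < n \<and> b < n then cinner (h a) ((gens H \<Gamma> A ! i) (h b)) else 0)"
  by (simp add: gvec_def Rep_qvec)

lemma gcone_scale:
  assumes K: "graded_set g K" and "c \<in> gcone K n" "t \<ge> 0"
  shows "t *\<^sub>R c \<in> gcone K n"
  using assms(2)
proof induction
  case (gen Y N h)
  have Y: "Y \<in> sa_mats g N" using K gen(1) by (auto simp: graded_set_def)
  define s where "s = complex_of_real (sqrt t)"
  have s: "cnj s * s = of_real t"
    using assms(3) by (simp add: s_def flip: of_real_mult)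
  let ?G = "gens (coord_space {..<N}) \<Gamma> (map (mat_op N) Y)"
  have "t *\<^sub>R gvec \<Gamma> (coord_space {..<N}) (map (mat_op N) Y) n h =
      gvec \<Gamma> (coord_space {..<N}) (map (mat_op N) Y) n (\<lambda>a. s *\<^sub>C h a)"
  proof (rule ell2_eqI3)
    fix i a b
    have "cinner (s *\<^sub>C h a) ((?G ! i) (s *\<^sub>C h b)) = of_real t * cinner (h a) ((?G ! i) (h b))"
      if "i < Suc (length \<Gamma>)" "b < n"
      using bounded_opsD(4)[OF gens_bounded_ops[OF op_tuple_mat[OF Y] that(1)] gen(2)[OF that(2)]]
      by (simp add: cinner_scaleC_left cinner_scaleC_right mult.assoc[symmetric] s mult.commute[of s])
    thus "Rep_ell2 (t *\<^sub>R gvec \<Gamma> (coord_space {..<N}) (map (mat_op N) Y) n h) (i, a, b) =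
        Rep_ell2 (gvec \<Gamma> (coord_space {..<N}) (map (mat_op N) Y) n (\<lambda>a. s *\<^sub>C h a)) (i, a, b)"
      by (simp add: scaleR_ell2_def scaleC_ell2.rep_eq Rep_gvec)
  qed
  thus ?case
    using gcone.gen[of Y K N n "\<lambda>a. s *\<^sub>C h a"] gen linear_subspaceD(3)[OF linear_subspace_coord_space] by auto
next
  case (add c d)
  thus ?case by (simp add: scaleR_add_right gcone.add)
qed

text \<open>Ensures that the defect between I and the first component of a cone element is
  Hermitian, as its correction requires.\<close>

lemma gcone_hermitian:
  assumes K: "graded_set g K" and "c \<in> gcone K n" "i < Suc (length \<Gamma>)" "a < n" "b < n"
  shows "Rep_ell2 c (i, b, a) = cnj (Rep_ell2 c (i, a, b))"
  using assms(2)
proof induction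
  case (gen Y N h)
  have Y: "Y \<in> sa_mats g N" using K gen(1) by (auto simp: graded_set_def)
  let ?G = "gens (coord_space {..<N}) \<Gamma> (map (mat_op N) Y)"
  have "cinner (h b) ((?G ! i) (h a)) = cinner ((?G ! i) (h b)) (h a)"
    using gens_mat_selfadjoint_on[OF Y assms(3)] gen(2) assms(4,5) by (simp add: selfadjoint_on_def)
  also have "\<dots> = cnj (cinner (h a) ((?G ! i) (h b)))" by (rule cinner_commute)
  finally show ?case using assms(3-5) by (simp add: Rep_gvec)
qed (simp add: plus_ell2.rep_eq)

text \<open>The form of \<open>herm_coeffs F\<close> at a family h is twice the value of
  \<open>F\<close> at the generator made from h, and every family h in the space of \<open>Y\<close>
  gives a generator.\<close>

lemma gcone_dual:
  assumes K: "graded_set g K" and F: "\<And>c. c \<in> gcone K n \<Longrightarrow> 0 \<le> inner F c" and Y: "Y \<in> K N"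
  shows "gamma_positive \<Gamma> (coord_space {..<N}) (map (mat_op N) Y) n (herm_coeffs F)"
  unfolding gamma_positive_def positive_matrix_def
proof (intro allI impI)
  fix h assume h: "\<forall>a<n. h a \<in> coord_space {..<N}"
  have sa: "Y \<in> sa_mats g N" using K Y by (auto simp: graded_set_def)
  have "0 \<le> inner F (gvec \<Gamma> (coord_space {..<N}) (map (mat_op N) Y) n h)"
    using h by (intro F gcone.gen[where N = N]) (auto simp: Y)
  thus "0 \<le> (\<Sum>a<n. \<Sum>b<n. cinner (h a)
      (op_comb (herm_coeffs F a b) (gens (coord_space {..<N}) \<Gamma> (map (mat_op N) Y)) (h b)))"
    using h by (subst herm_coeffs_pairing[OF gens_mat_selfadjoint_on[OF sa]]) (auto simp: less_eq_complex_def)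
qed

text \<open>On a generator the inner product is the trace of V*V, that is the sum of all |h a|^2,
  which dominates every entry <h a, T_i h b> up to a constant; sums follow by the triangle
  inequality. This is the norm control that \<open>cone_bidual_approx\<close> demands.\<close>

lemma gcone_norm_le:
  assumes K: "graded_set g K" and A: "op_tuple (hat_space K) (hat_tuple g K)"
  obtains M where "M \<ge> 0"
    "\<And>c. c \<in> gcone K n \<Longrightarrow>
      norm c \<le> M * inner (qvec (Suc (length \<Gamma>)) n (\<lambda>i a b. if i = 0 \<and> a = b then 1 else 0)) c"
proof -
  define m where "m = Suc (length \<Gamma>)"
  define e where "e = qvec m n (\<lambda>i a b. if i = 0 \<and> a = b then 1 else 0)"
  have "\<exists>C>0. \<forall>x\<in>hat_space K. norm ((gens (hat_space K) \<Gamma> (hat_tuple g K) ! i) x) \<le> C * norm x"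
    if "i < m" for i
    using bounded_ops_bound[OF gens_bounded_ops[OF A]] that unfolding m_def by metis
  then obtain C where C: "\<And>i. i < m \<Longrightarrow> C i > 0"
    "\<And>i x. i < m \<Longrightarrow> x \<in> hat_space K \<Longrightarrow> norm ((gens (hat_space K) \<Gamma> (hat_tuple g K) ! i) x) \<le> C i * norm x"
    by metis
  define \<kappa> where "\<kappa> = (\<Sum>i<m. C i)"
  have \<kappa>: "\<kappa> \<ge> 0" "C i \<le> \<kappa>" if "i < m" for i
    unfolding \<kappa>_def using less_imp_le[OF C(1)] that by (auto intro!: sum_nonneg member_le_sum)
  have \<kappa>0: "\<kappa> \<ge> 0" using \<kappa>(1)[of 0] by (simp add: m_def)
  have inner_e: "inner e c = (\<Sum>a<n. Re (Rep_ell2 c (0, a, a)))" for c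
  proof -
    have "cinner e c = cnj (\<Sum>i<m. \<Sum>a<n. \<Sum>b<n. cnj (Rep_ell2 c (i, a, b)) * (if i = 0 \<and> a = b then 1 else 0))"
      unfolding e_def by (subst cinner_commute) (simp only: cinner_qvec)
    also have "\<dots> = (\<Sum>i<m. \<Sum>a<n. if i = 0 then Rep_ell2 c (i, a, a) else 0)"
      by (simp add: if_distrib[of "\<lambda>x. _ * x"] if_distrib[of cnj] sum.delta cong: if_cong)
        (intro sum.cong refl; auto simp: sum.delta)
    also have "\<dots> = (\<Sum>i<m. if i = 0 then \<Sum>a<n. Rep_ell2 c (i, a, a) else 0)"
      by (intro sum.cong) auto
    also have "\<dots> = (\<Sum>a<n. Rep_ell2 c (0, a, a))" by (simp add: m_def)
    finally show ?thesis by (simp flip: Re_cinner)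
  qed
  \<comment> \<open>There are m n^2 entries, each bounded by \<kappa> times the trace.\<close>
  define M where "M = real m * (real n * (real n * \<kappa>))"
  have le: "norm c \<le> M * inner e c" if "c \<in> gcone K n" for c
    using that
  proof induction
    case (gen Y N h)
    have Y: "Y \<in> sa_mats g N" using K gen(1) by (auto simp: graded_set_def)
    have idx: "(N, Y) \<in> hat_index K" using gen(1) by (simp add: hat_index_def)
    define J where "J = embed_block N (N, Y)"
    have J: "isometric_between (coord_space {..<N}) (hat_space K) J"
      using embed_block_isometric_between[OF idx, of fst] by (simp add: hat_space_def J_def)
    have inter: "intertwines g (coord_space {..<N}) (map (mat_op N) Y) (hat_tuple g K) J"
      using dsum_op_embed_block[OF idx, where d = fst] sa_matsD(2)[OF Y]
      by (simp add: intertwines_def hat_tuple_def J_def)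
    let ?G = "gens (coord_space {..<N}) \<Gamma> (map (mat_op N) Y)"
    \<comment> \<open>All blocks are restrictions of the same bounded operators on the hat space,
      which makes \<kappa> independent of \<open>Y\<close>.\<close>
    have op: "norm ((?G ! i) v) \<le> \<kappa> * norm v" if i: "i < m" and v: "v \<in> coord_space {..<N}" for i v
    proof -
      let ?u = "\<lambda>l. if l = i then 1 else 0"
      have "op_comb ?u (gens (hat_space K) \<Gamma> (hat_tuple g K)) (J v) = J (op_comb ?u ?G v)"
        by (rule op_comb_intertwines[OF _ inter op_tuple_mat[OF Y] v]) (use J in \<open>simp add: isometric_between_def\<close>)
      hence eq: "(gens (hat_space K) \<Gamma> (hat_tuple g K) ! i) (J v) = J ((?G ! i) v)"
        using i by (simp add: op_comb_unit m_def del: nth_Cons_Suc)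
      have "norm ((?G ! i) v) = norm (J ((?G ! i) v))"
        using isometric_between_norm[OF J bounded_opsD(1)[OF gens_bounded_ops[OF op_tuple_mat[OF Y]] v]] i
        by (simp add: m_def del: nth_Cons_Suc)
      also have "\<dots> \<le> C i * norm (J v)"
        unfolding eq[symmetric] using J v by (intro C(2) i) (auto simp: isometric_between_def linear_between_def)
      also have "\<dots> \<le> \<kappa> * norm v"
        unfolding isometric_between_norm[OF J v] using \<kappa>(2)[OF i] by (intro mult_right_mono) auto
      finally show ?thesis .
    qed
    define s where "s = (\<Sum>a<n. (norm (h a))\<^sup>2)"
    have "cmod (cinner (h a) ((?G ! i) (h b))) \<le> \<kappa> * s" if "i < m" "a < n" "b < n" for i a b
    proof -
      have "cmod (cinner (h a) ((?G ! i) (h b))) \<le> norm (h a) * (\<kappa> * norm (h b))"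
        using cinner_norm_le[of "h a" "(?G ! i) (h b)"] mult_left_mono[OF op[OF that(1) gen(2)[OF that(3)]], of "norm (h a)"]
        by simp
      also have "\<dots> = \<kappa> * (norm (h a) * norm (h b))" by simp
      also have "norm (h a) * norm (h b) \<le> s"
      proof -
        have "(norm (h a))\<^sup>2 \<le> s" "(norm (h b))\<^sup>2 \<le> s"
          unfolding s_def using that by (auto intro!: member_le_sum)
        moreover have "2 * (norm (h a) * norm (h b)) \<le> (norm (h a))\<^sup>2 + (norm (h b))\<^sup>2"
          using zero_le_power2[of "norm (h a) - norm (h b)"] by (simp add: power2_diff)
        ultimately show ?thesis by linarith
      qed
      finally show ?thesis using \<kappa>0 by (simp add: mult_left_mono)
    qed
    hence "norm (gvec \<Gamma> (coord_space {..<N}) (map (mat_op N) Y) n h) \<le> (\<Sum>i<m. \<Sum>a<n. \<Sum>b<n. \<kappa> * s)"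
      unfolding gvec_def m_def[symmetric] by (intro order_trans[OF norm_qvec_le] sum_mono) auto
    also have "\<dots> = M * s" by (simp add: M_def mult_ac)
    also have "s = inner e (gvec \<Gamma> (coord_space {..<N}) (map (mat_op N) Y) n h)"
      using gen(2) by (simp add: inner_e s_def Rep_gvec id_on_def cinner_self)
    finally show ?case .
  next
    case (add c d)
    thus ?case using norm_triangle_ineq[of c d] by (simp add: inner_add_right distrib_left)
  qed
  show thesis
    by (rule that[of M]) (use le \<kappa>0 in \<open>auto simp: M_def e_def m_def\<close>)
qed

end

section \<open>Compressions inside matrix convex sets\<close>

lemma sum_lessThan_add:
  fixes f :: "nat \<Rightarrow> 'a::comm_monoid_add"
  shows "(\<Sum>p<N + M. f p) = (\<Sum>p<N. f p) + (\<Sum>p<M. f (N + p))"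
  by (induction M) (auto simp: add.assoc)

text \<open>The sums are the entries of \<open>V\<^sup>*V\<close> and \<open>V\<^sup>*W\<^sub>iV\<close>.\<close>

definition compression_data :: "nat \<Rightarrow> nat \<Rightarrow> graded \<Rightarrow> (nat \<times> nat \<times> nat) ell2 \<Rightarrow> bool" where
  "compression_data r n D c \<longleftrightarrow> (\<exists>N W V. W \<in> D N \<and>
     (\<forall>a<n. \<forall>b<n. Rep_ell2 c (0, a, b) = (\<Sum>p<N. cnj (V p a) * V p b)) \<and>
     (\<forall>i<r. \<forall>a<n. \<forall>b<n. Rep_ell2 c (Suc i, a, b) =
        (\<Sum>p<N. \<Sum>q<N. cnj (V p a) * W ! i $$ (p, q) * V q b)))"

text \<open>The matrix V stacked above V' compresses the direct sum of W and W' to the sum of the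
  two compressions.\<close>

lemma compression_data_add:
  assumes D: "matrix_convex r D" and c: "compression_data r n D c" and d: "compression_data r n D d"
  shows "compression_data r n D (c + d)"
proof -
  obtain N W V where W: "W \<in> D N"
    "\<forall>a<n. \<forall>b<n. Rep_ell2 c (0, a, b) = (\<Sum>p<N. cnj (V p a) * V p b)"
    "\<forall>i<r. \<forall>a<n. \<forall>b<n. Rep_ell2 c (Suc i, a, b) =
      (\<Sum>p<N. \<Sum>q<N. cnj (V p a) * W ! i $$ (p, q) * V q b)"
    using c unfolding compression_data_def by blast
  note W = W(1) W(2,3)[rule_format]
  obtain N' W' V' where W': "W' \<in> D N'"
    "\<forall>a<n. \<forall>b<n. Rep_ell2 d (0, a, b) = (\<Sum>p<N'. cnj (V' p a) * V' p b)"
    "\<forall>i<r. \<forall>a<n. \<forall>b<n. Rep_ell2 d (Suc i, a, b) =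
      (\<Sum>p<N'. \<Sum>q<N'. cnj (V' p a) * W' ! i $$ (p, q) * V' q b)"
    using d unfolding compression_data_def by blast
  note W' = W'(1) W'(2,3)[rule_format]
  have sa: "W \<in> sa_mats r N" "W' \<in> sa_mats r N'"
    using D W(1) W'(1) by (auto simp: matrix_convex_def free_set_def graded_set_def)
  define Z where "Z = (\<lambda>p a. if p < N then V p a else V' (p - N) a)"
  have "tuple_sum N N' W W' \<in> D (N + N')"
    using D W(1) W'(1) by (auto simp: matrix_convex_def free_set_def)
  moreover have "Rep_ell2 (c + d) (0, a, b) = (\<Sum>p<N + N'. cnj (Z p a) * Z p b)" if "a < n" "b < n" for a b
    using that by (simp add: sum_lessThan_add Z_def plus_ell2.rep_eq W(2) W'(2))
  moreover have "Rep_ell2 (c + d) (Suc i, a, b) =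
      (\<Sum>p<N + N'. \<Sum>q<N + N'. cnj (Z p a) * tuple_sum N N' W W' ! i $$ (p, q) * Z q b)"
    if i: "i < r" and ab: "a < n" "b < n" for i a b
  proof -
    have carrier: "W ! i \<in> carrier_mat N N" "W' ! i \<in> carrier_mat N' N'"
      using sa_matsD(3)[OF sa(1) i] sa_matsD(3)[OF sa(2) i] by auto
    have "tuple_sum N N' W W' ! i = four_block_mat (W ! i) (0\<^sub>m N N') (0\<^sub>m N' N) (W' ! i)"
      using sa_matsD(2)[OF sa(1)] sa_matsD(2)[OF sa(2)] i by (simp add: tuple_sum_def)
    thus ?thesis
      using carrier by (simp add: sum_lessThan_add Z_def plus_ell2.rep_eq W(3)[OF i ab] W'(3)[OF i ab])
  qed
  ultimately show ?thesis unfolding compression_data_def by blast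
qed

text \<open>The first component being I says that V is an isometry, so matrix convexity applies to
  the single compression that \<open>compression_data\<close> provides.\<close>

lemma compression_data_normalized:
  assumes D: "matrix_convex r D" and c: "compression_data r n D c" and n: "0 < n"
    and unit: "\<And>a b. a < n \<Longrightarrow> b < n \<Longrightarrow> Rep_ell2 c (0, a, b) = (if a = b then 1 else 0)"
  shows "map (\<lambda>i. mat n n (\<lambda>(a, b). Rep_ell2 c (Suc i, a, b))) [0..<r] \<in> D n"
proof -
  obtain N W Z where W: "W \<in> D N"
    "\<forall>a<n. \<forall>b<n. Rep_ell2 c (0, a, b) = (\<Sum>p<N. cnj (Z p a) * Z p b)"
    "\<forall>i<r. \<forall>a<n. \<forall>b<n. Rep_ell2 c (Suc i, a, b) =
      (\<Sum>p<N. \<Sum>q<N. cnj (Z p a) * W ! i $$ (p, q) * Z q b)"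
    using c unfolding compression_data_def by blast
  note W = W(1) W(2,3)[rule_format]
  have sa: "W \<in> sa_mats r N" using D W(1) by (auto simp: matrix_convex_def free_set_def graded_set_def)
  define V where "V = mat N n (\<lambda>(p, a). Z p a)"
  have V: "V \<in> carrier_mat N n" by (simp add: V_def)
  have V': "mat_adjoint V \<in> carrier_mat n N" by (rule mat_adjoint_carrier[OF V])
  have adj: "mat_adjoint V $$ (a, p) = cnj (Z p a)" if "a < n" "p < N" for a p
    using index_mat_adjoint[OF V that] that by (simp add: V_def)
  have V_nth: "V $$ (p, a) = Z p a" if "p < N" "a < n" for p a
    using that by (simp add: V_def)
  have "mat_adjoint V * V = 1\<^sub>m n"
  proof (rule eq_matI)
    fix a b assume "a < dim_row (1\<^sub>m n :: complex mat)" "b < dim_col (1\<^sub>m n :: complex mat)"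
    hence ab: "a < n" "b < n" by auto
    have "(mat_adjoint V * V) $$ (a, b) = (\<Sum>p<N. cnj (Z p a) * Z p b)"
      using ab V V' by (auto simp: scalar_prod_def lessThan_atLeast0 adj V_nth intro!: sum.cong)
    thus "(mat_adjoint V * V) $$ (a, b) = 1\<^sub>m n $$ (a, b)"
      using W(2)[OF ab] unit[OF ab] ab by simp
  qed (use V V' in auto)
  hence "isometry_mat N n V" using n V by (simp add: isometry_mat_def)
  hence "compress V W \<in> D n" using D W(1) unfolding matrix_convex_def by blast
  also have "compress V W = map (\<lambda>i. mat n n (\<lambda>(a, b). Rep_ell2 c (Suc i, a, b))) [0..<r]"
  proof (rule nth_equalityI)
    fix i assume "i < length (compress V W)"
    hence i: "i < r" using sa_matsD(2)[OF sa] by (simp add: compress_def)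
    have Wi: "W ! i \<in> carrier_mat N N" by (rule sa_matsD(3)[OF sa i])
    have "mat_adjoint V * W ! i * V = mat n n (\<lambda>(a, b). Rep_ell2 c (Suc i, a, b))"
    proof (rule eq_matI)
      fix a b assume "a < dim_row (mat n n (\<lambda>(a, b). Rep_ell2 c (Suc i, a, b)))"
        "b < dim_col (mat n n (\<lambda>(a, b). Rep_ell2 c (Suc i, a, b)))"
      hence ab: "a < n" "b < n" by auto
      define P where "P = mat_adjoint V * W ! i"
      have P: "P \<in> carrier_mat n N" unfolding P_def using V' Wi by (rule mult_carrier_mat)
      have P_nth: "P $$ (a, q) = (\<Sum>p<N. cnj (Z p a) * W ! i $$ (p, q))" if "q < N" for q
        using ab that V' Wi by (auto simp: P_def scalar_prod_def lessThan_atLeast0 adj intro!: sum.cong)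
      have "(P * V) $$ (a, b) = (\<Sum>q<N. (\<Sum>p<N. cnj (Z p a) * W ! i $$ (p, q)) * Z q b)"
        using ab V P P_nth by (auto simp: scalar_prod_def lessThan_atLeast0 V_nth intro!: sum.cong)
      also have "\<dots> = (\<Sum>p<N. \<Sum>q<N. cnj (Z p a) * W ! i $$ (p, q) * Z q b)"
        unfolding sum_distrib_right by (rule sum.swap)
      finally show "(mat_adjoint V * W ! i * V) $$ (a, b) = mat n n (\<lambda>(a, b). Rep_ell2 c (Suc i, a, b)) $$ (a, b)"
        using W(3)[OF i ab] ab by (simp add: P_def)
    qed (use V V' in auto)
    thus "compress V W ! i = map (\<lambda>i. mat n n (\<lambda>(a, b). Rep_ell2 c (Suc i, a, b))) [0..<r] ! i"
      using i sa_matsD(2)[OF sa] by (simp add: compress_def)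
  qed (use sa_matsD(2)[OF sa] in \<open>simp add: compress_def\<close>)
  finally show ?thesis .
qed

context gamma_tuple
begin

text \<open>\<open>D\<close> stays arbitrary because \<open>matco\<close> is the intersection of all
  such sets. Each generator is a compression of a point of \<Gamma>(K), and sums are absorbed by
  direct sums.\<close>

lemma gcone_compression_data:
  assumes K: "graded_set g K" and D: "matrix_convex (length \<Gamma>) D" "\<And>N. gamma_image \<Gamma> K N \<subseteq> D N"
    and "c \<in> gcone K n"
  shows "compression_data (length \<Gamma>) n D c"
  using assms(4)
proof induction
  case (gen Y N h)
  have Y: "Y \<in> sa_mats g N" using K gen(1) by (auto simp: graded_set_def)
  define V where "V = (\<lambda>p a. Rep_ell2 (h a) p)"
  define c where "c = gvec \<Gamma> (coord_space {..<N}) (map (mat_op N) Y) n h"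
  have "evals_mat N \<Gamma> Y \<in> D N" using D(2)[of N] gen(1) by (auto simp: gamma_image_def)
  moreover have "Rep_ell2 c (0, a, b) = (\<Sum>p<N. cnj (V p a) * V p b)" if "a < n" "b < n" for a b
    using that gen(2) by (simp add: c_def Rep_gvec id_on_def V_def cinner_ell2_finite[of "{..<N}"])
  moreover have "Rep_ell2 c (Suc i, a, b) = (\<Sum>p<N. \<Sum>q<N. cnj (V p a) * evals_mat N \<Gamma> Y ! i $$ (p, q) * V q b)"
    if "i < length \<Gamma>" "a < n" "b < n" for i a b
  proof -
    have "Rep_ell2 c (Suc i, a, b) = cinner (h a) (mat_op N (evals_mat N \<Gamma> Y ! i) (h b))"
      unfolding c_def Rep_gvec gens_mat[OF Y] using that by (simp add: evals_mat_def)
    thus ?thesis using gen(2) that by (simp add: cinner_mat_op V_def)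
  qed
  ultimately show ?case unfolding compression_data_def c_def[symmetric] by blast
qed (rule compression_data_add[OF D(1)])

section \<open>Cone elements supported in the first component\<close>

lemma gcone_zero:
  assumes "K N \<noteq> {}"
  shows "0 \<in> gcone K n"
proof -
  obtain Y where Y: "Y \<in> K N" using assms by blast
  have "gvec \<Gamma> (coord_space {..<N}) (map (mat_op N) Y) n (\<lambda>a. 0) \<in> gcone K n"
    by (rule gcone.gen[where N = N and K = K, OF Y]) (simp add: linear_subspaceD(1)[OF linear_subspace_coord_space])
  also have "gvec \<Gamma> (coord_space {..<N}) (map (mat_op N) Y) n (\<lambda>a. 0) = 0"
    by (rule ell2_eqI3) (simp add: Rep_gvec zero_ell2.rep_eq)
  finally show ?thesis .
qed

lemma gcone_sum:
  assumes "K N \<noteq> {}" "\<And>s. s \<in> S \<Longrightarrow> f s \<in> gcone K n"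
  shows "sum f S \<in> gcone K n"
  using assms(2) by (induction S rule: infinite_finite_induct) (auto intro: gcone_zero[where K = K, OF assms(1)] gcone.add)

text \<open>At the point 0 of size 1 all \<gamma>_l vanish, so a row vector \<open>w\<close> in the
  role of V leaves only V*V in the first component. This is how \<Gamma>(0) = 0 and 0 \<in> K enter
  the correction.\<close>

lemma gcone_rank_one:
  assumes zero: "replicate g (0\<^sub>m 1 1) \<in> K 1"
    and \<Gamma>0: "evals_mat 1 \<Gamma> (replicate g (0\<^sub>m 1 1)) = replicate (length \<Gamma>) (0\<^sub>m 1 1)"
    and sa: "replicate g (0\<^sub>m 1 1) \<in> sa_mats g 1"
  shows "qvec (Suc (length \<Gamma>)) n (\<lambda>i a b. if i = 0 then cnj (w a) * w b else 0) \<in> gcone K n"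
proof -
  define Z0 where "Z0 = replicate g (0\<^sub>m 1 1 :: complex mat)"
  define h where "h = (\<lambda>a. w a *\<^sub>C unit_ell2 0)"
  have h: "h a \<in> coord_space {..<1}" for a
    unfolding h_def by (intro linear_subspaceD(3)[OF linear_subspace_coord_space] unit_ell2_in_coord_space) simp
  have "gvec \<Gamma> (coord_space {..<1}) (map (mat_op 1) Z0) n h \<in> gcone K n"
    by (rule gcone.gen) (use zero h in \<open>auto simp: Z0_def\<close>)
  also have "gvec \<Gamma> (coord_space {..<1}) (map (mat_op 1) Z0) n h =
      qvec (Suc (length \<Gamma>)) n (\<lambda>i a b. if i = 0 then cnj (w a) * w b else 0)"
  proof (rule ell2_eqI3)
    fix i a b
    have id: "cinner (h a) (h b) = cnj (w a) * w b" for a b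
      using h by (subst cinner_ell2_finite[of "{..<1}"])
        (auto simp: h_def scaleC_ell2.rep_eq Rep_unit_ell2)
    have ops: "gens (coord_space {..<1}) \<Gamma> (map (mat_op 1) Z0) =
        map (mat_op 1) (1\<^sub>m 1 # replicate (length \<Gamma>) (0\<^sub>m 1 1))"
      unfolding Z0_def gens_mat[OF sa] \<Gamma>0 ..
    have "cinner (h a) ((gens (coord_space {..<1}) \<Gamma> (map (mat_op 1) Z0) ! i) (h b)) =
        (if i = 0 then cnj (w a) * w b else 0)" if "i < Suc (length \<Gamma>)"
    proof (cases i)
      case 0
      thus ?thesis using h[of b] by (simp add: id_on_def id)
    next
      case (Suc l)
      thus ?thesis using that h unfolding ops by (simp add: cinner_mat_op)
    qed
    thus "Rep_ell2 (gvec \<Gamma> (coord_space {..<1}) (map (mat_op 1) Z0) n h) (i, a, b) =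
        Rep_ell2 (qvec (Suc (length \<Gamma>)) n (\<lambda>i a b. if i = 0 then cnj (w a) * w b else 0)) (i, a, b)"
      by (simp add: Rep_gvec Rep_qvec)
  qed
  finally show ?thesis .
qed

text \<open>The rank-one matrices of the vectors \<open>\<alpha>e\<^sub>s + \<beta>\<^sub>s\<^sub>te\<^sub>t\<close> with \<open>\<beta> = E/(2\<alpha>)\<close> add up to \<open>n\<alpha>\<^sup>2I + E\<close> plus the
  diagonal matrix with entries \<open>\<Sum>\<^sub>s \<bar>\<beta>\<^sub>s\<^sub>b\<bar>\<^sup>2 \<le> \<epsilon>/2\<close>; choosing \<open>n\<alpha>\<^sup>2 = \<epsilon>/2\<close>, a nonnegative diagonal is missing.\<close>

lemma gcone_near_identity:
  assumes zero: "replicate g (0\<^sub>m 1 1) \<in> K 1"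
    and \<Gamma>0: "evals_mat 1 \<Gamma> (replicate g (0\<^sub>m 1 1)) = replicate (length \<Gamma>) (0\<^sub>m 1 1)"
    and sa: "replicate g (0\<^sub>m 1 1) \<in> sa_mats g 1"
    and \<epsilon>: "\<epsilon> > 0" and n: "n > 0"
    and E: "\<And>a b. a < n \<Longrightarrow> b < n \<Longrightarrow> E b a = cnj (E a b)" "\<And>a b. a < n \<Longrightarrow> b < n \<Longrightarrow> real n * cmod (E a b) \<le> \<epsilon>"
  shows "qvec (Suc (length \<Gamma>)) n (\<lambda>i a b. if i = 0 then (if a = b then of_real \<epsilon> else 0) + E a b else 0) \<in> gcone K n"
proof -
  define m where "m = Suc (length \<Gamma>)"
  define R where "R = (\<lambda>w. qvec m n (\<lambda>i a b. if i = 0 then cnj (w a) * w b else 0))"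
  have R: "R w \<in> gcone K n" for w
    unfolding R_def m_def by (rule gcone_rank_one[where K = K, OF zero \<Gamma>0 sa])
  define \<alpha> where "\<alpha> = sqrt (\<epsilon> / (2 * real n))"
  have \<alpha>: "\<alpha> > 0" "real n * \<alpha>\<^sup>2 = \<epsilon> / 2" using \<epsilon> n by (auto simp: \<alpha>_def)
  define \<beta> where "\<beta> = (\<lambda>s t. E s t / of_real (2 * \<alpha>))"
  define \<rho> where "\<rho> = (\<lambda>b. \<epsilon> / 2 - (\<Sum>s<n. (cmod (\<beta> s b))\<^sup>2))"
  have \<rho>: "\<rho> b \<ge> 0" if b: "b < n" for b
  proof -
    have "(cmod (\<beta> s b))\<^sup>2 \<le> \<epsilon> / (2 * real n)" if "s < n" for s
    proof -
      have "(real n * cmod (E s b))\<^sup>2 \<le> \<epsilon>\<^sup>2" using E(2)[OF that b] by (intro power_mono) auto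
      hence "(cmod (E s b))\<^sup>2 \<le> \<epsilon>\<^sup>2 / (real n)\<^sup>2" using n by (simp add: power_mult_distrib field_simps)
      moreover have "(cmod (\<beta> s b))\<^sup>2 = (cmod (E s b))\<^sup>2 / (4 * \<alpha>\<^sup>2)"
        using \<alpha>(1) by (simp add: \<beta>_def norm_divide norm_mult power_divide power_mult_distrib)
      moreover have "4 * \<alpha>\<^sup>2 = 2 * \<epsilon> / real n" using \<alpha>(2) n by (simp add: field_simps)
      ultimately have "(cmod (\<beta> s b))\<^sup>2 \<le> (\<epsilon>\<^sup>2 / (real n)\<^sup>2) / (2 * \<epsilon> / real n)"
        using \<epsilon> by (metis divide_right_mono less_imp_le mult_pos_pos of_nat_0_le_iff zero_le_divide_iff zero_less_numeral)
      also have "\<dots> = \<epsilon> / (2 * real n)" using \<epsilon> n by (simp add: power2_eq_square)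
      finally show ?thesis .
    qed
    hence "(\<Sum>s<n. (cmod (\<beta> s b))\<^sup>2) \<le> (\<Sum>s<n. \<epsilon> / (2 * real n))" by (intro sum_mono) auto
    thus ?thesis using n by (simp add: \<rho>_def)
  qed
  define w where "w = (\<lambda>s t x. (if x = s then of_real \<alpha> else 0) + (if x = t then \<beta> s t else 0))"
  define z where "z = (\<lambda>s x. if x = s then complex_of_real (sqrt (\<rho> s)) else 0)"
  have "(\<Sum>s<n. \<Sum>t<n. R (w s t)) + (\<Sum>s<n. R (z s)) \<in> gcone K n"
    using zero by (intro gcone.add gcone_sum[where N = 1] R) auto
  also have "(\<Sum>s<n. \<Sum>t<n. R (w s t)) + (\<Sum>s<n. R (z s)) =
      qvec m n (\<lambda>i a b. if i = 0 then (if a = b then of_real \<epsilon> else 0) + E a b else 0)"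
  proof (rule ell2_eqI3)
    fix i a b
    have "(\<Sum>s<n. \<Sum>t<n. cnj (w s t a) * w s t b) + (\<Sum>s<n. cnj (z s a) * z s b) =
        (if a = b then of_real \<epsilon> else 0) + E a b" if ab: "a < n" "b < n"
    proof -
      have "(\<Sum>s<n. \<Sum>t<n. cnj (w s t a) * w s t b) =
          (\<Sum>s<n. \<Sum>t<n. (if a = s then if b = s then of_real (\<alpha>\<^sup>2) else 0 else 0)) +
          (\<Sum>s<n. \<Sum>t<n. (if a = s then if b = t then of_real \<alpha> * \<beta> s t else 0 else 0)) +
          (\<Sum>s<n. \<Sum>t<n. (if b = s then if a = t then of_real \<alpha> * cnj (\<beta> s t) else 0 else 0)) +
          (\<Sum>s<n. \<Sum>t<n. (if a = t then if b = t then cnj (\<beta> s t) * \<beta> s t else 0 else 0))"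
        unfolding sum.distrib[symmetric]
        by (intro sum.cong refl) (simp add: w_def distrib_left distrib_right power2_eq_square)
      also have "(\<Sum>s<n. \<Sum>t<n. (if a = s then if b = s then of_real (\<alpha>\<^sup>2) else 0 else 0)) =
          (if a = b then of_real (real n * \<alpha>\<^sup>2) else 0 :: complex)"
        using ab by (simp add: sum.delta if_distrib[of "(*) _"] cong: if_cong)
      also have "(\<Sum>s<n. \<Sum>t<n. (if a = s then if b = t then of_real \<alpha> * \<beta> s t else 0 else 0)) = of_real \<alpha> * \<beta> a b"
        using ab by (subst sum.swap) (simp add: sum.delta)
      also have "(\<Sum>s<n. \<Sum>t<n. (if b = s then if a = t then of_real \<alpha> * cnj (\<beta> s t) else 0 else 0)) =
          of_real \<alpha> * cnj (\<beta> b a)"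
        using ab by (subst sum.swap) (simp add: sum.delta)
      also have "(\<Sum>s<n. \<Sum>t<n. (if a = t then if b = t then cnj (\<beta> s t) * \<beta> s t else 0 else 0)) =
          (if a = b then of_real (\<Sum>s<n. (cmod (\<beta> s b))\<^sup>2) else 0)"
        using ab by (simp add: sum.delta complex_norm_square mult.commute del: of_real_power)
      \<comment> \<open>As E is Hermitian and \<alpha> real, the two cross terms agree; each is half
        of E.\<close>
      also have "of_real \<alpha> * cnj (\<beta> b a) = of_real \<alpha> * \<beta> a b"
        using E(1)[OF ab] by (simp add: \<beta>_def)
      finally have "(\<Sum>s<n. \<Sum>t<n. cnj (w s t a) * w s t b) =
          (if a = b then of_real (\<epsilon> / 2) else 0) + 2 * (of_real \<alpha> * \<beta> a b) +
          (if a = b then of_real (\<Sum>s<n. (cmod (\<beta> s b))\<^sup>2) else 0)"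
        by (simp add: \<alpha>(2))
      moreover have "2 * (of_real \<alpha> * \<beta> a b) = E a b" using \<alpha>(1) by (simp add: \<beta>_def)
      moreover have "(\<Sum>s<n. cnj (z s a) * z s b) = (\<Sum>s<n. if s = a then if a = b then of_real (\<rho> b) else 0 else 0)"
        using \<rho>[OF ab(2)] by (intro sum.cong refl) (auto simp: z_def simp flip: of_real_mult)
      moreover have "(\<Sum>s<n. if s = a then if a = b then of_real (\<rho> b) else 0 else 0) =
          (if a = b then of_real (\<rho> b) else 0 :: complex)"
        using ab by (simp add: sum.delta')
      ultimately show ?thesis by (simp add: \<rho>_def)
    qed
    thus "Rep_ell2 ((\<Sum>s<n. \<Sum>t<n. R (w s t)) + (\<Sum>s<n. R (z s))) (i, a, b) =
        Rep_ell2 (qvec m n (\<lambda>i a b. if i = 0 then (if a = b then of_real \<epsilon> else 0) + E a b else 0)) (i, a, b)"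
      by (cases "a < n \<and> b < n") (auto simp: plus_ell2.rep_eq sum_Rep_ell2 R_def Rep_qvec m_def)
  qed
  finally show ?thesis by (simp only: m_def)
qed

section \<open>Part (b): points of the matrix range of the hat tuple\<close>

lemma gcone_approx:
  assumes K: "graded_set g K" "K N \<noteq> {}"
    and bd: "\<And>j. j < g \<Longrightarrow> dsum_bounded (hat_index K) fst (\<lambda>a. snd a ! j)"
    and X: "X \<in> gamma_matrix_range g \<Gamma> (hat_space K) (hat_tuple g K) n" and "\<delta> > 0"
  shows "\<exists>c\<in>gcone K n. norm (gvec \<Gamma> (coord_space {..<n}) (map (mat_op n) X) n unit_ell2 - c) < \<delta>"
proof -
  have sa: "X \<in> sa_mats g n" using X by (simp add: gamma_matrix_range_def)
  have A: "op_tuple (hat_space K) (hat_tuple g K)"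
    unfolding hat_space_def hat_tuple_eq by (rule op_tuple_dsum[OF bd])
  obtain M where M: "M \<ge> 0" "\<And>c. c \<in> gcone K n \<Longrightarrow>
      norm c \<le> M * inner (qvec (Suc (length \<Gamma>)) n (\<lambda>i a b. if i = 0 \<and> a = b then 1 else 0)) c"
    using gcone_norm_le[OF K(1) A] by blast
  show ?thesis
  proof (rule cone_bidual_approx[OF _ _ _ M _ \<open>\<delta> > 0\<close>])
    show "0 \<in> gcone K n" by (rule gcone_zero[where K = K, OF K(2)])
    show "c + d \<in> gcone K n" if "c \<in> gcone K n" "d \<in> gcone K n" for c d
      using that by (rule gcone.add)
    show "t *\<^sub>R c \<in> gcone K n" if "c \<in> gcone K n" "t \<ge> 0" for c t
      by (rule gcone_scale[OF K(1) that])
    fix F assume F: "\<And>c. c \<in> gcone K n \<Longrightarrow> 0 \<le> inner F c"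
    have "gamma_positive \<Gamma> (hat_space K) (hat_tuple g K) n (herm_coeffs F)"
      using gcone_dual[OF K(1) F] by (subst gamma_positive_hat_iff[OF K(1) bd]) auto
    hence "gamma_positive \<Gamma> (coord_space {..<n}) (map (mat_op n) X) n (herm_coeffs F)"
      by (rule gamma_positive_matrix_range[OF X])
    \<comment> \<open>The n unit vectors, taken together as one vector of the n-fold sum, test the
      form at V = I; this pairs \<open>F\<close> with (I, \<Gamma>(X)).\<close>
    hence "0 \<le> (\<Sum>a<n. \<Sum>b<n. cinner (unit_ell2 a)
        (op_comb (herm_coeffs F a b) (gens (coord_space {..<n}) \<Gamma> (map (mat_op n) X)) (unit_ell2 b)))"
      unfolding gamma_positive_def positive_matrix_def by (simp add: unit_ell2_in_coord_space)
    also have "\<dots> = of_real (2 * inner F (gvec \<Gamma> (coord_space {..<n}) (map (mat_op n) X) n unit_ell2))"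
      by (rule herm_coeffs_pairing[OF gens_mat_selfadjoint_on[OF sa]]) (simp_all add: unit_ell2_in_coord_space)
    finally show "0 \<le> inner F (gvec \<Gamma> (coord_space {..<n}) (map (mat_op n) X) n unit_ell2)"
      by (simp add: less_eq_complex_def)
  qed
qed

text \<open>The approximants have a first component only close to I, while
  \<open>compression_data_normalized\<close> asks for I exactly, so the correction is made inside
  the cone, before passing to compressions.\<close>

lemma evals_mat_in_closure_matco:
  assumes K: "graded_set g K" "replicate g (0\<^sub>m 1 1) \<in> K 1"
    and \<Gamma>0: "evals_mat 1 \<Gamma> (replicate g (0\<^sub>m 1 1)) = replicate (length \<Gamma>) (0\<^sub>m 1 1)"
    and bd: "\<And>j. j < g \<Longrightarrow> dsum_bounded (hat_index K) fst (\<lambda>a. snd a ! j)"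
    and X: "X \<in> gamma_matrix_range g \<Gamma> (hat_space K) (hat_tuple g K) n"
  shows "evals_mat n \<Gamma> X \<in> level_closure (length \<Gamma>) (matco (length \<Gamma>) (gamma_image \<Gamma> K)) n"
proof -
  define r where "r = length \<Gamma>"
  have sa: "X \<in> sa_mats g n" using X by (simp add: gamma_matrix_range_def)
  have n: "0 < n" by (rule sa_matsD(1)[OF sa])
  have sa0: "replicate g (0\<^sub>m 1 1) \<in> sa_mats g 1" using K by (auto simp: graded_set_def)
  define x where "x = gvec \<Gamma> (coord_space {..<n}) (map (mat_op n) X) n unit_ell2"
  have x0: "Rep_ell2 x (0, a, b) = (if a = b then 1 else 0)" if "a < n" "b < n" for a b
    using that by (simp add: x_def Rep_gvec id_on_def unit_ell2_in_coord_space
        cinner_ell2_finite[of "{..<n}"] Rep_unit_ell2 if_distrib[of cnj] sum.delta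
        if_distrib[of "\<lambda>z. z * _"] cong: if_cong)
  have x1: "Rep_ell2 x (Suc i, a, b) = evals_mat n \<Gamma> X ! i $$ (a, b)" if "i < r" "a < n" "b < n" for i a b
    using that unfolding x_def Rep_gvec gens_mat[OF sa]
    by (simp add: r_def evals_mat_def cinner_mat_op_unit)
  define \<epsilon> where "\<epsilon> = (\<lambda>k. 1 / real (Suc k))"
  have \<epsilon>: "\<epsilon> k > 0" for k by (simp add: \<epsilon>_def)
  have \<epsilon>_lim: "\<epsilon> \<longlonglongrightarrow> 0" unfolding \<epsilon>_def by (rule LIMSEQ_Suc[OF lim_1_over_n])
  \<comment> \<open>The tolerance is the one of \<open>gcone_near_identity\<close>: n times each
    entry of the defect is at most \<epsilon>.\<close>
  have "\<exists>c\<in>gcone K n. norm (x - c) < \<epsilon> k / real n" for k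
    unfolding x_def using K(2) n \<epsilon>[of k] by (intro gcone_approx[OF K(1) _ bd X, of 1]) auto
  then obtain c where c: "\<And>k. c k \<in> gcone K n" "\<And>k. norm (x - c k) < \<epsilon> k / real n"
    by metis
  have near: "cmod (Rep_ell2 x p - Rep_ell2 (c k) p) \<le> \<epsilon> k / real n" for p k
    using Rep_ell2_le_norm[of "x - c k" p] c(2)[of k] by (simp add: minus_ell2.rep_eq)
  define E where "E = (\<lambda>k a b. (if a = b then 1 else 0) - Rep_ell2 (c k) (0, a, b))"
  have E: "E k b a = cnj (E k a b)" "real n * cmod (E k a b) \<le> \<epsilon> k" if "a < n" "b < n" for k a b
  proof -
    show "E k b a = cnj (E k a b)"
      using gcone_hermitian[OF K(1) c(1) _ that, of 0] by (auto simp: E_def)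
    show "real n * cmod (E k a b) \<le> \<epsilon> k"
      using near[of "(0, a, b)" k] x0[OF that] n by (simp add: E_def field_simps)
  qed
  \<comment> \<open>The first component of the sum is exactly (1 + \<epsilon>) I, while the others
    are those of \<open>c k\<close>. Rescaling normalizes the first and changes the others by a
    factor tending to 1.\<close>
  define d where "d = (\<lambda>k. (1 / (1 + \<epsilon> k)) *\<^sub>R (c k + qvec (Suc r) n
      (\<lambda>i a b. if i = 0 then (if a = b then of_real (\<epsilon> k) else 0) + E k a b else 0)))"
  have d: "d k \<in> gcone K n" for k
  proof -
    have "qvec (Suc r) n (\<lambda>i a b. if i = 0 then (if a = b then of_real (\<epsilon> k) else 0) + E k a b else 0) \<in> gcone K n"
      unfolding r_def by (rule gcone_near_identity[where K = K, OF K(2) \<Gamma>0 sa0 \<epsilon> n E])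
    thus ?thesis
      unfolding d_def using less_imp_le[OF \<epsilon>[of k]] by (intro gcone_scale[OF K(1)] gcone.add[OF c(1)]) auto
  qed
  have Rep_d: "Rep_ell2 (d k) (i, a, b) = (1 / (1 + of_real (\<epsilon> k))) * (Rep_ell2 (c k) (i, a, b) +
      (if i = 0 then (if a = b then of_real (\<epsilon> k) else 0) + E k a b else 0))"
    if "i < Suc r" "a < n" "b < n" for k i a b
    using that by (simp add: d_def scaleR_ell2_def scaleC_ell2.rep_eq plus_ell2.rep_eq Rep_qvec)
  have d0: "Rep_ell2 (d k) (0, a, b) = (if a = b then 1 else 0)" if "a < n" "b < n" for k a b
  proof -
    have "1 + \<epsilon> k \<noteq> 0" using \<epsilon>[of k] by linarith
    hence "complex_of_real (1 + \<epsilon> k) \<noteq> 0" by (simp only: of_real_eq_0_iff not_False_eq_True)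
    hence "(1 :: complex) + of_real (\<epsilon> k) \<noteq> 0" by simp
    thus ?thesis using that by (simp add: Rep_d E_def)
  qed
  define S where "S = (\<lambda>k. map (\<lambda>i. mat n n (\<lambda>(a, b). Rep_ell2 (d k) (Suc i, a, b))) [0..<r])"
  have "S k \<in> matco r (gamma_image \<Gamma> K) n" for k
    unfolding matco_def
  proof (rule InterI, clarify)
    fix D assume D: "matrix_convex r D" "\<forall>m. gamma_image \<Gamma> K m \<subseteq> D m"
    have "compression_data r n D (d k)"
      using gcone_compression_data[OF K(1), of D] D d unfolding r_def by blast
    thus "S k \<in> D n" unfolding S_def by (rule compression_data_normalized[OF D(1) _ n d0])
  qed
  moreover have "tuple_tendsto r n S (evals_mat n \<Gamma> X)"
    unfolding tuple_tendsto_def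
  proof (intro allI impI)
    fix i a b assume i: "i < r" and ab: "a < n" "b < n"
    have "(\<lambda>k. Rep_ell2 (c k) (Suc i, a, b)) \<longlonglongrightarrow> Rep_ell2 x (Suc i, a, b)"
    proof (rule LIM_zero_cancel, rule tendsto_0_le)
      show "(\<lambda>k. \<epsilon> k / real n) \<longlonglongrightarrow> 0" using tendsto_divide[OF \<epsilon>_lim tendsto_const, of "real n"] n by simp
      show "\<forall>\<^sub>F k in sequentially. norm (Rep_ell2 (c k) (Suc i, a, b) - Rep_ell2 x (Suc i, a, b)) \<le> norm (\<epsilon> k / real n) * 1"
        using near less_imp_le[OF \<epsilon>] by (simp add: norm_minus_commute)
    qed
    moreover have "(\<lambda>k. complex_of_real (\<epsilon> k)) \<longlonglongrightarrow> 0" using tendsto_of_real[OF \<epsilon>_lim] by simp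
    ultimately have "(\<lambda>k. (1 / (1 + of_real (\<epsilon> k))) * Rep_ell2 (c k) (Suc i, a, b)) \<longlonglongrightarrow>
        (1 / (1 + 0)) * Rep_ell2 x (Suc i, a, b)"
      by (intro tendsto_intros) auto
    thus "(\<lambda>k. S k ! i $$ (a, b)) \<longlonglongrightarrow> evals_mat n \<Gamma> X ! i $$ (a, b)"
      using i ab by (simp add: S_def Rep_d x1)
  qed
  ultimately show ?thesis
    using evals_mat_sa_mats[OF sa] unfolding level_closure_def r_def by blast
qed

end

theorem theorem2p21:
  fixes g r :: nat and \<Gamma> :: "nc_poly list"
  assumes "1 \<le> g" and "g \<le> r" and "length \<Gamma> = r"
    and "\<forall>p\<in>set \<Gamma>. p \<in> nc_polys g \<and> symmetric_nc p"
    and "\<forall>j<g. \<Gamma> ! j = nc_var j"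
  shows
    "(\<forall>(H :: 'h::complex_inner set) A.
        hilbert_space H \<and> selfadjoint_tuple g H A \<and> semi_finite g H A \<and>
        op_lin_indep (id_on H # evals_op H \<Gamma> A) \<longrightarrow>
        gamma_isomorphic \<Gamma> H A
          (hat_space (gamma_matrix_range g \<Gamma> H A))
          (hat_tuple g (gamma_matrix_range g \<Gamma> H A))) \<and>
     (evals_mat 1 \<Gamma> (replicate g (0\<^sub>m 1 1)) = replicate r (0\<^sub>m 1 1) \<longrightarrow>
      (\<forall>K. gamma_convex g \<Gamma> K \<and> closed_graded g K \<and> bounded_graded K \<and>
           replicate g (0\<^sub>m 1 1) \<in> K 1 \<and>
           K = gamma_preimage g \<Gamma> (level_closure r (matco r (gamma_image \<Gamma> K))) \<longrightarrow>
           K = gamma_matrix_range g \<Gamma> (hat_space K) (hat_tuple g K)))"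
proof -
  interpret gamma_tuple g \<Gamma>
    using assms by unfold_locales auto
  show ?thesis
  proof (intro conjI allI impI)
    fix H :: "'h set" and A
    assume "hilbert_space H \<and> selfadjoint_tuple g H A \<and> semi_finite g H A \<and>
        op_lin_indep (id_on H # evals_op H \<Gamma> A)"
    thus "gamma_isomorphic \<Gamma> H A (hat_space (gamma_matrix_range g \<Gamma> H A))
        (hat_tuple g (gamma_matrix_range g \<Gamma> H A))"
      by (intro semi_finite_gamma_isomorphic) auto
  next
    fix K
    assume \<Gamma>0: "evals_mat 1 \<Gamma> (replicate g (0\<^sub>m 1 1)) = replicate r (0\<^sub>m 1 1)"
      and "gamma_convex g \<Gamma> K \<and> closed_graded g K \<and> bounded_graded K \<and>
           replicate g (0\<^sub>m 1 1) \<in> K 1 \<and>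
           K = gamma_preimage g \<Gamma> (level_closure r (matco r (gamma_image \<Gamma> K)))"
    hence K: "graded_set g K" "bounded_graded K" "replicate g (0\<^sub>m 1 1) \<in> K 1"
      and pre: "K = gamma_preimage g \<Gamma> (level_closure r (matco r (gamma_image \<Gamma> K)))"
      by (auto simp: gamma_convex_def free_set_def)
    obtain R where R: "R \<ge> 0" "\<And>j n X v. j < g \<Longrightarrow> X \<in> K n \<Longrightarrow> v \<in> coord_space {..<n} \<Longrightarrow>
        norm (mat_op n (X ! j) v) \<le> R * norm v"
      using bounded_graded_norm_le[OF K(1,2)] by metis
    \<comment> \<open>The bound on \<open>K\<close> makes the direct sum over its points a tuple of
      bounded operators.\<close>
    have bd: "dsum_bounded (hat_index K) fst (\<lambda>a. snd a ! j)" if "j < g" for j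
      using that R by (intro dsum_bounded_hat) blast+
    show "K = gamma_matrix_range g \<Gamma> (hat_space K) (hat_tuple g K)"
    proof (intro ext equalityI)
      fix n
      show "K n \<subseteq> gamma_matrix_range g \<Gamma> (hat_space K) (hat_tuple g K) n"
        by (rule subset_gamma_matrix_range_hat[OF K(1) bd])
      show "gamma_matrix_range g \<Gamma> (hat_space K) (hat_tuple g K) n \<subseteq> K n"
      proof
        fix X assume X: "X \<in> gamma_matrix_range g \<Gamma> (hat_space K) (hat_tuple g K) n"
        have "evals_mat n \<Gamma> X \<in> level_closure r (matco r (gamma_image \<Gamma> K)) n"
          using evals_mat_in_closure_matco[OF K(1,3) _ bd X] \<Gamma>0 assms(3) by simp
        moreover have "X \<in> sa_mats g n" using X by (simp add: gamma_matrix_range_def)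
        ultimately have "X \<in> gamma_preimage g \<Gamma> (level_closure r (matco r (gamma_image \<Gamma> K))) n"
          by (simp add: gamma_preimage_def)
        thus "X \<in> K n" using pre by simp
      qed
    qed
  qed
qed

end
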